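(* Let $a,b>0$ be constants with $a+b<\tfrac12$. There exists $\varepsilon_0>0$ such that for every fixed $0<\varepsilon<\varepsilon_0$ the following holds. Consider data $m,n,\boldsymbol{s},\boldsymbol{t},H$ with $m,n\to\infty$ such that, uniformly over $j,k$: $s_j-s$, $x_j$, $t_k-t$, $y_k$ are $O(n^{1/2+\varepsilon})$; $X=O(n^{1+2\varepsilon})$; $n=o(m^{1+\varepsilon})$, $m=o(n^{1+\varepsilon})$; and $\frac{(1-2\lambda)^2}{8A}\bigl(1+\frac{5m}{6n}+\frac{5n}{6m}\bigr)\le a\log n$. Let $G$ be a uniformly random element of $\mathcal{B}(\boldsymbol{s},\boldsymbol{t})$. Then (i) the probability that $G$ is edge-disjoint from $H$ is $(1-\lambda)^X\operatorname{miss}(m,n)$, and (ii) the probability that $G$ contains $H$ as a subgraph (i.e. $E(H)\subseteq E(G)$) is $\lambda^X\operatorname{hit}(m,n)$, where \begin{align*} \operatorname{miss}(m,n)=\exp\Bigl(&\frac{\lambda X}{2(1-\lambda)}\Bigl(\frac1n+\frac1m\Bigr)+\frac{\lambda X^2}{2(1-\lambda)mn}-\frac{1}{1-\lambda}\Bigl(\frac{R_{1,1}}{n}+\frac{C_{1,1}}{m}\Bigr)-\frac{Y}{\lambda(1-\lambda)mn}\\ &+\frac{\lambda}{2(1-\lambda)}\Bigl(\frac{R_{0,2}}{n}+\frac{C_{0,2}}{m}\Bigr)+\frac{\lambda(1-2\lambda)}{6(1-\lambda)^2}\Bigl(\frac{R_{0,3}}{n^2}+\frac{C_{0,3}}{m^2}\Bigr)\\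 &-\frac{1-2\lambda}{2(1-\lambda)^2}\Bigl(\frac{R_{1,2}}{n^2}+\frac{C_{1,2}}{m^2}\Bigr)-\frac{1}{2(1-\lambda)^2}\Bigl(\frac{R_{2,1}}{n^2}+\frac{C_{2,1}}{m^2}\Bigr)+O(n^{-b})\Bigr) \end{align*} and \begin{align*} \operatorname{hit}(m,n)=\exp\Bigl(&\frac{(1-\lambda)X}{2\lambda}\Bigl(\frac1n+\frac1m\Bigr)+\frac{(1-\lambda)X^2}{2\lambda mn}+\frac1\lambda\Bigl(\frac{R_{1,1}}{n}+\frac{C_{1,1}}{m}\Bigr)-\frac{1}{2\lambda^2}\Bigl(\frac{R_{2,1}}{n^2}+\frac{C_{2,1}}{m^2}\Bigr)\\ &-\frac{1+\lambda}{2\lambda}\Bigl(\frac{R_{0,2}}{n}+\frac{C_{0,2}}{m}\Bigr)+\frac{1+2\lambda}{2\lambda^2}\Bigl(\frac{R_{1,2}}{n^2}+\frac{C_{1,2}}{m^2}\Bigr)\\ &-\frac{(1+\lambda)(1+2\lambda)}{6\lambda^2}\Bigl(\frac{R_{0,3}}{n^2}+\frac{C_{0,3}}{m^2}\Bigr)-\frac{Y-Y_{0,1}-Y_{1,0}+Y_{1,1}}{\lambda(1-\lambda)mn}+O(n^{-b})\Bigr). \end{align*}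
   Context: Let $\boldsymbol{s}=(s_1,\dots,s_m)$, $\boldsymbol{t}=(t_1,\dots,t_n)$ be vectors of positive integers with equal sums. $\mathcal{B}(\boldsymbol{s},\boldsymbol{t})$ is the set of simple bipartite graphs on $\{u_1,\dots,u_m\}\cup\{v_1,\dots,v_n\}$ (edges only between $u$'s and $v$'s) with $\deg u_j=s_j$, $\deg v_k=t_k$. $H$ is a fixed bipartite graph on the same vertex set, with degrees $x_j$ of $u_j$ and $y_k$ of $v_k$. Define $s=m^{-1}\sum_j s_j$, $t=n^{-1}\sum_k t_k$, $\lambda=s/n=t/m$, $A=\tfrac12\lambda(1-\lambda)$, $\delta_j=s_j-s+\lambda x_j$, $\eta_k=t_k-t+\lambda y_k$, $X=\sum_j x_j$ (the number of edges of $H$), $Y=\sum_{u_jv_k\in E(H)}\delta_j\eta_k$. For nonnegative integers $h,\ell$: $R_{h,\ell}=\sum_{j=1}^m\delta_j^hx_j^\ell$, $C_{h,\ell}=\sum_{k=1}^n\eta_k^hy_k^\ell$. Also $Y_{1,1}=\sum_{u_jv_k\in E(H)}x_jy_k$, $Y_{0,1}=\sum_{u_jv_k\in E(H)}\delta_jy_k$, $Y_{1,0}=\sum_{u_jv_k\in E(H)}x_j\eta_k$. Asymptotic notation refers to $m,n\to\infty$. *)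

theory Defs
  imports "HOL-Analysis.Analysis" "HOL-Library.Landau_Symbols"
begin

text \<open>Bipartite graphs on u_0..u_(m-1), v_0..v_(n-1) are represented by their edge
sets E \<subseteq> {..<m} \<times> {..<n}; a pair (j,k) is the edge u_j v_k.\<close>

definition deg_u :: "(nat \<times> nat) set \<Rightarrow> nat \<Rightarrow> nat" where
  "deg_u E j = card {k. (j, k) \<in> E}"

definition deg_v :: "(nat \<times> nat) set \<Rightarrow> nat \<Rightarrow> nat" where
  "deg_v E k = card {j. (j, k) \<in> E}"

definition bip_graphs :: "nat \<Rightarrow> nat \<Rightarrow> (nat \<Rightarrow> nat) \<Rightarrow> (nat \<Rightarrow> nat) \<Rightarrow> (nat \<times> nat) set set" where
  "bip_graphs m n s t = {E. E \<subseteq> {..<m} \<times> {..<n} \<and>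
      (\<forall>j<m. deg_u E j = s j) \<and> (\<forall>k<n. deg_v E k = t k)}"

definition prob_B :: "nat \<Rightarrow> nat \<Rightarrow> (nat \<Rightarrow> nat) \<Rightarrow> (nat \<Rightarrow> nat) \<Rightarrow> ((nat \<times> nat) set \<Rightarrow> bool) \<Rightarrow> real" where
  "prob_B m n s t P = real (card {G \<in> bip_graphs m n s t. P G}) / real (card (bip_graphs m n s t))"

definition sbar :: "nat \<Rightarrow> (nat \<Rightarrow> nat) \<Rightarrow> real" where
  "sbar m s = (\<Sum>j<m. real (s j)) / real m"

definition tbar :: "nat \<Rightarrow> (nat \<Rightarrow> nat) \<Rightarrow> real" where
  "tbar n t = (\<Sum>k<n. real (t k)) / real n"

definition lam :: "nat \<Rightarrow> nat \<Rightarrow> (nat \<Rightarrow> nat) \<Rightarrow> real" where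
  "lam m n s = sbar m s / real n"

definition AA :: "nat \<Rightarrow> nat \<Rightarrow> (nat \<Rightarrow> nat) \<Rightarrow> real" where
  "AA m n s = lam m n s * (1 - lam m n s) / 2"

definition delta :: "nat \<Rightarrow> nat \<Rightarrow> (nat \<Rightarrow> nat) \<Rightarrow> (nat \<times> nat) set \<Rightarrow> nat \<Rightarrow> real" where
  "delta m n s H j = real (s j) - sbar m s + lam m n s * real (deg_u H j)"

definition eta :: "nat \<Rightarrow> nat \<Rightarrow> (nat \<Rightarrow> nat) \<Rightarrow> (nat \<Rightarrow> nat) \<Rightarrow> (nat \<times> nat) set \<Rightarrow> nat \<Rightarrow> real" where
  "eta m n s t H k = real (t k) - tbar n t + lam m n s * real (deg_v H k)"

definition XX :: "(nat \<times> nat) set \<Rightarrow> real" where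
  "XX H = real (card H)"

definition YY :: "nat \<Rightarrow> nat \<Rightarrow> (nat \<Rightarrow> nat) \<Rightarrow> (nat \<Rightarrow> nat) \<Rightarrow> (nat \<times> nat) set \<Rightarrow> real" where
  "YY m n s t H = (\<Sum>(j,k)\<in>H. delta m n s H j * eta m n s t H k)"

definition RR :: "nat \<Rightarrow> nat \<Rightarrow> (nat \<Rightarrow> nat) \<Rightarrow> (nat \<times> nat) set \<Rightarrow> nat \<Rightarrow> nat \<Rightarrow> real" where
  "RR m n s H h l = (\<Sum>j<m. delta m n s H j ^ h * real (deg_u H j) ^ l)"

definition CC :: "nat \<Rightarrow> nat \<Rightarrow> (nat \<Rightarrow> nat) \<Rightarrow> (nat \<Rightarrow> nat) \<Rightarrow> (nat \<times> nat) set \<Rightarrow> nat \<Rightarrow> nat \<Rightarrow> real" where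
  "CC m n s t H h l = (\<Sum>k<n. eta m n s t H k ^ h * real (deg_v H k) ^ l)"

definition Y11 :: "(nat \<times> nat) set \<Rightarrow> real" where
  "Y11 H = (\<Sum>(j,k)\<in>H. real (deg_u H j) * real (deg_v H k))"

definition Y01 :: "nat \<Rightarrow> nat \<Rightarrow> (nat \<Rightarrow> nat) \<Rightarrow> (nat \<times> nat) set \<Rightarrow> real" where
  "Y01 m n s H = (\<Sum>(j,k)\<in>H. delta m n s H j * real (deg_v H k))"

definition Y10 :: "nat \<Rightarrow> nat \<Rightarrow> (nat \<Rightarrow> nat) \<Rightarrow> (nat \<Rightarrow> nat) \<Rightarrow> (nat \<times> nat) set \<Rightarrow> real" where
  "Y10 m n s t H = (\<Sum>(j,k)\<in>H. real (deg_u H j) * eta m n s t H k)"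

definition miss_main :: "nat \<Rightarrow> nat \<Rightarrow> (nat \<Rightarrow> nat) \<Rightarrow> (nat \<Rightarrow> nat) \<Rightarrow> (nat \<times> nat) set \<Rightarrow> real" where
  "miss_main m n s t H =
    (let l = lam m n s; X = XX H; M = real m; N = real n;
         R = RR m n s H; C = CC m n s t H in
       l * X / (2 * (1 - l)) * (1 / N + 1 / M)
     + l * X\<^sup>2 / (2 * (1 - l) * M * N)
     - 1 / (1 - l) * (R 1 1 / N + C 1 1 / M)
     - YY m n s t H / (l * (1 - l) * M * N)
     + l / (2 * (1 - l)) * (R 0 2 / N + C 0 2 / M)
     + l * (1 - 2 * l) / (6 * (1 - l)\<^sup>2) * (R 0 3 / N\<^sup>2 + C 0 3 / M\<^sup>2)
     - (1 - 2 * l) / (2 * (1 - l)\<^sup>2) * (R 1 2 / N\<^sup>2 + C 1 2 / M\<^sup>2)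
     - 1 / (2 * (1 - l)\<^sup>2) * (R 2 1 / N\<^sup>2 + C 2 1 / M\<^sup>2))"

definition hit_main :: "nat \<Rightarrow> nat \<Rightarrow> (nat \<Rightarrow> nat) \<Rightarrow> (nat \<Rightarrow> nat) \<Rightarrow> (nat \<times> nat) set \<Rightarrow> real" where
  "hit_main m n s t H =
    (let l = lam m n s; X = XX H; M = real m; N = real n;
         R = RR m n s H; C = CC m n s t H in
       (1 - l) * X / (2 * l) * (1 / N + 1 / M)
     + (1 - l) * X\<^sup>2 / (2 * l * M * N)
     + 1 / l * (R 1 1 / N + C 1 1 / M)
     - 1 / (2 * l\<^sup>2) * (R 2 1 / N\<^sup>2 + C 2 1 / M\<^sup>2)
     - (1 + l) / (2 * l) * (R 0 2 / N + C 0 2 / M)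
     + (1 + 2 * l) / (2 * l\<^sup>2) * (R 1 2 / N\<^sup>2 + C 1 2 / M\<^sup>2)
     - (1 + l) * (1 + 2 * l) / (6 * l\<^sup>2) * (R 0 3 / N\<^sup>2 + C 0 3 / M\<^sup>2)
     - (YY m n s t H - Y01 m n s H - Y10 m n s t H + Y11 H) / (l * (1 - l) * M * N))"

end

theory Submission
  imports Defs "HOL-Real_Asymp.Real_Asymp"
begin

text \<open>The graphs avoiding \<open>H\<close> are counted by forbidding the edges of \<open>H\<close> one at a time, so
it suffices to know, in the ensemble of graphs avoiding a set \<open>F\<close>, the probability of a single
edge with error \<open>n powr (-3/2 + o(1))\<close>.

Moving an edge from row \<open>a\<close> to row \<open>b\<close> compares the edges \<open>(a,k)\<close> and \<open>(b,k)\<close>: the difference of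
their probabilities is the mean of a quotient whose denominator is the number of columns adjacent to
\<open>b\<close> but not to \<open>a\<close>. A second switching argument shows that this number is of order \<open>n\<close>
outside an exponentially small event, which gives the probabilities up to \<open>n powr (-1/2 + o(1))\<close>.
Conditioning on further edges being present stays within the same class of ensembles, so an
estimate of edge probabilities is also an estimate of the mean and variance of numerator and
denominator. Each such estimate improves the error of the quotient, and (because the column sums of
the probabilities are known exactly) of the probabilities, by a factor \<open>n powr (-1/2 + o(1))\<close>;
two rounds suffice. The probability of containing \<open>H\<close> follows by passing to complements.\<close>


section \<open>Switchings in conditioned graph ensembles\<close>

text \<open>The accuracy is dictated by the length of the telescoping product: \<open>H\<close> may
  have about n powr (1 + 2 * \<epsilon>) edges, so an error n powr (-3/2 + o(1)) per edge adds up to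
  n powr (-1/2 + o(1)), which beats n powr (-b) for small \<epsilon> because b < 1/2. With q = sqrt
  n, every edge probability is thus needed up to order 1/q^3, and all terms of order 1/q and 1/q^2
  must be exact.

  The obstacle is the denominator. Pointwise it is only known to be at least 1, so a rare event on
  which it is small could spoil any expansion; this event is excluded by switchings through a third
  row. The density hypothesis keeps lambda * (1 - lambda) above a constant over log n, so that the
  typical denominator, of size lambda * (1 - lambda) * n, dominates every fluctuation of size sqrt n
  even after losses n powr o(1).

  Conditions on further edges act as a budget: each round of improvement spends a bounded number of
  them, so the rounds start with a generous supply and the last one needs a bound for the
  unconditioned ensemble only.\<close>

definition sw :: "nat \<Rightarrow> nat \<Rightarrow> nat \<Rightarrow> nat \<Rightarrow> (nat \<times> nat) set \<Rightarrow> (nat \<times> nat) set" where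
  "sw a b k l G = (G - {(b,k),(a,l)}) \<union> {(a,k),(b,l)}"

lemma sw_mem:
  "(i,j) \<in> sw a b k l G \<longleftrightarrow>
     ((i,j) \<in> G \<and> (i,j) \<noteq> (b,k) \<and> (i,j) \<noteq> (a,l)) \<or> (i,j) = (a,k) \<or> (i,j) = (b,l)"
  unfolding sw_def by auto

lemma sw_sw:
  assumes "a \<noteq> b" "k \<noteq> l" "(b,k) \<in> G" "(a,l) \<in> G" "(a,k) \<notin> G" "(b,l) \<notin> G"
  shows "sw b a k l (sw a b k l G) = G"
  using assms unfolding sw_def by auto

lemma card_exchange:
  assumes "finite S" "x \<in> S" "y \<notin> S"
  shows "card (insert y (S - {x})) = card S"
  using assms by (metis DiffD1 card_Suc_Diff1 card_insert_disjoint finite_Diff)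

lemma sw_bip_graphs:
  assumes G: "G \<in> bip_graphs m n s t" and ne: "a \<noteq> b" "k \<noteq> l"
    and e: "(b,k) \<in> G" "(a,l) \<in> G" "(a,k) \<notin> G" "(b,l) \<notin> G"
  shows "sw a b k l G \<in> bip_graphs m n s t"
proof -
  have sub: "G \<subseteq> {..<m} \<times> {..<n}" using G by (auto simp: bip_graphs_def)
  have finr: "finite {k. (i,k) \<in> G}" for i
    by (rule finite_subset[of _ "{..<n}"]) (use sub in auto)
  have finc: "finite {i. (i,k) \<in> G}" for k
    by (rule finite_subset[of _ "{..<m}"]) (use sub in auto)
  have du: "deg_u (sw a b k l G) i = deg_u G i" for i
  proof -
    consider "i = a" | "i = b" | "i \<noteq> a" "i \<noteq> b" by blast
    then show ?thesis
    proof cases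
      case 1
      have "{j. (a,j) \<in> sw a b k l G} = insert k ({j. (a,j) \<in> G} - {l})"
        using ne by (auto simp: sw_mem)
      with 1 show ?thesis unfolding deg_u_def using card_exchange[of "{j. (a,j) \<in> G}" l k] finr e by simp
    next
      case 2
      have "{j. (b,j) \<in> sw a b k l G} = insert l ({j. (b,j) \<in> G} - {k})"
        using ne by (auto simp: sw_mem)
      with 2 show ?thesis unfolding deg_u_def using card_exchange[of "{j. (b,j) \<in> G}" k l] finr e by simp
    next
      case 3
      then show ?thesis unfolding deg_u_def by (auto simp: sw_mem intro!: arg_cong[where f=card])
    qed
  qed
  have dv: "deg_v (sw a b k l G) j = deg_v G j" for j
  proof -
    consider "j = k" | "j = l" | "j \<noteq> k" "j \<noteq> l" by blast
    then show ?thesis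
    proof cases
      case 1
      have "{i. (i,k) \<in> sw a b k l G} = insert a ({i. (i,k) \<in> G} - {b})"
        using ne by (auto simp: sw_mem)
      with 1 show ?thesis unfolding deg_v_def using card_exchange[of "{i. (i,k) \<in> G}" b a] finc e by simp
    next
      case 2
      have "{i. (i,l) \<in> sw a b k l G} = insert b ({i. (i,l) \<in> G} - {a})"
        using ne by (auto simp: sw_mem)
      with 2 show ?thesis unfolding deg_v_def using card_exchange[of "{i. (i,l) \<in> G}" a b] finc e by simp
    next
      case 3
      then show ?thesis unfolding deg_v_def by (auto simp: sw_mem intro!: arg_cong[where f=card])
    qed
  qed
  have "sw a b k l G \<subseteq> {..<m} \<times> {..<n}" using sub e by (auto simp: sw_def)
  then show ?thesis using G du dv by (auto simp: bip_graphs_def)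
qed

lemma bip_graphs_sub: "G \<in> bip_graphs m n s t \<Longrightarrow> G \<subseteq> {..<m} \<times> {..<n}"
  by (auto simp: bip_graphs_def)

lemma finite_bip_graphs: "finite (bip_graphs m n s t)"
  by (rule finite_subset[of _ "Pow ({..<m} \<times> {..<n})"]) (auto simp: bip_graphs_def)

section \<open>Graph ensembles with prescribed and forbidden edges\<close>

locale bip_ensemble =
  fixes m n :: nat and s t :: "nat \<Rightarrow> nat"
begin

text \<open>Conditioning on one more edge being present or absent only enlarges \<open>A\<close> or
  \<open>U\<close>, so a bound that is uniform in both sets applies again to the conditional
  distributions.\<close>

definition ens :: "(nat \<times> nat) set \<Rightarrow> (nat \<times> nat) set \<Rightarrow> (nat \<times> nat) set set" where
  "ens A U = {G \<in> bip_graphs m n s t. A \<subseteq> G \<and> G \<inter> U = {}}"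

text \<open>Counts instead of probabilities: a bound of the form \<open>\<bar>NN (insert e A) U - p
  * NN A U\<bar> \<le> \<kappa> * NN A U\<close> remains meaningful for an empty ensemble, so
  positivity need not be carried through the conditioning.\<close>

definition NN :: "(nat \<times> nat) set \<Rightarrow> (nat \<times> nat) set \<Rightarrow> real" where
  "NN A U = real (card (ens A U))"

text \<open>The columns in which the edge at row \<open>a\<close> may be moved to row \<open>b\<close>
without violating the constraints \<open>A\<close> and \<open>U\<close>.\<close>

definition wset :: "(nat \<times> nat) set \<Rightarrow> (nat \<times> nat) set \<Rightarrow> nat \<Rightarrow> nat \<Rightarrow> (nat \<times> nat) set \<Rightarrow> nat set" where
  "wset A U a b G = {k. (a,k) \<in> G - A \<and> (b,k) \<notin> G \<union> U}"

lemma finite_ens [simp]: "finite (ens A U)"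
  using finite_bip_graphs by (auto simp: ens_def)

lemma NN_nonneg [simp]: "NN A U \<ge> 0" by (simp add: NN_def)

lemma ens_box: "G \<in> ens A U \<Longrightarrow> G \<subseteq> {..<m} \<times> {..<n}"
  by (auto simp: ens_def bip_graphs_def)

lemma finite_row: "G \<subseteq> {..<m} \<times> {..<n} \<Longrightarrow> finite {k. (a,k) \<in> G}"
  by (rule finite_subset[of _ "{..<n}"]) auto

lemma finite_col: "G \<subseteq> {..<m} \<times> {..<n} \<Longrightarrow> finite {j. (j,k) \<in> G}"
  by (rule finite_subset[of _ "{..<m}"]) auto

lemma finite_wset: "G \<subseteq> {..<m} \<times> {..<n} \<Longrightarrow> finite (wset A U a b G)"
  by (rule finite_subset[of _ "{..<n}"]) (auto simp: wset_def)

lemma NN_split: "NN A U = NN (insert e A) U + NN A (insert e U)"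
proof -
  have "ens A U = ens (insert e A) U \<union> ens A (insert e U)"
    "ens (insert e A) U \<inter> ens A (insert e U) = {}"
    by (auto simp: ens_def)
  then show ?thesis unfolding NN_def by (simp add: card_Un_disjoint)
qed

lemma NN_le_A: "NN (A \<union> B) U \<le> NN A U"
  unfolding NN_def of_nat_le_iff by (rule card_mono[OF finite_ens]) (auto simp: ens_def)

lemma NN_insert_le: "NN (insert e A) U \<le> NN A U"
  unfolding NN_def of_nat_le_iff by (rule card_mono[OF finite_ens]) (auto simp: ens_def)

lemma NN_insert_U_le: "NN A (insert e U) \<le> NN A U"
  unfolding NN_def of_nat_le_iff by (rule card_mono[OF finite_ens]) (auto simp: ens_def)

lemma NN_eq_sum: "NN (A \<union> B) U = (\<Sum>G\<in>ens A U. of_bool (B \<subseteq> G))"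
proof -
  have "ens (A \<union> B) U = {G \<in> ens A U. B \<subseteq> G}" by (auto simp: ens_def)
  then show ?thesis by (simp add: NN_def sum.If_cases of_bool_def Int_def)
qed

text \<open>Double counting of pairs of a graph and one of its edges in column k: each graph has
  \<open>t k\<close> of them, and those forced by \<open>A\<close> lie outside the index
  set.\<close>

lemma NN_col_sum:
  assumes "k < n"
  shows "(\<Sum>j | j < m \<and> (j,k) \<notin> A \<union> U. NN (insert (j,k) A) U)
     = (real (t k) - real (card {j. (j,k) \<in> A})) * NN A U"
proof -
  let ?J = "{j. j < m \<and> (j,k) \<notin> A \<union> U}"
  have "(\<Sum>j\<in>?J. NN (insert (j,k) A) U) = (\<Sum>j\<in>?J. \<Sum>G\<in>ens A U. of_bool ((j,k) \<in> G))"
    using NN_eq_sum[of A "{(j,k)}" U for j] by simp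
  also have "\<dots> = (\<Sum>G\<in>ens A U. \<Sum>j\<in>?J. of_bool ((j,k) \<in> G))" by (rule sum.swap)
  also have "\<dots> = (\<Sum>G\<in>ens A U. real (t k) - real (card {j. (j,k) \<in> A}))"
  proof (rule sum.cong[OF refl])
    fix G assume G: "G \<in> ens A U"
    have box: "G \<subseteq> {..<m} \<times> {..<n}" using ens_box G .
    have tk: "card {j. (j,k) \<in> G} = t k" using G assms by (auto simp: ens_def bip_graphs_def deg_v_def)
    have sub: "{j. (j,k) \<in> A} \<subseteq> {j. (j,k) \<in> G}" using G by (auto simp: ens_def)
    have "(\<Sum>j\<in>?J. of_bool ((j,k) \<in> G)) = real (card {j \<in> ?J. (j,k) \<in> G})"
      by (simp add: sum.If_cases of_bool_def Int_def)
    also have "{j \<in> ?J. (j,k) \<in> G} = {j. (j,k) \<in> G} - {j. (j,k) \<in> A}"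
      using G box by (auto simp: ens_def)
    also have "real (card \<dots>) = real (t k) - real (card {j. (j,k) \<in> A})"
      using card_Diff_subset[OF finite_subset[OF sub finite_col[OF box]] sub] tk
        card_mono[OF finite_col[OF box] sub] by (simp add: of_nat_diff)
    finally show "(\<Sum>j\<in>?J. of_bool ((j,k) \<in> G)) = real (t k) - real (card {j. (j,k) \<in> A})" .
  qed
  finally show ?thesis by (simp add: NN_def mult.commute)
qed

text \<open>The third claim carries the idea: column k leaves \<open>wset A U b a\<close> and l
  enters it, so the number of reverse switchings is the same before and after the switching. The
  sets refer to the original \<open>A\<close> and \<open>U\<close>, since relative to the enlarged
  ones the column k itself would not be movable.\<close>

lemma sw_ens:
  assumes G: "G \<in> ens (insert (b,k) A) (insert (a,k) U)" and ne: "a \<noteq> b"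
    and ak: "(b,k) \<notin> A \<union> U" "(a,k) \<notin> A \<union> U" and l: "l \<in> wset A U a b G"
  shows "sw a b k l G \<in> ens (insert (a,k) A) (insert (b,k) U)"
    "l \<in> wset A U b a (sw a b k l G)"
    "card (wset A U b a (sw a b k l G)) = card (wset A U b a G)"
    "sw b a k l (sw a b k l G) = G"
proof -
  have e: "(b,k) \<in> G" "(a,l) \<in> G" "(a,k) \<notin> G" "(b,l) \<notin> G" "(a,l) \<notin> A" "(b,l) \<notin> U"
    using G l by (auto simp: ens_def wset_def)
  have kl: "k \<noteq> l" using e by auto
  show "sw b a k l (sw a b k l G) = G" using e ne kl by (intro sw_sw) auto
  have "sw a b k l G \<in> bip_graphs m n s t"
    using sw_bip_graphs[OF _ ne kl] e G by (auto simp: ens_def)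
  moreover have "insert (a,k) A \<subseteq> sw a b k l G" using G e ak by (auto simp: ens_def sw_def)
  moreover have "sw a b k l G \<inter> insert (b,k) U = {}" using G e ak kl ne by (auto simp: ens_def sw_def)
  ultimately show "sw a b k l G \<in> ens (insert (a,k) A) (insert (b,k) U)" by (simp add: ens_def)
  have lU: "(a,l) \<notin> U" using G e by (auto simp: ens_def)
  have bA: "(b,l) \<notin> A" using G e by (auto simp: ens_def)
  show "l \<in> wset A U b a (sw a b k l G)" using e ne kl lU bA by (auto simp: wset_def sw_mem)
  have "wset A U b a (sw a b k l G) = insert l (wset A U b a G - {k})"
    using e ne kl lU bA ak by (auto simp: wset_def sw_mem)
  moreover have "k \<in> wset A U b a G" "l \<notin> wset A U b a G"
    using e ak by (auto simp: wset_def)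
  ultimately show "card (wset A U b a (sw a b k l G)) = card (wset A U b a G)"
    using card_exchange[of "wset A U b a G" k l] finite_wset[OF ens_box[OF G]] by simp
qed

text \<open>Each switching of a graph \<open>G\<close> on the left is weighted by the reciprocal of the number of
reverse switchings, which is a quantity readable off \<open>G\<close> itself; no estimate is lost.\<close>

lemma switch_identity:
  assumes ne: "a \<noteq> b" and ak: "(a,k) \<notin> A \<union> U" "(b,k) \<notin> A \<union> U"
  shows "(\<Sum>G\<in>ens (insert (b,k) A) (insert (a,k) U).
            real (card (wset A U a b G)) / real (card (wset A U b a G)))
       = real (card {G \<in> ens (insert (a,k) A) (insert (b,k) U). wset A U b a G \<noteq> {}})"
proof -
  let ?X = "ens (insert (b,k) A) (insert (a,k) U)" and ?Y = "ens (insert (a,k) A) (insert (b,k) U)"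
  let ?w = "\<lambda>G. 1 / real (card (wset A U b a G))"
  have fin: "finite (wset A U c d G)" if "G \<in> ?X \<or> G \<in> ?Y" for c d G
    using that finite_wset ens_box by blast
  have "(\<Sum>G\<in>?X. real (card (wset A U a b G)) / real (card (wset A U b a G)))
     = (\<Sum>G\<in>?X. \<Sum>l\<in>wset A U a b G. ?w G)" by simp
  also have "\<dots> = (\<Sum>(G,l)\<in>(SIGMA G:?X. wset A U a b G). ?w G)"
    by (rule sum.Sigma) (use fin in auto)
  also have "\<dots> = (\<Sum>(G,l)\<in>(SIGMA G:?Y. wset A U b a G). ?w G)"
  proof (rule sum.reindex_bij_witness[where i = "\<lambda>(G,l). (sw b a k l G, l)" and j = "\<lambda>(G,l). (sw a b k l G, l)"])
    fix x assume "x \<in> (SIGMA G:?X. wset A U a b G)"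
    then obtain G l where x: "x = (G,l)" "G \<in> ?X" "l \<in> wset A U a b G" by auto
    note f = sw_ens[OF x(2) ne ak(2) ak(1) x(3)]
    show "(case case x of (G,l) \<Rightarrow> (sw a b k l G, l) of (G,l) \<Rightarrow> (sw b a k l G, l)) = x"
      using x f by simp
    show "(case x of (G,l) \<Rightarrow> (sw a b k l G, l)) \<in> (SIGMA G:?Y. wset A U b a G)"
      using x f by simp
    show "(case case x of (G,l) \<Rightarrow> (sw a b k l G, l) of (G,l) \<Rightarrow> ?w G) = (case x of (G,l) \<Rightarrow> ?w G)"
      using x f by simp
  next
    fix x assume "x \<in> (SIGMA G:?Y. wset A U b a G)"
    then obtain G l where x: "x = (G,l)" "G \<in> ?Y" "l \<in> wset A U b a G" by auto
    note f = sw_ens[OF x(2) ne[symmetric] ak(1) ak(2) x(3)]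
    show "(case case x of (G,l) \<Rightarrow> (sw b a k l G, l) of (G,l) \<Rightarrow> (sw a b k l G, l)) = x"
      using x f by simp
    show "(case x of (G,l) \<Rightarrow> (sw b a k l G, l)) \<in> (SIGMA G:?X. wset A U a b G)"
      using x f by simp
  qed
  also have "\<dots> = (\<Sum>G\<in>?Y. \<Sum>l\<in>wset A U b a G. ?w G)"
    by (rule sum.Sigma[symmetric]) (use fin in auto)
  \<comment> \<open>A graph with r > 0 reverse switchings receives r times the weight 1/r; one
    without any receives the empty sum, which is why it has to be accounted for separately
    later.\<close>
  also have "\<dots> = (\<Sum>G\<in>?Y. of_bool (wset A U b a G \<noteq> {}))"
    by (rule sum.cong) (use fin in auto)
  also have "\<dots> = real (card {G \<in> ?Y. wset A U b a G \<noteq> {}})"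
    by (simp add: sum.If_cases of_bool_def Int_def)
  finally show ?thesis .
qed

text \<open>Graphs containing both edges occur in both counts and cancel. On the remaining graphs
  with (b,k) but not (a,k) the denominator is positive, because k itself is a movable column; the
  last summand collects the graphs that no switching reaches.\<close>

lemma NN_switch_difference:
  assumes ne: "a \<noteq> b" and ak: "(a,k) \<notin> A \<union> U" "(b,k) \<notin> A \<union> U"
  shows "NN (insert (a,k) A) U - NN (insert (b,k) A) U
      = (\<Sum>G\<in>ens (insert (b,k) A) (insert (a,k) U).
            (real (card (wset A U a b G)) - real (card (wset A U b a G))) / real (card (wset A U b a G)))
       + real (card {G \<in> ens (insert (a,k) A) (insert (b,k) U). wset A U b a G = {}})"
proof -
  let ?X = "ens (insert (b,k) A) (insert (a,k) U)" and ?Y = "ens (insert (a,k) A) (insert (b,k) U)"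
  have pos: "card (wset A U b a G) > 0" if "G \<in> ?X" for G
  proof -
    have "k \<in> wset A U b a G" using that ak by (auto simp: wset_def ens_def)
    then show ?thesis using finite_wset[OF ens_box[OF that]] by (auto simp: card_gt_0_iff)
  qed
  have "NN (insert (a,k) A) U = NN (insert (b,k) (insert (a,k) A)) U + real (card ?Y)"
    using NN_split[of "insert (a,k) A" U "(b,k)"] by (simp add: NN_def)
  moreover have "NN (insert (b,k) A) U = NN (insert (b,k) (insert (a,k) A)) U + real (card ?X)"
    using NN_split[of "insert (b,k) A" U "(a,k)"] by (simp add: NN_def insert_commute)
  moreover have "real (card ?Y) = real (card {G \<in> ?Y. wset A U b a G \<noteq> {}}) + real (card {G \<in> ?Y. wset A U b a G = {}})"
  proof -
    have "card ({G \<in> ?Y. wset A U b a G \<noteq> {}} \<union> {G \<in> ?Y. wset A U b a G = {}})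
        = card {G \<in> ?Y. wset A U b a G \<noteq> {}} + card {G \<in> ?Y. wset A U b a G = {}}"
      by (rule card_Un_disjoint) auto
    moreover have "{G \<in> ?Y. wset A U b a G \<noteq> {}} \<union> {G \<in> ?Y. wset A U b a G = {}} = ?Y" by blast
    ultimately have "card ?Y = card {G \<in> ?Y. wset A U b a G \<noteq> {}} + card {G \<in> ?Y. wset A U b a G = {}}"
      by metis
    then show ?thesis by simp
  qed
  moreover have "(\<Sum>G\<in>?X. (real (card (wset A U a b G)) - real (card (wset A U b a G))) / real (card (wset A U b a G)))
    = (\<Sum>G\<in>?X. real (card (wset A U a b G)) / real (card (wset A U b a G)) - 1)"
    by (rule sum.cong) (use pos in \<open>auto simp: diff_divide_distrib\<close>)
  ultimately show ?thesis
    using switch_identity[OF ne ak] by (simp add: sum_subtractf)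
qed

end


section \<open>Rows differ in many columns\<close>

text \<open>Here \<open>q\<close> is the square root of \<open>n\<close>, and \<open>L\<close> is a slowly growing factor (later
\<open>n powr (3 * \<epsilon>)\<close>) that absorbs all constants, logarithms and small powers of \<open>n\<close>, so that
every error term takes the form \<open>L ^ i / q ^ j\<close>.\<close>

locale dense_bip = bip_ensemble m n s t for m n :: nat and s t :: "nat \<Rightarrow> nat" +
  fixes lam L q :: real
  assumes q2: "q\<^sup>2 = real n" and q_pos: "q > 0"
    and L_ge: "L \<ge> 1000" and L_q: "L ^ 50 \<le> q"
    and lam_ge: "1 / L \<le> lam" and lam_le: "1 / L \<le> 1 - lam"
    and m_le: "real m \<le> L * real n" and n_le: "real n \<le> L * real m"
    and s_dev: "\<And>j. j < m \<Longrightarrow> \<bar>real (s j) - lam * real n\<bar> \<le> L * q"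
    and t_dev: "\<And>k. k < n \<Longrightarrow> \<bar>real (t k) - lam * real m\<bar> \<le> L * q"
    and sum_s: "(\<Sum>j<m. real (s j)) = lam * real m * real n"
    and sum_t: "(\<Sum>k<n. real (t k)) = lam * real m * real n"
begin

section \<open>Size estimates in powers of \<open>L\<close> and \<open>q\<close>\<close>

abbreviation gam :: real where "gam \<equiv> lam * (1 - lam)"

lemma L_pos: "L > 0" and L1: "L \<ge> 1" using L_ge by auto

lemma L_mono: "i \<le> j \<Longrightarrow> L ^ i \<le> L ^ j" using L1 by (rule power_increasing[rotated])

text \<open>One more power of \<open>L\<close> pays for any constant up to 1000; this is how
  numerical constants vanish from all later bounds.\<close>

lemma L_absorb: "i < j \<Longrightarrow> 0 \<le> c \<Longrightarrow> c \<le> 1000 \<Longrightarrow> c * L ^ i \<le> L ^ j"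
proof -
  assume "i < j" "0 \<le> c" "c \<le> 1000"
  then have "c * L ^ i \<le> L * L ^ i" using L_ge L_pos by (intro mult_right_mono) auto
  also have "\<dots> \<le> L ^ j" using L_mono[of "Suc i" j] \<open>i < j\<close> by simp
  finally show ?thesis .
qed

lemma L_le_q: "i \<le> 50 \<Longrightarrow> L ^ i \<le> q" using L_mono[of i 50] L_q by linarith

lemma q_ge: "q \<ge> 1000" using L_le_q[of 1] L_ge by simp

lemma n_pos: "real n > 0" using q2 q_pos by (metis zero_less_power)

lemma m_pos: "real m > 0" using n_le n_pos L_pos by (smt (verit) mult_nonneg_nonpos)

lemma lam_pos: "lam > 0" and lam1: "lam < 1"
  using lam_ge lam_le L_pos by (smt (verit) divide_pos_pos)+

lemma gam_ge: "gam \<ge> 1 / L\<^sup>2"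
proof -
  have "1 / L * (1 / L) \<le> lam * (1 - lam)"
    using lam_ge lam_le L_pos lam_pos lam1 by (intro mult_mono) auto
  then show ?thesis by (simp add: power2_eq_square)
qed

lemma gam_pos: "gam > 0" using lam_pos lam1 by simp
lemma gam_le: "gam \<le> 1" using lam_pos lam1 by (simp add: mult_le_one)

text \<open>Since \<open>gam\<close> is at least 1/L^2 and q is at least L^42, the leading term
  \<open>gam * n\<close> exceeds every error of size \<open>L ^ i * q\<close> with i well below
  40.\<close>

lemma gamn_ge: "gam * real n \<ge> L ^ 40 * q"
proof -
  have "L ^ 42 * q \<le> q * q" using L_le_q[of 42] q_pos by (intro mult_right_mono) auto
  then have "L ^ 42 * q \<le> n" using q2 by (simp add: power2_eq_square)
  then have "L ^ 42 * q / L\<^sup>2 \<le> n / L\<^sup>2" using L_pos by (intro divide_right_mono) auto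
  also have "\<dots> \<le> gam * n" using mult_right_mono[OF gam_ge, of n] by simp
  finally have "L ^ 42 * q / L\<^sup>2 \<le> gam * n" .
  moreover have "L ^ 42 * q / L\<^sup>2 = L ^ 40 * q" using L_pos by (simp add: field_simps flip: power_add)
  ultimately show ?thesis by linarith
qed

section \<open>Overlap of two rows and switchings through a third\<close>

lemma row_card: "G \<in> ens A U \<Longrightarrow> i < m \<Longrightarrow> card {k. (i,k) \<in> G} = s i"
  by (auto simp: ens_def bip_graphs_def deg_u_def)

lemma col_card: "G \<in> ens A U \<Longrightarrow> k < n \<Longrightarrow> card {i. (i,k) \<in> G} = t k"
  by (auto simp: ens_def bip_graphs_def deg_v_def)

lemma card_le_row: "finite A \<Longrightarrow> card {k. (b,k) \<in> A} \<le> card A"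
  by (rule card_inj_on_le[of "\<lambda>k. (b,k)"]) (auto simp: inj_on_def)

lemma card_le_col: "finite A \<Longrightarrow> card {j. (j,k) \<in> A} \<le> card A"
  by (rule card_inj_on_le[of "\<lambda>j. (j,k)"]) (auto simp: inj_on_def)

text \<open>A column in row b but not in row a is missing from \<open>wset A U b a G\<close> only if
  \<open>A\<close> or row a of \<open>U\<close> blocks it, at a cost of 3 L q. Since both rows have
  lam n + O(L q) entries, few differences in one direction force a large common part and few
  differences in the other direction.\<close>

lemma row_split:
  assumes "finite A" "real (card A) \<le> L * q" and U: "U \<subseteq> {..<m} \<times> {..<n}"
    and dU: "\<And>i. i < m \<Longrightarrow> real (card {k. (i,k) \<in> U}) \<le> 2 * L * q"
    and G: "G \<in> ens A U" and ab: "a < m" "b < m"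
  shows "real (card {k. (b,k) \<in> G \<and> (a,k) \<notin> G}) \<le> real (card (wset A U b a G)) + 3 * L * q" (is ?A)
    and "real (s b) - real (card (wset A U b a G)) - 3 * L * q \<le> real (card {k. (a,k) \<in> G \<and> (b,k) \<in> G})" (is ?B)
    and "real (card {k. (a,k) \<in> G \<and> (b,k) \<notin> G}) \<le> real (card (wset A U b a G)) + 5 * L * q" (is ?C)
proof -
  let ?S2 = "{k. (a,k) \<in> G \<and> (b,k) \<in> G}"
  have box: "G \<subseteq> {..<m} \<times> {..<n}" by (rule ens_box[OF G])
  have fin: "finite {k. (i,k) \<in> G \<and> P k}" for i P
    by (rule finite_subset[OF _ finite_row[OF box, of i]]) auto
  have "card {k. (b,k) \<in> G \<and> (a,k) \<notin> G} \<le> card (wset A U b a G \<union> {k. (b,k) \<in> A} \<union> {k. (a,k) \<in> U})"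
  proof (rule card_mono)
    have "finite {k. (b,k) \<in> A}" using assms(1) by (rule finite_subset[rotated, OF finite_imageI[of A snd]]) force
    then show "finite (wset A U b a G \<union> {k. (b,k) \<in> A} \<union> {k. (a,k) \<in> U})"
      using finite_wset[OF box] finite_row[OF U] by auto
  qed (auto simp: wset_def)
  also have "\<dots> \<le> card (wset A U b a G) + card {k. (b,k) \<in> A} + card {k. (a,k) \<in> U}"
    by (meson add_right_mono card_Un_le le_trans)
  finally show A: ?A using card_le_row[OF assms(1), of b] dU[of a] ab assms(2) by simp
  have "card {k. (b,k) \<in> G} = card ?S2 + card {k. (b,k) \<in> G \<and> (a,k) \<notin> G}"
    by (subst card_Un_disjoint[symmetric]) (auto intro!: arg_cong[where f=card] simp: fin conj_commute)
  then show B: ?B using row_card[OF G ab(2)] A by simp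
  have "card {k. (a,k) \<in> G} = card ?S2 + card {k. (a,k) \<in> G \<and> (b,k) \<notin> G}"
    by (subst card_Un_disjoint[symmetric]) (auto intro!: arg_cong[where f=card] simp: fin)
  then show ?C using row_card[OF G ab(1)] B s_dev[OF ab(1)] s_dev[OF ab(2)] by linarith
qed

text \<open>Counts the switchings with a third row i that make row b less like row a: row b gives up
  a column k shared with a and takes a column l that neither a nor b has, while i moves from l to k.
  If w is small, rows a and b nearly coincide, so each of the two column sets has about lam n minus
  the number of columns common to a, b and i; on average over i the latter is about lam^2 n, leaving
  about \<open>gam * n\<close> choices for k and for l.\<close>

lemma forward_count:
  assumes fA: "finite A" and cA: "real (card A) \<le> L * q" and U: "U \<subseteq> {..<m} \<times> {..<n}"
    and dU: "\<And>i. i < m \<Longrightarrow> real (card {k. (i,k) \<in> U}) \<le> 2 * L * q"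
    and G: "G \<in> ens A U" and ab: "a < m" "b < m"
    and w: "w = real (card (wset A U b a G))" "16 * w \<le> gam * real n"
  shows "real (card (SIGMA i:{..<m}.
      {k. (a,k) \<in> G \<and> (b,k) \<in> G \<and> (b,k) \<notin> A \<and> (i,k) \<notin> G \<union> U} \<times>
      {l. (a,l) \<notin> G \<union> U \<and> (b,l) \<notin> G \<union> U \<and> (i,l) \<in> G - A})) \<ge> real m * (gam * real n)\<^sup>2 / 2"
proof -
  let ?S2 = "{k. (a,k) \<in> G \<and> (b,k) \<in> G}"
  let ?C1 = "\<lambda>i. {k. (a,k) \<in> G \<and> (b,k) \<in> G \<and> (b,k) \<notin> A \<and> (i,k) \<notin> G \<union> U}"
  let ?C2 = "\<lambda>i. {l. (a,l) \<notin> G \<union> U \<and> (b,l) \<notin> G \<union> U \<and> (i,l) \<in> G - A}"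
  let ?x = "\<lambda>i. {k. (a,k) \<in> G \<and> (b,k) \<in> G \<and> (i,k) \<in> G}"
  note rs = row_split[OF fA cA U dU G ab]
  have box: "G \<subseteq> {..<m} \<times> {..<n}" by (rule ens_box[OF G])
  have fin: "finite {k. (i,k) \<in> G \<and> P k}" for i P
    by (rule finite_subset[OF _ finite_row[OF box, of i]]) auto
  have finA: "finite {k. (i,k) \<in> A}" for i using fA by (rule finite_subset[rotated, OF finite_imageI[of A snd]]) force
  \<comment> \<open>One lower bound serves both column sets. The loss comes from the second: the
    one-sided differences of rows a and b, at most w + 3 L q and w + 5 L q, two rows of
    \<open>U\<close> at 2 L q each, and L q each for \<open>A\<close> and the deviation of
    \<open>s i\<close>.\<close>
  define z where "z i = lam * n - real (card (?x i)) - 2 * w - 14 * L * q" for i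
  have finC: "finite (?C1 i)" "finite (?C2 i)" for i
    by (rule finite_subset[OF _ finite_row[OF box, of a]], force) (rule finite_subset[OF _ finite_row[OF box, of i]], force)
  have c1: "real (card (?C1 i)) \<ge> z i" if i: "i < m" for i
  proof -
    have "card ?S2 \<le> card (?C1 i \<union> ?x i \<union> {k. (b,k) \<in> A} \<union> {k. (i,k) \<in> U})"
      by (rule card_mono) (use fin finA finite_row[OF U] in auto)
    also have "\<dots> \<le> card (?C1 i) + card (?x i) + card {k. (b,k) \<in> A} + card {k. (i,k) \<in> U}"
      by (meson add_right_mono card_Un_le le_trans)
    finally have "real (card ?S2) \<le> card (?C1 i) + card (?x i) + L * q + 2 * L * q"
      using card_le_row[OF fA, of b] dU[OF i] cA by linarith
    moreover have "L * q > 0" "w \<ge> 0" using L_pos q_pos w by auto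
    ultimately show ?thesis unfolding z_def using rs(2) s_dev[OF ab(2)] w(1) by linarith
  qed
  have c2: "real (card (?C2 i)) \<ge> z i" if i: "i < m" for i
  proof -
    let ?R = "{k. (b,k) \<in> G \<and> (a,k) \<notin> G} \<union> {k. (a,k) \<in> G \<and> (b,k) \<notin> G} \<union> {k. (a,k) \<in> U} \<union> {k. (b,k) \<in> U}"
    have "card {k. (i,k) \<in> G} \<le> card (?C2 i \<union> ?x i \<union> {k. (i,k) \<in> A} \<union> ?R)"
      by (rule card_mono) (use fin finA finite_row[OF U] finC in auto)
    also have "\<dots> \<le> card (?C2 i) + card (?x i) + card {k. (i,k) \<in> A} + (card {k. (b,k) \<in> G \<and> (a,k) \<notin> G} +
       card {k. (a,k) \<in> G \<and> (b,k) \<notin> G} + card {k. (a,k) \<in> U} + card {k. (b,k) \<in> U})"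
      by (meson add_mono card_Un_le le_trans order_refl)
    finally have "real (s i) \<le> card (?C2 i) + card (?x i) + L * q + ((w + 3 * L * q) + (w + 5 * L * q) + 2 * L * q + 2 * L * q)"
      using card_le_row[OF fA, of i] dU[OF ab(1)] dU[OF ab(2)] cA rs(1,3) w(1) row_card[OF G i] by linarith
    then show ?thesis unfolding z_def using s_dev[OF i] by (simp add: algebra_simps)
  qed
  \<comment> \<open>Of \<open>gam * n\<close>, an eighth is lost to 2 w and at most an eighth to the
    lower-order terms; 3/4 remains, and its square 9/16 still exceeds 1/2.\<close>
  define g where "g = 3 / 4 * (gam * n)"
  have g0: "g \<ge> 0" unfolding g_def using gam_pos by simp
  \<comment> \<open>the tangent line of the square at \<open>g\<close> serves instead of the Cauchy-Schwarz inequality\<close>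
  have prodge: "real (card (?C1 i \<times> ?C2 i)) \<ge> 2 * g * z i - g\<^sup>2" if i: "i < m" for i
  proof (cases "z i \<ge> 0")
    case True
    have "z i * z i \<le> real (card (?C1 i)) * real (card (?C2 i))"
      using c1[OF i] c2[OF i] True by (intro mult_mono) auto
    moreover have "(z i - g)\<^sup>2 \<ge> 0" by simp
    ultimately show ?thesis by (simp add: card_cartesian_product power2_eq_square algebra_simps)
  next
    case False
    then have "2 * g * z i \<le> 0" using g0 by (simp add: mult_nonneg_nonpos)
    moreover have "g\<^sup>2 \<ge> 0" by simp
    moreover have "real (card (?C1 i \<times> ?C2 i)) \<ge> 0" by simp
    ultimately show ?thesis by linarith
  qed
  \<comment> \<open>Interchanging the sums replaces the triple overlaps by the column degrees
    \<open>t k\<close> over the columns common to a and b.\<close>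
  have sumx: "(\<Sum>i<m. real (card (?x i))) \<le> (lam * n + L * q) * (lam * m + L * q)"
  proof -
    have fS: "finite ?S2" using fin by auto
    have "(\<Sum>i<m. card (?x i)) = (\<Sum>i<m. \<Sum>k\<in>?S2. of_bool ((i,k) \<in> G))"
    proof (rule sum.cong[OF refl])
      fix i
      have "?x i = {k \<in> ?S2. (i,k) \<in> G}" by auto
      then show "card (?x i) = (\<Sum>k\<in>?S2. of_bool ((i,k) \<in> G))"
        using fS by (simp add: sum.If_cases of_bool_def Int_def)
    qed
    also have "\<dots> = (\<Sum>k\<in>?S2. \<Sum>i<m. of_bool ((i,k) \<in> G))" by (rule sum.swap)
    also have "\<dots> = (\<Sum>k\<in>?S2. t k)"
    proof (rule sum.cong[OF refl])
      fix k assume "k \<in> ?S2"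
      then have k: "k < n" using box by auto
      have "{i. (i,k) \<in> G} = {i. i < m \<and> (i,k) \<in> G}" using box by auto
      then show "(\<Sum>i<m. of_bool ((i,k) \<in> G)) = t k"
        using col_card[OF G k] by (simp add: sum.If_cases of_bool_def Int_def lessThan_def)
    qed
    finally have "real (\<Sum>i<m. card (?x i)) = real (\<Sum>k\<in>?S2. t k)" by (rule arg_cong)
    then have "(\<Sum>i<m. real (card (?x i))) = (\<Sum>k\<in>?S2. real (t k))" by (simp only: of_nat_sum)
    also have "\<dots> \<le> (\<Sum>k\<in>?S2. lam * m + L * q)"
      by (rule sum_mono) (use t_dev box in fastforce)
    also have "\<dots> = real (card ?S2) * (lam * m + L * q)" by simp
    also have "\<dots> \<le> (lam * n + L * q) * (lam * m + L * q)"
    proof (rule mult_right_mono)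
      have "card ?S2 \<le> card {k. (b,k) \<in> G}" by (rule card_mono) (use finite_row[OF box] in auto)
      then show "real (card ?S2) \<le> lam * n + L * q" using row_card[OF G ab(2)] s_dev[OF ab(2)] by linarith
    qed (use lam_pos m_pos L_pos q_pos in simp)
    finally show ?thesis .
  qed
  have sumz: "(\<Sum>i<m. z i) \<ge> m * g"
  proof -
    have e0: "(lam * n + L * q) * (lam * m + L * q) = lam\<^sup>2 * n * m + lam * (L * q) * n + lam * (L * q) * m + L\<^sup>2 * n"
      using q2 by (simp add: algebra_simps power2_eq_square)
    have "lam * (L * q) * n \<le> 1 * (L * q) * (L * m)"
      using lam_pos lam1 L_pos q_pos n_le by (intro mult_mono) auto
    moreover have "lam * (L * q) * m \<le> 1 * (L * q) * m"
      using lam_pos lam1 L_pos q_pos by (intro mult_right_mono) auto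
    moreover have "L\<^sup>2 * n \<le> L\<^sup>2 * (L * m)" using n_le L_pos by (intro mult_left_mono) auto
    ultimately have "(\<Sum>i<m. real (card (?x i))) \<le> lam\<^sup>2 * n * m + m * (L\<^sup>2 * q + L * q + L ^ 3)"
      using sumx[unfolded e0] by (simp add: algebra_simps power2_eq_square power3_eq_cube)
    moreover have "(\<Sum>i<m. z i) = m * (lam * n - 2 * w - 14 * L * q) - (\<Sum>i<m. real (card (?x i)))"
      unfolding z_def sum_subtractf by (simp add: algebra_simps)
    ultimately have "(\<Sum>i<m. z i) \<ge> m * (lam * n - 2 * w - 14 * L * q) - (lam\<^sup>2 * n * m + m * (L\<^sup>2 * q + L * q + L ^ 3))"
      by linarith
    also have "m * (lam * n - 2 * w - 14 * L * q) - (lam\<^sup>2 * n * m + m * (L\<^sup>2 * q + L * q + L ^ 3))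
       = m * (gam * n - 2 * w - (14 * L * q + L\<^sup>2 * q + L * q + L ^ 3))"
      by (simp add: algebra_simps power2_eq_square)
    finally have *: "(\<Sum>i<m. z i) \<ge> m * (gam * n - 2 * w - (14 * L * q + L\<^sup>2 * q + L * q + L ^ 3))" .
    have "14 * L * q + L\<^sup>2 * q + L * q + L ^ 3 \<le> 17 * (L ^ 3 * q)"
    proof -
      have "L * q \<le> L ^ 3 * q" "L\<^sup>2 * q \<le> L ^ 3 * q" "L ^ 3 * 1 \<le> L ^ 3 * q"
        using L_mono[of 1 3] L_mono[of 2 3] q_ge L_pos by (auto intro!: mult_mono)
      then show ?thesis by simp
    qed
    also have "17 * (L ^ 3 * q) \<le> gam * n / 8"
    proof -
      have "136 * L ^ 3 * q \<le> L ^ 40 * q" using L_absorb[of 3 40 136] q_pos by (intro mult_right_mono) auto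
      then show ?thesis using gamn_ge by simp
    qed
    finally have "gam * n - 2 * w - (14 * L * q + L\<^sup>2 * q + L * q + L ^ 3) \<ge> g"
      unfolding g_def using w(2) by linarith
    then have "m * (gam * n - 2 * w - (14 * L * q + L\<^sup>2 * q + L * q + L ^ 3)) \<ge> m * g"
      by (intro mult_left_mono) auto
    with * show ?thesis by linarith
  qed
  have "real (card (SIGMA i:{..<m}. ?C1 i \<times> ?C2 i)) = (\<Sum>i<m. real (card (?C1 i \<times> ?C2 i)))"
    using finC by (simp add: card_SigmaI)
  moreover have "(\<Sum>i<m. 2 * g * z i - g\<^sup>2) \<le> (\<Sum>i<m. real (card (?C1 i \<times> ?C2 i)))"
    by (rule sum_mono) (use prodge in auto)
  moreover have "(\<Sum>i<m. 2 * g * z i - g\<^sup>2) = 2 * g * (\<Sum>i<m. z i) - m * g\<^sup>2"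
    by (simp add: sum_subtractf sum_distrib_left)
  moreover have "2 * g * (m * g) \<le> 2 * g * (\<Sum>i<m. z i)" using sumz g0 by (intro mult_left_mono) auto
  moreover have "2 * g * (m * g) - m * g\<^sup>2 = m * g\<^sup>2" by (simp add: power2_eq_square)
  moreover have "m * g\<^sup>2 \<ge> real m * (gam * real n)\<^sup>2 / 2"
  proof -
    have "g\<^sup>2 = 9 / 16 * (gam * real n)\<^sup>2" unfolding g_def by (simp only: power_mult_distrib) (simp add: power2_eq_square)
    then have "m * g\<^sup>2 = 9 / 16 * (m * (gam * real n)\<^sup>2)" by simp
    moreover have "m * (gam * real n)\<^sup>2 \<ge> 0" by simp
    ultimately show ?thesis by linarith
  qed
  ultimately show ?thesis by linarith
qed

text \<open>Double counting between consecutive levels of \<open>card (wset A U b a G)\<close>.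
  Upwards there are at least m (gam n)^2 / 2 switchings. A reverse switching must take k from the
  columns of a missing in b and l from \<open>wset A U b a G\<close>; near the bottom both sets have
  at most gam n / 8 elements, so there are at most m (gam n)^2 / 64 of them.\<close>

lemma level_ratio:
  assumes fA: "finite A" and cA: "real (card A) \<le> L * q" and U: "U \<subseteq> {..<m} \<times> {..<n}"
    and dU: "\<And>i. i < m \<Longrightarrow> real (card {k. (i,k) \<in> U}) \<le> 2 * L * q"
    and ab: "a < m" "b < m" and nab: "a \<noteq> b" and w: "32 * real w \<le> gam * real n"
  shows "32 * real (card {G \<in> ens A U. card (wset A U b a G) = w})
     \<le> real (card {G \<in> ens A U. card (wset A U b a G) = Suc w})"
proof -
  let ?X = "{G \<in> ens A U. card (wset A U b a G) = w}"
  let ?Y = "{G \<in> ens A U. card (wset A U b a G) = Suc w}"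
  let ?C1 = "\<lambda>G i. {k. (a,k) \<in> G \<and> (b,k) \<in> G \<and> (b,k) \<notin> A \<and> (i,k) \<notin> G \<union> U}"
  let ?C2 = "\<lambda>G i. {l. (a,l) \<notin> G \<union> U \<and> (b,l) \<notin> G \<union> U \<and> (i,l) \<in> G - A}"
  let ?T = "\<lambda>G. SIGMA i:{..<m}. ?C1 G i \<times> ?C2 G i"
  let ?T' = "\<lambda>G. {..<m} \<times> ({k. (a,k) \<in> G \<and> (b,k) \<notin> G} \<times> wset A U b a G)"
  let ?f = "\<lambda>(G,i,k,l). (sw i b k l G, i, k, l)" and ?f' = "\<lambda>(G,i,k,l). (sw b i k l G, i, k, l)"
  let ?g = "gam * real n"
  have fin1: "finite {k. (i,k) \<in> G \<and> P k}" if "G \<in> ens A U" for i G P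
    by (rule finite_subset[OF _ finite_row[OF ens_box[OF that], of i]]) auto
  have finT: "finite (?T G)" if "G \<in> ens A U" for G
  proof (intro finite_SigmaI finite_cartesian_product)
    show "finite (?C1 G i)" "finite (?C2 G i)" for i
      by (rule finite_subset[OF _ finite_row[OF ens_box[OF that], of a]], force)
        (rule finite_subset[OF _ finite_row[OF ens_box[OF that], of i]], force)
  qed auto
  have finT': "finite (?T' G)" if "G \<in> ens A U" for G
    using fin1[OF that] finite_wset[OF ens_box[OF that]] by auto
  have step: "sw i b k l G \<in> ?Y \<and> (i,k,l) \<in> ?T' (sw i b k l G) \<and> sw b i k l (sw i b k l G) = G"
    if G: "G \<in> ?X" and T: "(i,k,l) \<in> ?T G" for G i k l
  proof -
    have e: "(a,k) \<in> G" "(b,k) \<in> G" "(b,k) \<notin> A" "(i,k) \<notin> G" "(i,k) \<notin> U"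
      "(a,l) \<notin> G" "(a,l) \<notin> U" "(b,l) \<notin> G" "(b,l) \<notin> U" "(i,l) \<in> G" "(i,l) \<notin> A" "i < m"
      using T by auto
    have ne: "i \<noteq> b" "i \<noteq> a" "k \<noteq> l" "a \<noteq> b" using e nab by auto
    have GE: "G \<in> ens A U" using G by simp
    have bA: "(b,l) \<notin> A" using GE e by (auto simp: ens_def)
    have "sw i b k l G \<in> bip_graphs m n s t"
      by (rule sw_bip_graphs) (use GE e ne in \<open>auto simp: ens_def\<close>)
    moreover have "A \<subseteq> sw i b k l G" "sw i b k l G \<inter> U = {}"
      using GE e ne by (auto simp: ens_def sw_def)
    ultimately have E': "sw i b k l G \<in> ens A U" by (simp add: ens_def)
    have ws: "wset A U b a (sw i b k l G) = insert l (wset A U b a G)"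
      using e ne bA by (auto simp: wset_def sw_mem)
    moreover have "l \<notin> wset A U b a G" using e by (auto simp: wset_def)
    ultimately have "card (wset A U b a (sw i b k l G)) = Suc w"
      using G finite_wset[OF ens_box[OF GE]] by simp
    moreover have "(a,k) \<in> sw i b k l G" "(b,k) \<notin> sw i b k l G" using e ne by (auto simp: sw_mem)
    moreover have "sw b i k l (sw i b k l G) = G" using e ne by (intro sw_sw) auto
    ultimately show ?thesis using E' ws e by auto
  qed
  have "card (SIGMA G:?X. ?T G) \<le> card (SIGMA G:?Y. ?T' G)"
  proof (rule card_inj_on_le[where f = ?f])
    show "inj_on ?f (SIGMA G:?X. ?T G)"
    proof (rule inj_on_inverseI[where g = ?f'])
      fix x assume "x \<in> (SIGMA G:?X. ?T G)"
      then obtain G i k l where x: "x = (G,i,k,l)" "G \<in> ?X" "(i,k,l) \<in> ?T G" by (cases x) auto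
      show "?f' (?f x) = x" using step[OF x(2,3)] unfolding x(1) by simp
    qed
    show "?f ` (SIGMA G:?X. ?T G) \<subseteq> (SIGMA G:?Y. ?T' G)"
    proof (rule image_subsetI)
      fix x assume "x \<in> (SIGMA G:?X. ?T G)"
      then obtain G i k l where x: "x = (G,i,k,l)" "G \<in> ?X" "(i,k,l) \<in> ?T G" by (cases x) auto
      show "?f x \<in> (SIGMA G:?Y. ?T' G)" using step[OF x(2,3)] unfolding x(1) by simp
    qed
    show "finite (SIGMA G:?Y. ?T' G)" by (rule finite_SigmaI) (use finT' in auto)
  qed
  then have le: "real (card (SIGMA G:?X. ?T G)) \<le> real (card (SIGMA G:?Y. ?T' G))" by simp
  have "real (card ?X) * (m * ?g\<^sup>2 / 2) = (\<Sum>G\<in>?X. m * ?g\<^sup>2 / 2)" by simp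
  also have "\<dots> \<le> (\<Sum>G\<in>?X. real (card (?T G)))"
  proof (rule sum_mono)
    fix G assume G: "G \<in> ?X"
    then have GE: "G \<in> ens A U" and we: "real w = real (card (wset A U b a G))" by auto
    have w2: "16 * real w \<le> gam * real n" using w by simp
    show "m * ?g\<^sup>2 / 2 \<le> real (card (?T G))"
      by (rule forward_count[OF fA cA U dU GE ab we w2])
  qed
  also have "\<dots> = real (card (SIGMA G:?X. ?T G))"
    using finT by (subst card_SigmaI) auto
  also note le
  also have "real (card (SIGMA G:?Y. ?T' G)) = (\<Sum>G\<in>?Y. real (card (?T' G)))"
    using finT' by (subst card_SigmaI) auto
  also have "\<dots> \<le> (\<Sum>G\<in>?Y. m * ?g\<^sup>2 / 64)"
  proof (rule sum_mono)
    fix G assume G: "G \<in> ?Y"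
    then have GE: "G \<in> ens A U" and we: "card (wset A U b a G) = Suc w" by auto
    have small: "1 + 5 * L * q \<le> ?g / 32"
    proof -
      have "32 * (1 + 5 * L * q) \<le> 192 * (L * q)" using mult_mono[OF L1, of 1 q] q_ge L_pos by simp
      also have "\<dots> \<le> L ^ 40 * q" using L_absorb[of 1 40 192] q_pos by simp
      finally show ?thesis using gamn_ge by simp
    qed
    have sw: "real (Suc w) \<le> ?g / 8" using w small mult_pos_pos[OF L_pos q_pos] of_nat_Suc[of w, where 'a=real] by linarith
    have c: "real (card {k. (a,k) \<in> G \<and> (b,k) \<notin> G}) \<le> ?g / 8"
      using row_split(3)[OF fA cA U dU GE ab] we w small by simp
    have "real (card (?T' G)) = m * (real (card {k. (a,k) \<in> G \<and> (b,k) \<notin> G}) * real (Suc w))"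
      using we by (simp add: card_cartesian_product algebra_simps)
    also have "\<dots> \<le> m * ((?g / 8) * (?g / 8))"
      using c sw gam_pos by (intro mult_left_mono mult_mono) auto
    also have "\<dots> = m * ?g\<^sup>2 / 64" by (simp add: power2_eq_square)
    finally show "real (card (?T' G)) \<le> m * ?g\<^sup>2 / 64" .
  qed
  also have "\<dots> = real (card ?Y) * (m * ?g\<^sup>2 / 64)" by simp
  finally have "real (card ?X) * (m * ?g\<^sup>2 / 2) \<le> real (card ?Y) * (m * ?g\<^sup>2 / 64)" .
  then have "(m * ?g\<^sup>2) * (32 * real (card ?X)) \<le> (m * ?g\<^sup>2) * real (card ?Y)" by (simp add: algebra_simps)
  moreover have "m * ?g\<^sup>2 > 0" using m_pos n_pos lam_pos lam1 by (intro mult_pos_pos zero_less_power) auto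
  ultimately show ?thesis by (rule mult_left_le_imp_le)
qed

text \<open>Level sizes grow by the factor 32 at each step, so a level below the threshold can be
  climbed many times and holds a tiny proportion of the ensemble. A polynomial bound is all that is
  recorded.\<close>

lemma wset_tail:
  assumes fA: "finite A" and cA: "real (card A) \<le> L * q" and U: "U \<subseteq> {..<m} \<times> {..<n}"
    and dU: "\<And>i. i < m \<Longrightarrow> real (card {k. (i,k) \<in> U}) \<le> 2 * L * q"
    and ab: "a < m" "b < m" and nab: "a \<noteq> b"
  shows "real (card {G \<in> ens A U. real (card (wset A U b a G)) < real n / L ^ 3}) \<le> NN A U / (real n)\<^sup>2"
proof -
  let ?X = "\<lambda>w. {G \<in> ens A U. card (wset A U b a G) = w}"
  \<comment> \<open>Levels below i are climbed i times; this stays below 2 i, where the growth by 32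
    is still available.\<close>
  define i where "i = nat \<lceil>real n / L ^ 3\<rceil>"
  have i1: "real n / L ^ 3 \<le> real i" "real i \<le> real n / L ^ 3 + 1"
    unfolding i_def using n_pos L_pos by (simp_all add: real_nat_ceiling_ge)
  have bound: "32 * real (2 * i) \<le> gam * n"
  proof -
    have "n / L ^ 3 \<ge> 1"
    proof -
      have "L ^ 3 * 1 \<le> q * q" using L_le_q[of 3] q_ge q_pos by (intro mult_mono) auto
      then show ?thesis using q2 L_pos by (simp add: field_simps power2_eq_square)
    qed
    then have "32 * real (2 * i) \<le> 128 * (n / L ^ 3)" using i1 by simp
    also have "\<dots> \<le> 1 / L\<^sup>2 * n" using L_ge n_pos L_pos by (simp add: field_simps power2_eq_square power3_eq_cube)
    also have "\<dots> \<le> gam * n" using gam_ge by (intro mult_right_mono) auto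
    finally show ?thesis .
  qed
  have iter: "32 ^ j * real (card (?X w)) \<le> NN A U" if "w < i" "j \<le> i" for w j
  proof -
    have "32 ^ j * real (card (?X w)) \<le> real (card (?X (w + j)))" using that(2)
    proof (induction j)
      case (Suc j)
      have "32 * real (w + j) \<le> 32 * real (2 * i)" using Suc.prems that(1) by simp
      then have "32 * real (card (?X (w + j))) \<le> real (card (?X (Suc (w + j))))"
        using bound by (intro level_ratio[OF fA cA U dU ab nab]) auto
      then show ?case using Suc by simp
    qed simp
    also have "\<dots> \<le> NN A U" unfolding NN_def of_nat_le_iff by (rule card_mono[OF finite_ens]) auto
    finally show ?thesis .
  qed
  have "{G \<in> ens A U. real (card (wset A U b a G)) < real n / L ^ 3} \<subseteq> (\<Union>w<i. ?X w)"
    using i1 by auto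
  then have "card {G \<in> ens A U. real (card (wset A U b a G)) < real n / L ^ 3} \<le> card (\<Union>w<i. ?X w)"
    by (intro card_mono) auto
  also have "\<dots> \<le> (\<Sum>w<i. card (?X w))" by (rule card_UN_le) simp
  finally have "real (card {G \<in> ens A U. real (card (wset A U b a G)) < real n / L ^ 3}) \<le> (\<Sum>w<i. real (card (?X w)))"
    by (simp only: of_nat_le_iff flip: of_nat_sum)
  also have "\<dots> \<le> (\<Sum>w<i. NN A U / 32 ^ i)"
    by (rule sum_mono) (use iter[of _ i] in \<open>simp add: field_simps\<close>)
  also have "\<dots> = (i / 32 ^ i) * NN A U" by simp
  also have "\<dots> \<le> (1 / (real n)\<^sup>2) * NN A U"
  proof (rule mult_right_mono)
    \<comment> \<open>As 32 = 2^5, the quotient i / 32^i is at most 1 / i^4, and i is at least n /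
      L^3 with L^12 below n^2.\<close>
    have i2: "real i \<le> 2 ^ i" using of_nat_less_two_power[of i] by (metis less_imp_le)
    have "(real i) ^ 5 \<le> (2 ^ i) ^ 5" using i2 by (intro power_mono) auto
    also have "(2 ^ i) ^ 5 = (32::real) ^ i" by (simp flip: power_mult) (simp add: power_mult mult.commute[of i])
    finally have 32: "(real i) ^ 5 \<le> 32 ^ i" .
    have "(real n)\<^sup>2 \<le> (real n / L ^ 3) ^ 4"
    proof -
      have "L ^ 12 * 1 \<le> q * (q * (q * q))" using L_le_q[of 12] q_ge q_pos
        by (intro mult_mono) (auto intro!: mult_ge1_I)
      then have "L ^ 12 \<le> (real n)\<^sup>2" using q2 by (simp add: power2_eq_square flip: q2)
      then have "(real n)\<^sup>2 * L ^ 12 \<le> (real n)\<^sup>2 * (real n)\<^sup>2" by (intro mult_left_mono) auto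
      then have "(real n)\<^sup>2 * L ^ 12 \<le> (real n) ^ 4" by (simp flip: power_add)
      then show ?thesis using L_pos by (simp add: power_divide field_simps flip: power_mult)
    qed
    also have "\<dots> \<le> real i ^ 4" using i1 n_pos L_pos by (intro power_mono) auto
    finally have "(real n)\<^sup>2 * i \<le> real i ^ 4 * i" by (intro mult_right_mono) auto
    also have "\<dots> = real i ^ 5" by (simp add: power_Suc2[symmetric] del: power_Suc)
    also note 32
    finally show "i / 32 ^ i \<le> 1 / (real n)\<^sup>2" using n_pos by (simp add: field_simps)
  qed simp
  finally show ?thesis by simp
qed

end


section \<open>First approximation of the edge probabilities\<close>

text \<open>Second-moment bound: pairs of distinct indices are governed by near-independence, and
  the at most \<open>card I\<close> diagonal pairs by the trivial bound 1.\<close>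

lemma abs_double_sum_le:
  fixes f h :: "'i \<Rightarrow> 'g \<Rightarrow> real"
  assumes fin: "finite I" "finite J" and N: "N = real (card \<Omega>)" and \<kappa>: "\<kappa> \<ge> 0"
    and f1: "\<And>i G. i \<in> I \<Longrightarrow> G \<in> \<Omega> \<Longrightarrow> \<bar>f i G\<bar> \<le> 1"
    and h1: "\<And>j G. j \<in> J \<Longrightarrow> G \<in> \<Omega> \<Longrightarrow> \<bar>h j G\<bar> \<le> 1"
    and off: "\<And>i j. i \<in> I \<Longrightarrow> j \<in> J \<Longrightarrow> i \<noteq> j \<Longrightarrow> \<bar>\<Sum>G\<in>\<Omega>. f i G * h j G\<bar> \<le> \<kappa> * N"
  shows "\<bar>\<Sum>G\<in>\<Omega>. (\<Sum>i\<in>I. f i G) * (\<Sum>j\<in>J. h j G)\<bar> \<le> (real (card I) * real (card J) * \<kappa> + real (card I)) * N"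
proof -
  have "(\<Sum>G\<in>\<Omega>. (\<Sum>i\<in>I. f i G) * (\<Sum>j\<in>J. h j G)) = (\<Sum>G\<in>\<Omega>. \<Sum>i\<in>I. \<Sum>j\<in>J. f i G * h j G)"
    by (simp add: sum_product)
  also have "\<dots> = (\<Sum>i\<in>I. \<Sum>j\<in>J. \<Sum>G\<in>\<Omega>. f i G * h j G)"
    by (subst sum.swap, rule sum.cong[OF refl], rule sum.swap)
  finally have eq: "(\<Sum>G\<in>\<Omega>. (\<Sum>i\<in>I. f i G) * (\<Sum>j\<in>J. h j G)) = (\<Sum>i\<in>I. \<Sum>j\<in>J. \<Sum>G\<in>\<Omega>. f i G * h j G)" .
  have "\<bar>\<Sum>i\<in>I. \<Sum>j\<in>J. \<Sum>G\<in>\<Omega>. f i G * h j G\<bar> \<le> (\<Sum>i\<in>I. \<Sum>j\<in>J. \<bar>\<Sum>G\<in>\<Omega>. f i G * h j G\<bar>)"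
    by (rule order_trans[OF sum_abs sum_mono]) (rule sum_abs)
  also have "\<dots> \<le> (\<Sum>i\<in>I. \<Sum>j\<in>J. \<kappa> * N + (if j = i then N else 0))"
  proof (intro sum_mono)
    fix i j assume ij: "i \<in> I" "j \<in> J"
    show "\<bar>\<Sum>G\<in>\<Omega>. f i G * h j G\<bar> \<le> \<kappa> * N + (if j = i then N else 0)"
    proof (cases "i = j")
      case True
      have "\<bar>\<Sum>G\<in>\<Omega>. f i G * h j G\<bar> \<le> (\<Sum>G\<in>\<Omega>. \<bar>f i G * h j G\<bar>)" by (rule sum_abs)
      also have "\<dots> \<le> (\<Sum>G\<in>\<Omega>. 1)"
        using f1[OF ij(1)] h1[OF ij(2)] by (intro sum_mono) (auto simp: abs_mult intro: mult_le_one)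
      finally show ?thesis using True N \<kappa> by (simp add: add_increasing)
    qed (use off ij in auto)
  qed
  also have "\<dots> \<le> (\<Sum>i\<in>I. real (card J) * (\<kappa> * N) + N)"
  proof (rule sum_mono)
    fix i assume "i \<in> I"
    show "(\<Sum>j\<in>J. \<kappa> * N + (if j = i then N else 0)) \<le> real (card J) * (\<kappa> * N) + N"
      using fin N by (simp add: sum.distrib)
  qed
  finally show ?thesis using eq by (simp add: algebra_simps)
qed

text \<open>Second-order expansion of the mean of a quotient: it needs a lower bound on the
denominator only off a small exceptional set.\<close>

lemma mean_quotient_approx:
  fixes \<nu> D :: "'g \<Rightarrow> real"
  assumes fin: "finite \<Omega>" and N: "N = real (card \<Omega>)" and D0: "D0 > 0" and w0: "w0 > 0"
    and D1: "\<And>G. G \<in> \<Omega> \<Longrightarrow> D G \<ge> 1" and M: "\<And>G. G \<in> \<Omega> \<Longrightarrow> \<bar>\<nu> G\<bar> \<le> M"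
    and V: "\<And>G. G \<in> \<Omega> \<Longrightarrow> \<bar>D G - D0\<bar> \<le> V"
    and tail: "real (card {G \<in> \<Omega>. D G < w0}) \<le> \<tau> * N"
    and e1: "\<bar>\<Sum>G\<in>\<Omega>. \<nu> G - \<nu>0\<bar> \<le> e1 * N"
    and e2: "\<bar>\<Sum>G\<in>\<Omega>. D G - D0\<bar> \<le> e2 * N"
    and e3: "\<bar>\<Sum>G\<in>\<Omega>. (\<nu> G - \<nu>0) * (D G - D0)\<bar> \<le> e3 * N"
    and e4: "(\<Sum>G\<in>\<Omega>. (D G - D0)\<^sup>2) \<le> e4 * N" and M0: "M \<ge> 0"
  shows "\<bar>(\<Sum>G\<in>\<Omega>. \<nu> G / D G) - \<nu>0 / D0 * N\<bar>
     \<le> (e1 / D0 + (\<bar>\<nu>0\<bar> * e2 + e3) / D0\<^sup>2 + M * e4 / (D0\<^sup>2 * w0) + M * V\<^sup>2 * \<tau> / D0\<^sup>2) * N"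
proof -
  let ?r = "\<lambda>G. \<nu> G * (D G - D0)\<^sup>2 / (D0\<^sup>2 * D G)"
  \<comment> \<open>Exact form of the expansion: with d = D - D0, 1/D = 1/D0 - d/D0^2 + d^2/(D0^2
    D). Only the last term still contains the random denominator, and there the square d^2 is
    already small on average.\<close>
  have id: "\<nu> G / D G = \<nu>0 / D0 + (\<nu> G - \<nu>0) / D0 - (\<nu>0 * (D G - D0) + (\<nu> G - \<nu>0) * (D G - D0)) / D0\<^sup>2 + ?r G"
    if "G \<in> \<Omega>" for G
  proof -
    have "D G \<noteq> 0" "D0 \<noteq> 0" using D1[OF that] D0 by auto
    then show ?thesis by (simp add: field_simps power2_eq_square)
  qed
  have "(\<Sum>G\<in>\<Omega>. \<nu> G / D G) = (\<Sum>G\<in>\<Omega>. \<nu>0 / D0 + (\<nu> G - \<nu>0) / D0 - (\<nu>0 * (D G - D0) + (\<nu> G - \<nu>0) * (D G - D0)) / D0\<^sup>2 + ?r G)"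
    by (rule sum.cong[OF refl]) (rule id)
  also have "\<dots> = \<nu>0 / D0 * N + (\<Sum>G\<in>\<Omega>. \<nu> G - \<nu>0) / D0
     - (\<nu>0 * (\<Sum>G\<in>\<Omega>. D G - D0) + (\<Sum>G\<in>\<Omega>. (\<nu> G - \<nu>0) * (D G - D0))) / D0\<^sup>2 + (\<Sum>G\<in>\<Omega>. ?r G)"
    unfolding N by (simp only: sum.distrib sum_subtractf[of "\<lambda>G. _ G + _ G"] sum_divide_distrib[symmetric] sum_distrib_left[symmetric] sum_constant) (simp add: mult.commute)
  finally have eq: "(\<Sum>G\<in>\<Omega>. \<nu> G / D G) - \<nu>0 / D0 * N = (\<Sum>G\<in>\<Omega>. \<nu> G - \<nu>0) / D0
     - (\<nu>0 * (\<Sum>G\<in>\<Omega>. D G - D0) + (\<Sum>G\<in>\<Omega>. (\<nu> G - \<nu>0) * (D G - D0))) / D0\<^sup>2 + (\<Sum>G\<in>\<Omega>. ?r G)"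
    by simp
  have t1: "\<bar>(\<Sum>G\<in>\<Omega>. \<nu> G - \<nu>0) / D0\<bar> \<le> e1 / D0 * N"
    using e1 D0 by (simp add: field_simps)
  have "\<bar>\<nu>0 * (\<Sum>G\<in>\<Omega>. D G - D0) + (\<Sum>G\<in>\<Omega>. (\<nu> G - \<nu>0) * (D G - D0))\<bar> \<le> \<bar>\<nu>0\<bar> * (e2 * N) + e3 * N"
  proof -
    have "\<bar>\<nu>0 * (\<Sum>G\<in>\<Omega>. D G - D0)\<bar> \<le> \<bar>\<nu>0\<bar> * (e2 * N)"
      unfolding abs_mult using e2 by (intro mult_left_mono) auto
    then show ?thesis using e3 by linarith
  qed
  then have t2: "\<bar>(\<nu>0 * (\<Sum>G\<in>\<Omega>. D G - D0) + (\<Sum>G\<in>\<Omega>. (\<nu> G - \<nu>0) * (D G - D0))) / D0\<^sup>2\<bar>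
     \<le> (\<bar>\<nu>0\<bar> * e2 + e3) / D0\<^sup>2 * N"
    using D0 by (simp add: field_simps)
  have "\<bar>\<Sum>G\<in>\<Omega>. ?r G\<bar> \<le> (\<Sum>G\<in>\<Omega>. \<bar>?r G\<bar>)" by (rule sum_abs)
  also have "\<dots> \<le> (\<Sum>G\<in>\<Omega>. M / (D0\<^sup>2 * w0) * (D G - D0)\<^sup>2 + M * V\<^sup>2 / D0\<^sup>2 * of_bool (D G < w0))"
  proof (rule sum_mono)
    fix G assume G: "G \<in> \<Omega>"
    have d: "D G \<ge> 1" using D1[OF G] .
    have "\<bar>?r G\<bar> = \<bar>\<nu> G\<bar> * ((D G - D0)\<^sup>2 / (D0\<^sup>2 * D G))" using d by (simp add: abs_mult)
    also have "\<dots> \<le> M * ((D G - D0)\<^sup>2 / (D0\<^sup>2 * D G))" using M[OF G] d by (intro mult_right_mono) auto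
    also have "\<dots> \<le> M / (D0\<^sup>2 * w0) * (D G - D0)\<^sup>2 + M * V\<^sup>2 / D0\<^sup>2 * of_bool (D G < w0)"
    proof (cases "D G < w0")
      case True
      have "(D G - D0)\<^sup>2 \<le> V\<^sup>2" using V[OF G] by (metis abs_ge_zero power2_abs power_mono)
      then have "(D G - D0)\<^sup>2 / (D0\<^sup>2 * D G) \<le> V\<^sup>2 / (D0\<^sup>2 * 1)"
        using d D0 by (intro frac_le mult_left_mono) auto
      then have "M * ((D G - D0)\<^sup>2 / (D0\<^sup>2 * D G)) \<le> M * (V\<^sup>2 / (D0\<^sup>2 * 1))" using M0 by (intro mult_left_mono)
      moreover have "M / (D0\<^sup>2 * w0) * (D G - D0)\<^sup>2 \<ge> 0" using M0 w0 by simp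
      ultimately show ?thesis using True by simp
    next
      case False
      have "(D G - D0)\<^sup>2 / (D0\<^sup>2 * D G) \<le> (D G - D0)\<^sup>2 / (D0\<^sup>2 * w0)"
        using False w0 D0 by (intro frac_le mult_left_mono) auto
      then have "M * ((D G - D0)\<^sup>2 / (D0\<^sup>2 * D G)) \<le> M * ((D G - D0)\<^sup>2 / (D0\<^sup>2 * w0))" using M0 by (intro mult_left_mono)
      then show ?thesis using False by simp
    qed
    finally show "\<bar>?r G\<bar> \<le> M / (D0\<^sup>2 * w0) * (D G - D0)\<^sup>2 + M * V\<^sup>2 / D0\<^sup>2 * of_bool (D G < w0)" .
  qed
  also have "\<dots> = M / (D0\<^sup>2 * w0) * (\<Sum>G\<in>\<Omega>. (D G - D0)\<^sup>2) + M * V\<^sup>2 / D0\<^sup>2 * real (card {G \<in> \<Omega>. D G < w0})"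
    unfolding sum.distrib sum_distrib_left[symmetric] using fin by (simp add: sum.If_cases of_bool_def Int_def)
  also have "\<dots> \<le> M / (D0\<^sup>2 * w0) * (e4 * N) + M * V\<^sup>2 / D0\<^sup>2 * (\<tau> * N)"
    using e4 tail M0 w0 by (intro add_mono mult_left_mono) auto
  finally have t3: "\<bar>\<Sum>G\<in>\<Omega>. ?r G\<bar> \<le> M / (D0\<^sup>2 * w0) * (e4 * N) + M * V\<^sup>2 / D0\<^sup>2 * (\<tau> * N)" .
  have tri: "\<bar>x - y + z\<bar> \<le> a + b + c" if "\<bar>x\<bar> \<le> a" "\<bar>y\<bar> \<le> b" "\<bar>z\<bar> \<le> c" for x y z a b c :: real
    using that by linarith
  show ?thesis unfolding eq
    by (rule order_trans[OF tri[OF t1 t2 t3]]) (simp add: algebra_simps add_divide_distrib)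
qed

lemma finite_row_of: "finite A \<Longrightarrow> finite {k. (a,k) \<in> A}"
  using finite_subset[of "{k. (a,k) \<in> A}" "snd ` A"] by (simp add: image_iff subset_iff) force

section \<open>Ensembles avoiding a sparse set of edges\<close>

locale forb_bip = dense_bip m n s t lam L q for m n s t lam L q +
  fixes F :: "(nat \<times> nat) set"
  assumes F_box: "F \<subseteq> {..<m} \<times> {..<n}"
    and F_row: "\<And>i. i < m \<Longrightarrow> real (card {k. (i,k) \<in> F}) \<le> L * q"
    and F_col: "\<And>k. k < n \<Longrightarrow> real (card {i. (i,k) \<in> F}) \<le> L * q"
    and F_card: "real (card F) \<le> L * real n"
begin

text \<open>The number c bounds the extra conditions beyond \<open>F\<close>. A switching fixes two
  edges and a covariance of indicators up to four more, so a bound for c conditions yields an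
  improved one for c - 5; the values 90, 80 and 0 used below leave ample room.\<close>

definition near :: "nat \<Rightarrow> (nat \<times> nat) set \<Rightarrow> (nat \<times> nat) set \<Rightarrow> bool" where
  "near c A U \<longleftrightarrow> A \<subseteq> {..<m} \<times> {..<n} \<and> F \<subseteq> U \<and> U \<subseteq> {..<m} \<times> {..<n} \<and> card A + card (U - F) \<le> c"

lemma near_mono: "near c A U \<Longrightarrow> c \<le> d \<Longrightarrow> near d A U" by (auto simp: near_def)

lemma near_finite: assumes "near c A U" shows "finite A" "finite U"
proof -
  have "A \<subseteq> {..<m} \<times> {..<n}" "U \<subseteq> {..<m} \<times> {..<n}" using assms by (auto simp: near_def)
  then show "finite A" "finite U" using finite_subset[of _ "{..<m} \<times> {..<n}"] by blast+
qed

lemma near_insert_A: "near c A U \<Longrightarrow> e \<in> {..<m} \<times> {..<n} \<Longrightarrow> near (Suc c) (insert e A) U"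
proof -
  assume a: "near c A U" and e: "e \<in> {..<m} \<times> {..<n}"
  have "card (insert e A) \<le> Suc (card A)" using near_finite[OF a] by (simp add: card_insert_if)
  then show ?thesis using a e unfolding near_def by simp
qed

lemma near_insert_U: "near c A U \<Longrightarrow> e \<in> {..<m} \<times> {..<n} \<Longrightarrow> near (Suc c) A (insert e U)"
proof -
  assume a: "near c A U" and e: "e \<in> {..<m} \<times> {..<n}"
  have "card (insert e U - F) \<le> card (insert e (U - F))"
    by (rule card_mono) (use near_finite[OF a] in auto)
  also have "\<dots> \<le> Suc (card (U - F))" using near_finite[OF a] by (simp add: card_insert_if)
  finally show ?thesis using a e unfolding near_def by auto
qed

lemma near_base: "near 0 {} F" using F_box by (simp add: near_def)

lemma near_row: assumes "near c A U" "c \<le> 100" shows "i < m \<Longrightarrow> real (card {k. (i,k) \<in> U}) \<le> 2 * L * q"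
proof -
  assume i: "i < m"
  have fU: "finite (U - F)" "finite F" using near_finite[OF assms(1)] F_box finite_subset[OF F_box] by auto
  have "card {k. (i,k) \<in> U} \<le> card ({k. (i,k) \<in> F} \<union> {k. (i,k) \<in> U - F})"
    by (rule card_mono) (use finite_row F_box assms in \<open>auto simp: near_def intro: finite_subset[OF _ finite_row]\<close>)
  also have "\<dots> \<le> card {k. (i,k) \<in> F} + card {k. (i,k) \<in> U - F}" by (rule card_Un_le)
  finally have "real (card {k. (i,k) \<in> U}) \<le> L * q + 100"
    using F_row[OF i] card_le_row[OF fU(1), of i] assms by (auto simp: near_def)
  moreover have "L * q \<ge> 1000 * 1000" using L_ge q_ge by (intro mult_mono) auto
  ultimately show ?thesis by linarith
qed

lemma Lq_ge: "L * q \<ge> 1000000" using mult_mono[OF L_ge q_ge] L_pos by simp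

lemma near_card_A: "near c A U \<Longrightarrow> c \<le> 100 \<Longrightarrow> real (card A) \<le> L * q"
  using Lq_ge by (auto simp: near_def)

lemma near_tail:
  assumes "near c A U" "c \<le> 100" "a < m" "b < m" "a \<noteq> b"
  shows "real (card {G \<in> ens A U. real (card (wset A U b a G)) < real n / L ^ 3}) \<le> NN A U / (real n)\<^sup>2"
proof (rule wset_tail)
  show "U \<subseteq> {..<m} \<times> {..<n}" using assms by (simp add: near_def)
  show "real (card {k. (i,k) \<in> U}) \<le> 2 * L * q" if "i < m" for i using near_row[OF assms(1,2) that] .
qed (use assms near_card_A[OF assms(1,2)] near_finite[OF assms(1)] in auto)

text \<open>Row a splits into movable columns, columns where row b meets \<open>F\<close>, columns
  where row b has an edge, and at most c columns blocked by the extra conditions. The quantity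
  \<open>z\<close> depends on \<open>F\<close> but not on \<open>A\<close> and \<open>U\<close>, so
  one approximation will fit all conditioned ensembles.\<close>

lemma wset_card_bounds:
  fixes a b :: nat
  assumes near: "near c A U" and G: "G \<in> ens A' U'" "U \<subseteq> U'" and a: "a < m"
  defines "z \<equiv> real (s a) - real (card {k. (a,k) \<in> G \<and> (b,k) \<in> F}) - real (card {k. (a,k) \<in> G \<and> (b,k) \<in> G})"
  shows "real (card (wset A U a b G)) \<le> z" "z - c \<le> real (card (wset A U a b G))"
proof -
  let ?w = "wset A U a b G" and ?p = "{k. (a,k) \<in> G \<and> (b,k) \<in> F}" and ?b = "{k. (a,k) \<in> G \<and> (b,k) \<in> G}"
  let ?x = "{k. (a,k) \<in> G} - ?w - ?p - ?b"
  have box: "G \<subseteq> {..<m} \<times> {..<n}" by (rule ens_box[OF G(1)])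
  have fin: "finite {k. (a,k) \<in> G}" by (rule finite_row[OF box])
  have FG: "F \<inter> G = {}" using G near by (auto simp: ens_def near_def)
  have U: "finite (U - F)" "finite A" using near_finite[OF near] by auto
  have fs: "finite ?w" "finite ?p" "finite ?b" "finite ?x"
    using fin finite_wset[OF box] by (auto intro: finite_subset[OF _ fin])
  have "{k. (a,k) \<in> G} = ?w \<union> ?p \<union> ?b \<union> ?x" by (auto simp: wset_def)
  then have "card {k. (a,k) \<in> G} = card (?w \<union> ?p \<union> ?b \<union> ?x)" by simp
  also have "\<dots> = card (?w \<union> ?p \<union> ?b) + card ?x" by (rule card_Un_disjoint) (use fs in auto)
  also have "card (?w \<union> ?p \<union> ?b) = card (?w \<union> ?p) + card ?b"
    by (rule card_Un_disjoint) (use fs FG in \<open>auto simp: wset_def\<close>)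
  also have "card (?w \<union> ?p) = card ?w + card ?p"
    by (rule card_Un_disjoint) (use fs near in \<open>auto simp: wset_def near_def\<close>)
  finally have eq: "s a = card ?w + card ?p + card ?b + card ?x" using row_card[OF G(1) a] by simp
  have "card ?x \<le> card ({k. (a,k) \<in> A} \<union> {k. (b,k) \<in> U - F})"
  proof (rule card_mono)
    show "finite ({k. (a,k) \<in> A} \<union> {k. (b,k) \<in> U - F})"
      using finite_row_of[OF U(2)] finite_row_of[OF U(1)] by blast
  qed (auto simp: wset_def)
  also have "\<dots> \<le> card {k. (a,k) \<in> A} + card {k. (b,k) \<in> U - F}" by (rule card_Un_le)
  also have "\<dots> \<le> c" using card_le_row[OF U(2), of a] card_le_row[OF U(1), of b] near by (simp add: near_def)
  finally show "real (card ?w) \<le> z" "z - c \<le> real (card ?w)" using eq unfolding z_def by auto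
qed

lemma F_row_part: "b < m \<Longrightarrow> real (card {k. (a,k) \<in> G \<and> (b,k) \<in> F}) \<le> L * q"
proof -
  assume b: "b < m"
  have "card {k. (a,k) \<in> G \<and> (b,k) \<in> F} \<le> card {k. (b,k) \<in> F}"
    by (rule card_mono[OF finite_row[OF F_box]]) auto
  then show ?thesis using F_row[OF b] by linarith
qed

lemma wset_diff_le:
  assumes near: "near c A U" "c \<le> 100" and G: "G \<in> ens A' U'" "U \<subseteq> U'" and ab: "a < m" "b < m"
  shows "\<bar>real (card (wset A U a b G)) - real (card (wset A U b a G))\<bar> \<le> 5 * L * q"
proof -
  have c: "real c \<le> 100" using near by simp
  have "{k. (b,k) \<in> G \<and> (a,k) \<in> G} = {k. (a,k) \<in> G \<and> (b,k) \<in> G}" by auto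
  then show ?thesis
    using wset_card_bounds[OF near(1) G ab(1), of b] wset_card_bounds[OF near(1) G ab(2), of a]
      s_dev[OF ab(1)] s_dev[OF ab(2)] F_row_part[OF ab(1), of b G] F_row_part[OF ab(2), of a G]
      c Lq_ge by simp
qed

lemma wset_ge1:
  assumes "G \<in> ens (insert (b,k) A) (insert (a,k) U)" "(a,k) \<notin> A \<union> U" "(b,k) \<notin> A \<union> U"
  shows "real (card (wset A U b a G)) \<ge> 1"
proof -
  have "k \<in> wset A U b a G" using assms by (auto simp: wset_def ens_def)
  then show ?thesis using finite_wset[OF ens_box[OF assms(1)]] by (metis One_nat_def Suc_leI card_gt_0_iff empty_iff of_nat_1 of_nat_le_iff)
qed

text \<open>Adding the switched edges to the constraints can only shrink \<open>wset\<close>, so the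
  tail bound for the enlarged ensembles covers the sets taken relative to \<open>A\<close> and
  \<open>U\<close>. Graphs without reverse switchings are an extreme case of a small
  denominator.\<close>

lemma switch_tail:
  assumes near: "near c A U" "c \<le> 90" and ab: "a < m" "b < m" "a \<noteq> b" and k: "k < n"
  shows "real (card {G \<in> ens (insert (b,k) A) (insert (a,k) U). real (card (wset A U b a G)) < real n / L ^ 3})
      \<le> 1 / (real n)\<^sup>2 * NN (insert (b,k) A) (insert (a,k) U)"
    and "real (card {G \<in> ens (insert (a,k) A) (insert (b,k) U). wset A U b a G = {}}) \<le> NN A U / (real n)\<^sup>2"
proof -
  have sub: "wset A' U' b a G \<subseteq> wset A U b a G" if "A \<subseteq> A'" "U \<subseteq> U'" for A' U' G
    using that by (auto simp: wset_def)
  have n1: "near (Suc (Suc c)) (insert (b,k) A) (insert (a,k) U)"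
    using near_insert_U[OF near_insert_A[OF near(1)]] ab k by auto
  have n2: "near (Suc (Suc c)) (insert (a,k) A) (insert (b,k) U)"
    using near_insert_U[OF near_insert_A[OF near(1)]] ab k by auto
  have c: "Suc (Suc c) \<le> 100" using near by simp
  have "card {G \<in> ens (insert (b,k) A) (insert (a,k) U). real (card (wset A U b a G)) < real n / L ^ 3}
     \<le> card {G \<in> ens (insert (b,k) A) (insert (a,k) U). real (card (wset (insert (b,k) A) (insert (a,k) U) b a G)) < real n / L ^ 3}"
  proof (rule card_mono)
    show "{G \<in> ens (insert (b,k) A) (insert (a,k) U). real (card (wset A U b a G)) < real n / L ^ 3} \<subseteq>
      {G \<in> ens (insert (b,k) A) (insert (a,k) U). real (card (wset (insert (b,k) A) (insert (a,k) U) b a G)) < real n / L ^ 3}"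
    proof (rule Collect_mono, rule impI, elim conjE, rule conjI)
      fix G assume G: "G \<in> ens (insert (b,k) A) (insert (a,k) U)" and lt: "real (card (wset A U b a G)) < real n / L ^ 3"
      show "G \<in> ens (insert (b,k) A) (insert (a,k) U)" by (rule G)
      have "card (wset (insert (b,k) A) (insert (a,k) U) b a G) \<le> card (wset A U b a G)"
        by (rule card_mono[OF finite_wset[OF ens_box[OF G]] sub]) auto
      then show "real (card (wset (insert (b,k) A) (insert (a,k) U) b a G)) < real n / L ^ 3" using lt by linarith
    qed
  qed auto
  then show "real (card {G \<in> ens (insert (b,k) A) (insert (a,k) U). real (card (wset A U b a G)) < real n / L ^ 3})
      \<le> 1 / (real n)\<^sup>2 * NN (insert (b,k) A) (insert (a,k) U)"
    using near_tail[OF n1 c ab] by simp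
  have "card {G \<in> ens (insert (a,k) A) (insert (b,k) U). wset A U b a G = {}}
     \<le> card {G \<in> ens (insert (a,k) A) (insert (b,k) U). real (card (wset (insert (a,k) A) (insert (b,k) U) b a G)) < real n / L ^ 3}"
  proof (rule card_mono)
    have "n / L ^ 3 > 0" using n_pos L_pos by simp
    then show "{G \<in> ens (insert (a,k) A) (insert (b,k) U). wset A U b a G = {}} \<subseteq>
      {G \<in> ens (insert (a,k) A) (insert (b,k) U). real (card (wset (insert (a,k) A) (insert (b,k) U) b a G)) < real n / L ^ 3}"
    proof (intro Collect_mono impI, elim conjE, intro conjI)
      fix G assume 0: "0 < n / L ^ 3" and G: "G \<in> ens (insert (a,k) A) (insert (b,k) U)" and e: "wset A U b a G = {}"
      show "G \<in> ens (insert (a,k) A) (insert (b,k) U)" by (rule G)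
      have "wset (insert (a,k) A) (insert (b,k) U) b a G = {}" using sub[OF subset_insertI subset_insertI] e by blast
      then show "real (card (wset (insert (a,k) A) (insert (b,k) U) b a G)) < real n / L ^ 3" using 0 by simp
    qed
  qed auto
  then have "real (card {G \<in> ens (insert (a,k) A) (insert (b,k) U). wset A U b a G = {}}) \<le> NN (insert (a,k) A) (insert (b,k) U) / (real n)\<^sup>2"
    using near_tail[OF n2 c ab] by simp
  also have "\<dots> \<le> NN A U / (real n)\<^sup>2"
    using order_trans[OF NN_insert_le NN_insert_U_le] by (intro divide_right_mono) auto
  finally show "real (card {G \<in> ens (insert (a,k) A) (insert (b,k) U). wset A U b a G = {}}) \<le> NN A U / (real n)\<^sup>2" .
qed


text \<open>The numerator is at most 5 L q everywhere, the denominator at least n / L^3 off the tail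
  and at least 1 on it; the tail has proportion 1/n^2, so the quotient has mean of order L^4 /
  q.\<close>

lemma crude_switch_bound:
  assumes near: "near c A U" "c \<le> 90" and ab: "a < m" "b < m" "a \<noteq> b" and k: "k < n"
    and e: "(a,k) \<notin> A \<union> U" "(b,k) \<notin> A \<union> U"
  shows "\<bar>NN (insert (a,k) A) U - NN (insert (b,k) A) U\<bar> \<le> 7 * L ^ 4 / q * NN A U"
proof -
  let ?O = "ens (insert (b,k) A) (insert (a,k) U)" and ?D = "\<lambda>G. real (card (wset A U b a G))"
  let ?\<nu> = "\<lambda>G. real (card (wset A U a b G)) - real (card (wset A U b a G))"
  let ?N = "NN (insert (b,k) A) (insert (a,k) U)"
  note tail = switch_tail[OF near ab k]
  have w0: "n / L ^ 3 > 0" using n_pos L_pos by simp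
  have NNle: "?N \<le> NN A U" using order_trans[OF NN_insert_le NN_insert_U_le] by auto
  have c100: "c \<le> 100" using near by simp
  have "\<bar>\<Sum>G\<in>?O. ?\<nu> G / ?D G\<bar> \<le> (\<Sum>G\<in>?O. \<bar>?\<nu> G / ?D G\<bar>)" by (rule sum_abs)
  also have "\<dots> \<le> (\<Sum>G\<in>?O. 5 * L * q * (L ^ 3 / n + of_bool (?D G < n / L ^ 3)))"
  proof (rule sum_mono)
    fix G assume G: "G \<in> ?O"
    have d: "?D G \<ge> 1" by (rule wset_ge1[OF G e])
    have "\<bar>?\<nu> G\<bar> \<le> 5 * L * q" by (rule wset_diff_le[OF near(1) c100 G subset_insertI ab(1,2)])
    moreover have "1 / ?D G \<le> L ^ 3 / n + of_bool (?D G < n / L ^ 3)"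
    proof (cases "?D G < n / L ^ 3")
      case True
      have "1 / ?D G \<le> 1" "L ^ 3 / n \<ge> 0" using d L_pos by auto
      then show ?thesis using True by simp
    next
      case False
      then have "1 / ?D G \<le> 1 / (n / L ^ 3)" using w0 by (intro frac_le) auto
      then show ?thesis using False by simp
    qed
    ultimately have "\<bar>?\<nu> G\<bar> * (1 / ?D G) \<le> 5 * L * q * (L ^ 3 / n + of_bool (?D G < n / L ^ 3))"
      using d by (intro mult_mono) auto
    then show "\<bar>?\<nu> G / ?D G\<bar> \<le> 5 * L * q * (L ^ 3 / n + of_bool (?D G < n / L ^ 3))" by simp
  qed
  also have "\<dots> = 5 * L * q * (L ^ 3 / n * ?N + real (card {G \<in> ?O. ?D G < n / L ^ 3}))"
    unfolding sum_distrib_left[symmetric] sum.distrib by (simp add: NN_def sum.If_cases of_bool_def Int_def mult.commute)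
  also have "\<dots> \<le> 5 * L * q * (L ^ 3 / n * ?N + 1 / (real n)\<^sup>2 * ?N)"
    using tail(1) L_pos q_pos by (intro mult_left_mono add_left_mono) auto
  also have "\<dots> = 5 * L * q * (L ^ 3 / n + 1 / (real n)\<^sup>2) * ?N" by (simp add: algebra_simps)
  also have "\<dots> \<le> 5 * L * q * (L ^ 3 / n + 1 / (real n)\<^sup>2) * NN A U"
    using L_pos q_pos NNle by (intro mult_left_mono) auto
  finally have s: "\<bar>\<Sum>G\<in>?O. ?\<nu> G / ?D G\<bar> \<le> 5 * L * q * (L ^ 3 / n + 1 / (real n)\<^sup>2) * NN A U" .
  have "\<bar>NN (insert (a,k) A) U - NN (insert (b,k) A) U\<bar>
     \<le> 5 * L * q * (L ^ 3 / n + 1 / (real n)\<^sup>2) * NN A U + NN A U / (real n)\<^sup>2"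
    unfolding NN_switch_difference[OF ab(3) e] using s tail(2) by linarith
  also have "\<dots> = (5 * L * q * (L ^ 3 / n + 1 / (real n)\<^sup>2) + 1 / (real n)\<^sup>2) * NN A U" by (simp add: algebra_simps)
  also have "\<dots> \<le> 7 * L ^ 4 / q * NN A U"
  proof (rule mult_right_mono)
    have n1: "real n \<ge> 1" using n_pos by simp
    have a1: "1 / (real n)\<^sup>2 \<le> 1 / n" using n1 by (simp add: divide_simps power2_eq_square)
    have "5 * L * q * (L ^ 3 / n + 1 / (real n)\<^sup>2) + 1 / (real n)\<^sup>2 \<le> 5 * L * q * (L ^ 3 / n + 1 / n) + 1 / n"
      using a1 L_pos q_pos by (intro add_mono mult_left_mono) auto
    also have "\<dots> = (5 * L ^ 4 * q + 5 * L * q + 1) / n"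
      by (simp add: algebra_simps add_divide_distrib power_numeral_reduce)
    also have "\<dots> \<le> (7 * L ^ 4 * q) / n"
    proof (rule divide_right_mono)
      have "5 * L * q \<le> L ^ 4 * q" using L_absorb[of 1 4 5] q_pos by (intro mult_right_mono) auto
      moreover have "1 * 1 \<le> L ^ 4 * q" using L_mono[of 0 4] q_ge by (intro mult_mono) auto
      ultimately show "5 * L ^ 4 * q + 5 * L * q + 1 \<le> 7 * L ^ 4 * q" by linarith
    qed simp
    also have "\<dots> = 7 * L ^ 4 / q" using q_pos by (simp add: q2[symmetric] power2_eq_square)
    finally show "5 * L * q * (L ^ 3 / n + 1 / (real n)\<^sup>2) + 1 / (real n)\<^sup>2 \<le> 7 * L ^ 4 / q" .
  qed simp
  finally show ?thesis .
qed

lemma near_col: assumes "near c A U" "c \<le> 100" and k: "k < n"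
  shows "real (card {j. j < m \<and> (j,k) \<notin> A \<union> U}) \<le> m"
    "real m - L * q - c \<le> real (card {j. j < m \<and> (j,k) \<notin> A \<union> U})"
    "real m / 2 \<le> real (card {j. j < m \<and> (j,k) \<notin> A \<union> U})"
proof -
  let ?J = "{j. j < m \<and> (j,k) \<notin> A \<union> U}"
  have fU: "finite (U - F)" "finite A" using near_finite[OF assms(1)] by auto
  have "card ?J \<le> card {..<m}" by (rule card_mono) auto
  then show "real (card ?J) \<le> m" by simp
  have "card {..<m} \<le> card (?J \<union> {j. (j,k) \<in> F} \<union> ({j. (j,k) \<in> A} \<union> {j. (j,k) \<in> U - F}))"
  proof (rule card_mono)
    have "{j. (j,k) \<in> A} \<subseteq> {..<m}" "{j. (j,k) \<in> U - F} \<subseteq> {..<m}" "{j. (j,k) \<in> F} \<subseteq> {..<m}"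
      using assms F_box by (auto simp: near_def)
    then show "finite (?J \<union> {j. (j,k) \<in> F} \<union> ({j. (j,k) \<in> A} \<union> {j. (j,k) \<in> U - F}))"
      using finite_subset[OF _ finite_lessThan[of m]] by auto
  qed auto
  also have "\<dots> \<le> card ?J + card {j. (j,k) \<in> F} + (card {j. (j,k) \<in> A} + card {j. (j,k) \<in> U - F})"
    by (meson add_mono card_Un_le le_trans order_refl)
  finally have "real m \<le> card ?J + card {j. (j,k) \<in> F} + c"
    using card_le_col[OF fU(1), of k] card_le_col[OF fU(2), of k] assms by (simp add: near_def)
  then show 1: "real m - L * q - c \<le> real (card ?J)" using F_col[OF k] by linarith
  have "4 * L ^ 2 * q \<le> n"
  proof -
    have "4 * L ^ 2 * q \<le> q * q" using L_absorb[of 2 3 4] L_le_q[of 3] q_pos by (intro mult_right_mono) auto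
    then show ?thesis using q2 by (simp add: power2_eq_square)
  qed
  then have "L * (4 * L * q) \<le> L * m" using n_le by (simp add: power2_eq_square)
  then have "4 * L * q \<le> m" using L_pos by simp
  then show "real m / 2 \<le> real (card ?J)" using 1 assms Lq_ge by simp
qed

text \<open>The column sums of the edge probabilities are known exactly, so differences
between the probabilities within a column determine the probabilities themselves.\<close>

lemma column_closing:
  assumes near: "near c A U" "c \<le> 100" and k: "k < n" and a: "a < m" "(a,k) \<notin> A \<union> U" and \<kappa>: "\<kappa> \<ge> 0"
    and dif: "\<And>b. b < m \<Longrightarrow> b \<noteq> a \<Longrightarrow> (b,k) \<notin> A \<union> U \<Longrightarrow>
        \<bar>NN (insert (a,k) A) U - NN (insert (b,k) A) U - (r a - r b) * NN A U\<bar> \<le> \<kappa> * NN A U"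
    and sum: "\<bar>(\<Sum>b | b < m \<and> (b,k) \<notin> A \<union> U. r b) - real (t k)\<bar> \<le> \<epsilon>"
  shows "\<bar>NN (insert (a,k) A) U - r a * NN A U\<bar> \<le> (\<kappa> + 2 * (\<epsilon> + real (card A)) / m) * NN A U"
proof -
  let ?J = "{j. j < m \<and> (j,k) \<notin> A \<union> U}"
  let ?N = "NN A U" and ?f = "\<lambda>b. NN (insert (b,k) A) U"
  have "(\<Sum>b\<in>?J. ?f a - ?f b - (r a - r b) * ?N) =
     real (card ?J) * (?f a - r a * ?N) - ((\<Sum>b\<in>?J. ?f b) - (\<Sum>b\<in>?J. r b) * ?N)"
    by (simp add: sum_subtractf sum.distrib sum_distrib_left algebra_simps)
  \<comment> \<open>Summing the differences over all admissible b isolates the deviation at a: it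
    equals the average of the errors of the differences plus the error of the column sum spread over
    at least m/2 rows.\<close>
  then have eq: "real (card ?J) * (?f a - r a * ?N) = (\<Sum>b\<in>?J. ?f a - ?f b - (r a - r b) * ?N)
      + (real (t k) - (\<Sum>b\<in>?J. r b) - real (card {j. (j,k) \<in> A})) * ?N"
    using NN_col_sum[OF k, of A U] by (simp add: algebra_simps)
  have s1: "\<bar>\<Sum>b\<in>?J. ?f a - ?f b - (r a - r b) * ?N\<bar> \<le> real (card ?J) * (\<kappa> * ?N)"
  proof -
    have "\<bar>\<Sum>b\<in>?J. ?f a - ?f b - (r a - r b) * ?N\<bar> \<le> (\<Sum>b\<in>?J. \<bar>?f a - ?f b - (r a - r b) * ?N\<bar>)" by (rule sum_abs)
    also have "\<dots> \<le> (\<Sum>b\<in>?J. \<kappa> * ?N)"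
    proof (rule sum_mono)
      fix b assume "b \<in> ?J"
      then show "\<bar>?f a - ?f b - (r a - r b) * ?N\<bar> \<le> \<kappa> * ?N" using dif[of b] \<kappa> by (cases "b = a") auto
    qed
    finally show ?thesis by simp
  qed
  have s2: "\<bar>real (t k) - (\<Sum>b\<in>?J. r b) - real (card {j. (j,k) \<in> A})\<bar> \<le> \<epsilon> + card A"
    using sum card_le_col[of A k] near_finite[OF near(1)] by linarith
  have "real (card ?J) * \<bar>?f a - r a * ?N\<bar> = \<bar>real (card ?J) * (?f a - r a * ?N)\<bar>" by (simp add: abs_mult)
  also have "\<dots> \<le> real (card ?J) * (\<kappa> * ?N) + (\<epsilon> + card A) * ?N"
  proof -
    have "\<bar>(real (t k) - (\<Sum>b\<in>?J. r b) - real (card {j. (j,k) \<in> A})) * ?N\<bar> \<le> (\<epsilon> + card A) * ?N"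
      unfolding abs_mult using s2 by (intro mult_mono) auto
    then show ?thesis unfolding eq using s1 by linarith
  qed
  also have "(\<epsilon> + card A) * ?N \<le> real (card ?J) * (2 * (\<epsilon> + card A) / m * ?N)"
  proof -
    have "\<epsilon> + card A \<ge> 0" using s2 by linarith
    then have "(m / 2) * (2 * (\<epsilon> + card A) / m * ?N) \<le> real (card ?J) * (2 * (\<epsilon> + card A) / m * ?N)"
      using near_col(3)[OF near k] m_pos by (intro mult_right_mono) auto
    moreover have "(m / 2) * (2 * (\<epsilon> + card A) / m * ?N) = (\<epsilon> + card A) * ?N"
      using m_pos by (simp add: field_simps)
    ultimately show ?thesis by linarith
  qed
  finally have "real (card ?J) * \<bar>?f a - r a * ?N\<bar> \<le> real (card ?J) * ((\<kappa> + 2 * (\<epsilon> + card A) / m) * ?N)"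
    by (simp add: algebra_simps)
  moreover have "real (card ?J) > 0" using near_col(3)[OF near k] m_pos by linarith
  ultimately show ?thesis by simp
qed

lemma per_m: "x \<ge> 0 \<Longrightarrow> x / real m \<le> L * x / real n"
proof -
  assume x: "x \<ge> 0"
  have "x * n \<le> x * (L * m)" using n_le x by (intro mult_left_mono) auto
  then show ?thesis using n_pos m_pos by (simp add: field_simps)
qed

lemma q_over_n: "q / real n = 1 / q" using q_pos q2 by (simp add: power2_eq_square flip: q2)

text \<open>The constant \<open>lam\<close> is accurate enough here: its column sum misses
  \<open>t k\<close> by O(L q), which after division by m is of the same order 1/q as the crude
  difference bound.\<close>

lemma edge_prob_level0:
  assumes near: "near c A U" "c \<le> 90" and e: "a < m" "k < n" "(a,k) \<notin> A \<union> U"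
  shows "\<bar>NN (insert (a,k) A) U - lam * NN A U\<bar> \<le> L ^ 6 / q * NN A U"
proof -
  let ?J = "{b. b < m \<and> (b,k) \<notin> A \<union> U}"
  have c100: "c \<le> 100" using near by simp
  have cA: "real (card A) \<le> 100" using near by (auto simp: near_def)
  have nc: "real (card ?J) \<le> m" "m - L * q - c \<le> real (card ?J)" using near_col[OF near(1) c100 e(2)] by auto
  have "\<bar>NN (insert (a,k) A) U - lam * NN A U\<bar> \<le> (7 * L ^ 4 / q + 2 * (3 * L * q + real (card A)) / m) * NN A U"
  proof (rule column_closing[OF near(1) c100 e(2) e(1) e(3)])
    show "0 \<le> 7 * L ^ 4 / q" using L_pos q_pos by simp
    show "\<bar>NN (insert (a,k) A) U - NN (insert (b,k) A) U - (lam - lam) * NN A U\<bar> \<le> 7 * L ^ 4 / q * NN A U"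
      if "b < m" "b \<noteq> a" "(b,k) \<notin> A \<union> U" for b
      using crude_switch_bound[OF near e(1) that(1) _ e(2) e(3) that(3)] that by simp
    have "lam * real (card ?J) \<le> lam * m" "lam * (m - L * q - c) \<le> lam * real (card ?J)"
      using nc lam_pos by (auto intro!: mult_left_mono)
    moreover have "lam * (m - (L * q + c)) = lam * m - lam * (L * q + c)" by (simp add: algebra_simps)
    moreover have "lam * (L * q + c) \<le> 1 * (L * q + c)" using lam1 L_pos q_pos by (intro mult_right_mono) auto
    moreover have "real c \<le> L * q" using near Lq_ge by simp
    ultimately have "\<bar>lam * real (card ?J) - real (t k)\<bar> \<le> 3 * L * q" using t_dev[OF e(2)]
      by (simp add: diff_diff_eq)
    then show "\<bar>(\<Sum>b | b < m \<and> (b,k) \<notin> A \<union> U. lam) - real (t k)\<bar> \<le> 3 * L * q" by (simp add: mult.commute)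
  qed
  also have "\<dots> \<le> L ^ 6 / q * NN A U"
  proof (rule mult_right_mono)
    have "2 * (3 * L * q + real (card A)) / m \<le> 8 * L * q / m"
      using cA Lq_ge by (intro divide_right_mono) auto
    also have "\<dots> \<le> L * (8 * L * q) / n" using L_pos q_pos by (intro per_m) auto
    also have "\<dots> = 8 * L\<^sup>2 * (q / n)" by (simp add: power2_eq_square)
    also have "\<dots> = 8 * L\<^sup>2 / q" unfolding q_over_n by simp
    finally have "7 * L ^ 4 / q + 2 * (3 * L * q + real (card A)) / m \<le> (7 * L ^ 4 + 8 * L\<^sup>2) / q"
      by (simp add: add_divide_distrib)
    also have "\<dots> \<le> L ^ 6 / q"
      using L_absorb[of 2 4 8] L_absorb[of 4 6 8] q_pos by (intro divide_right_mono) auto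
    finally show "7 * L ^ 4 / q + 2 * (3 * L * q + real (card A)) / m \<le> L ^ 6 / q" .
  qed simp
  finally show ?thesis .
qed

end


section \<open>Bootstrapping\<close>

context dense_bip begin

text \<open>Collects the error terms of the quotient expansion, with D standing for 1/D0. The input
  error \<kappa> improves to \<kappa>/q; 1/q^3 arises mainly from the diagonal of the second
  moments, which no better input can reduce, and g/q^2 from the columns touched by g extra
  conditions.\<close>

lemma quotient_error_numerics:
  assumes \<kappa>: "\<kappa> \<ge> 0" and g: "0 \<le> g" "g \<le> 80" and D: "0 \<le> D" "D \<le> L ^ 3 / q\<^sup>2" and \<nu>: "\<bar>\<nu>0\<bar> \<le> 4 * L * q"
  shows "(2 * L * q * (8 * \<kappa>) + 2 * g) * D
     + (\<bar>\<nu>0\<bar> * (q\<^sup>2 * (8 * \<kappa>) + (2 * g + 1)) + (2 * L * q * q\<^sup>2 * (8 * \<kappa>) + 2 * L * q + 2 * L * q * (2 * g + 1) + 2 * g * (2 * q\<^sup>2))) * D\<^sup>2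
     + 5 * L * q * (2 * (q\<^sup>2 * q\<^sup>2 * (8 * \<kappa>) + q\<^sup>2) + 2 * (2 * g + 1)\<^sup>2) * D\<^sup>2 * (L ^ 3 / q\<^sup>2)
     + 5 * L * q * (2 * q\<^sup>2)\<^sup>2 * (1 / (q\<^sup>2)\<^sup>2) * D\<^sup>2
    \<le> L ^ 11 * (\<kappa> / q + 1 / q ^ 3 + g / q\<^sup>2)"
proof -
  \<comment> \<open>With q * i = 1 all terms become polynomials in L, q and i, so the divisions
    disappear from the normalisation.\<close>
  define i where "i = 1 / q"
  have i: "i > 0" "q * i = 1" "i \<le> 1 / 1000" using q_pos q_ge by (auto simp: i_def field_simps)
  have D': "D \<le> L ^ 3 * i\<^sup>2" using D by (simp add: i_def power_divide)
  have D2: "D\<^sup>2 \<le> L ^ 6 * i ^ 4"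
    using power_mono[OF D' D(1), of 2] by (simp add: power_mult_distrib flip: power_mult)
  have Lq: "L * q > 0" using L_pos q_pos by simp
  have t1: "(2 * L * q * (8 * \<kappa>) + 2 * g) * D \<le> (2 * L * q * (8 * \<kappa>) + 2 * g) * (L ^ 3 * i\<^sup>2)"
    using \<kappa> g Lq D' L_pos q_pos by (intro mult_left_mono) auto
  have r1: "(2 * L * q * (8 * \<kappa>) + 2 * g) * (L ^ 3 * i\<^sup>2) = 16 * L ^ 4 * (\<kappa> * i) + 2 * L ^ 3 * (g * i\<^sup>2)"
  proof -
    have "(2 * L * q * (8 * \<kappa>) + 2 * g) * (L ^ 3 * i\<^sup>2) = 16 * L ^ 4 * (\<kappa> * i) * (q * i) + 2 * L ^ 3 * (g * i\<^sup>2)"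
      by (simp add: algebra_simps power_numeral_reduce)
    then show ?thesis using i by simp
  qed
  let ?e = "4 * L * q * (q\<^sup>2 * (8 * \<kappa>) + (2 * g + 1)) + (2 * L * q * q\<^sup>2 * (8 * \<kappa>) + 2 * L * q + 2 * L * q * (2 * g + 1) + 2 * g * (2 * q\<^sup>2))"
  have t2: "(\<bar>\<nu>0\<bar> * (q\<^sup>2 * (8 * \<kappa>) + (2 * g + 1)) + (2 * L * q * q\<^sup>2 * (8 * \<kappa>) + 2 * L * q + 2 * L * q * (2 * g + 1) + 2 * g * (2 * q\<^sup>2))) * D\<^sup>2
      \<le> ?e * (L ^ 6 * i ^ 4)"
    using \<kappa> g L_pos q_pos D2 \<nu> by (intro mult_mono add_right_mono) (auto intro!: add_nonneg_nonneg mult_nonneg_nonneg)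
  have r2: "?e * (L ^ 6 * i ^ 4) = 48 * L ^ 7 * (\<kappa> * i) + (12 * g + 8) * L ^ 7 * i ^ 3 + 4 * L ^ 6 * (g * i\<^sup>2)"
  proof -
    have "?e * (L ^ 6 * i ^ 4) = 48 * L ^ 7 * (\<kappa> * i) * (q * i) ^ 3 + (12 * g + 8) * L ^ 7 * i ^ 3 * (q * i) + 4 * L ^ 6 * (g * i\<^sup>2) * (q * i)\<^sup>2"
      by (simp add: algebra_simps power_numeral_reduce)
    then show ?thesis using i by simp
  qed
  let ?f = "5 * L * q * (2 * (q\<^sup>2 * q\<^sup>2 * (8 * \<kappa>) + q\<^sup>2) + 2 * (2 * g + 1)\<^sup>2)"
  have t3: "?f * D\<^sup>2 * (L ^ 3 / q\<^sup>2) \<le> ?f * (L ^ 6 * i ^ 4) * (L ^ 3 / q\<^sup>2)"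
    using \<kappa> g L_pos q_pos D2 by (intro mult_right_mono mult_left_mono) auto
  have r3: "?f * (L ^ 6 * i ^ 4) * (L ^ 3 / q\<^sup>2) = 80 * L ^ 10 * (\<kappa> * i) + 10 * L ^ 10 * i ^ 3 + 10 * (2 * g + 1)\<^sup>2 * i\<^sup>2 * (L ^ 10 * i ^ 3)"
  proof -
    have e: "L ^ 3 / q\<^sup>2 = L ^ 3 * i\<^sup>2" by (simp add: i_def power_divide)
    have "?f * (L ^ 6 * i ^ 4) * (L ^ 3 * i\<^sup>2) = 80 * L ^ 10 * (\<kappa> * i) * (q * i) ^ 5 + 10 * L ^ 10 * i ^ 3 * (q * i) ^ 3 + 10 * (2 * g + 1)\<^sup>2 * i\<^sup>2 * (L ^ 10 * i ^ 3) * (q * i)"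
      by (simp add: algebra_simps power_numeral_reduce)
    then show ?thesis using i e by simp
  qed
  have t4: "5 * L * q * (2 * q\<^sup>2)\<^sup>2 * (1 / (q\<^sup>2)\<^sup>2) * D\<^sup>2 \<le> 20 * L ^ 7 * i ^ 3"
  proof -
    have "5 * L * q * (2 * q\<^sup>2)\<^sup>2 * (1 / (q\<^sup>2)\<^sup>2) = 20 * L * q" using q_pos by (simp add: power_mult_distrib)
    moreover have "20 * L * q * D\<^sup>2 \<le> 20 * L * q * (L ^ 6 * i ^ 4)" using D2 L_pos q_pos by (intro mult_left_mono) auto
    moreover have "20 * L * q * (L ^ 6 * i ^ 4) = 20 * L ^ 7 * i ^ 3 * (q * i)" by (simp add: power_numeral_reduce)
    ultimately show ?thesis using i by simp
  qed
  have g2: "10 * (2 * g + 1)\<^sup>2 * i\<^sup>2 \<le> 1"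
  proof -
    have "(2 * g + 1)\<^sup>2 \<le> 161\<^sup>2" using g by (intro power_mono) auto
    moreover have "i\<^sup>2 \<le> (1/1000)\<^sup>2" using i by (intro power_mono) auto
    ultimately have "(2 * g + 1)\<^sup>2 * i\<^sup>2 \<le> 161\<^sup>2 * (1/1000)\<^sup>2" by (intro mult_mono) auto
    then show ?thesis by (simp add: power2_eq_square)
  qed
  have "10 * (2 * g + 1)\<^sup>2 * i\<^sup>2 * (L ^ 10 * i ^ 3) \<le> 1 * (L ^ 10 * i ^ 3)"
    using g2 i L_pos by (intro mult_right_mono) auto
  moreover have "(12 * g + 8) * L ^ 7 * i ^ 3 \<le> L ^ 8 * i ^ 3"
    using L_absorb[of 7 8 "12 * g + 8"] g i by (intro mult_right_mono) auto
  moreover have "20 * L ^ 7 * i ^ 3 \<le> L ^ 8 * i ^ 3"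
    using L_absorb[of 7 8 20] i by (intro mult_right_mono) auto
  moreover have "L ^ 8 * i ^ 3 \<le> L ^ 10 * i ^ 3" using L_mono[of 8 10] i by (intro mult_right_mono) auto
  moreover have "13 * L ^ 10 * i ^ 3 \<le> L ^ 11 * i ^ 3" using L_absorb[of 10 11 13] i by (intro mult_right_mono) auto
  moreover have ki: "\<kappa> * i \<ge> 0" "g * i\<^sup>2 \<ge> 0" using \<kappa> i g by auto
  moreover have "16 * L ^ 4 * (\<kappa> * i) \<le> 16 * L ^ 10 * (\<kappa> * i)" "48 * L ^ 7 * (\<kappa> * i) \<le> 48 * L ^ 10 * (\<kappa> * i)"
    using L_mono[of 4 10] L_mono[of 7 10] ki by (auto intro!: mult_right_mono)
  moreover have "144 * L ^ 10 * (\<kappa> * i) \<le> L ^ 11 * (\<kappa> * i)" using L_absorb[of 10 11 144] ki by (intro mult_right_mono) auto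
  moreover have "2 * L ^ 3 * (g * i\<^sup>2) \<le> L ^ 10 * (g * i\<^sup>2)" "4 * L ^ 6 * (g * i\<^sup>2) \<le> L ^ 10 * (g * i\<^sup>2)"
     "2 * L ^ 10 * (g * i\<^sup>2) \<le> L ^ 11 * (g * i\<^sup>2)"
    using L_absorb[of 3 10 2] L_absorb[of 6 10 4] L_absorb[of 10 11 2] ki by (auto intro!: mult_right_mono)
  ultimately have "16 * L ^ 4 * (\<kappa> * i) + 2 * L ^ 3 * (g * i\<^sup>2) +
    (48 * L ^ 7 * (\<kappa> * i) + (12 * g + 8) * L ^ 7 * i ^ 3 + 4 * L ^ 6 * (g * i\<^sup>2)) +
    (80 * L ^ 10 * (\<kappa> * i) + 10 * L ^ 10 * i ^ 3 + 10 * (2 * g + 1)\<^sup>2 * i\<^sup>2 * (L ^ 10 * i ^ 3)) +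
    20 * L ^ 7 * i ^ 3 \<le> L ^ 11 * (\<kappa> * i) + L ^ 11 * i ^ 3 + L ^ 11 * (g * i\<^sup>2)"
    by linarith
  also have "\<dots> = L ^ 11 * (\<kappa> / q + 1 / q ^ 3 + g / q\<^sup>2)" by (simp add: i_def field_simps power_divide)
  finally show ?thesis using t1 r1 t2 r2 t3 r3 t4 by linarith
qed

end

section \<open>Near-independence of the edges and moments of switching counts\<close>

context forb_bip begin

text \<open>One function p must serve all ensembles with at most c extra conditions. This uniformity
  is a statement of near-independence, since conditioning on other edges barely changes the
  probability of an edge, and it is what makes second moments accessible.\<close>

definition approx :: "nat \<Rightarrow> real \<Rightarrow> (nat \<times> nat \<Rightarrow> real) \<Rightarrow> bool" where
  "approx c \<kappa> p \<longleftrightarrow> \<kappa> \<ge> 0 \<and> (\<forall>e\<in>{..<m} \<times> {..<n}. 0 \<le> p e \<and> p e \<le> 1 \<and> \<bar>p e - lam\<bar> \<le> L ^ 3 / q) \<and>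
     (\<forall>A U e. near c A U \<longrightarrow> e \<in> {..<m} \<times> {..<n} \<longrightarrow> e \<notin> A \<union> U \<longrightarrow>
         \<bar>NN (insert e A) U - p e * NN A U\<bar> \<le> \<kappa> * NN A U)"

lemma approxD:
  assumes "approx c \<kappa> p"
  shows "\<kappa> \<ge> 0"
    and "e \<in> {..<m} \<times> {..<n} \<Longrightarrow> 0 \<le> p e" "e \<in> {..<m} \<times> {..<n} \<Longrightarrow> p e \<le> 1"
    and "e \<in> {..<m} \<times> {..<n} \<Longrightarrow> \<bar>p e - lam\<bar> \<le> L ^ 3 / q"
    and "near c A U \<Longrightarrow> e \<in> {..<m} \<times> {..<n} \<Longrightarrow> e \<notin> A \<union> U \<Longrightarrow> \<bar>NN (insert e A) U - p e * NN A U\<bar> \<le> \<kappa> * NN A U"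
  using assms unfolding approx_def by blast+

lemma near_union:
  assumes "near d A U" "finite E" "E \<subseteq> {..<m} \<times> {..<n}"
  shows "near (d + card E) (A \<union> E) U"
  using assms card_Un_le[of A E] by (auto simp: near_def)

lemma prod_p_bounds:
  assumes "approx c \<kappa> p" "E \<subseteq> {..<m} \<times> {..<n}"
  shows "0 \<le> prod p E" "prod p E \<le> 1"
  using approxD[OF assms(1)] assms(2) by (auto intro!: prod_nonneg prod_le_1)

text \<open>Chain rule: the edges of E are imposed one at a time, each within the conditioning
  allowed by \<open>approx\<close>. As the factors lie in [0,1], the errors merely add up.\<close>

lemma monomial_approx:
  assumes ap: "approx c \<kappa> p" and near: "near d A U" and E: "finite E" "E \<subseteq> {..<m} \<times> {..<n}" "E \<inter> (A \<union> U) = {}"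
    and c: "d + card E \<le> Suc c"
  shows "\<bar>NN (A \<union> E) U - prod p E * NN A U\<bar> \<le> real (card E) * \<kappa> * NN A U"
  using E c
proof (induction E rule: finite_induct)
  case empty
  then show ?case by simp
next
  case (insert e E)
  let ?N = "NN A U" and ?M = "NN (A \<union> E) U"
  have nE: "near c (A \<union> E) U"
    by (rule near_mono[OF near_union[OF near insert.hyps(1)]]) (use insert in auto)
  have 1: "\<bar>NN (insert e (A \<union> E)) U - p e * ?M\<bar> \<le> \<kappa> * ?M"
    by (rule approxD(5)[OF ap nE]) (use insert in auto)
  have "\<kappa> * ?M \<le> \<kappa> * ?N" using approxD(1)[OF ap] NN_le_A by (intro mult_left_mono)
  with 1 have 1: "\<bar>NN (insert e (A \<union> E)) U - p e * ?M\<bar> \<le> \<kappa> * ?N" by linarith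
  have "\<bar>?M - prod p E * ?N\<bar> \<le> real (card E) * \<kappa> * ?N" by (rule insert.IH) (use insert in auto)
  moreover have "0 \<le> p e" "p e \<le> 1" using approxD(2,3)[OF ap, of e] insert by auto
  ultimately have "\<bar>p e * (?M - prod p E * ?N)\<bar> \<le> 1 * (real (card E) * \<kappa> * ?N)"
    unfolding abs_mult by (intro mult_mono) auto
  moreover have "NN (A \<union> insert e E) U - prod p (insert e E) * ?N
     = (NN (insert e (A \<union> E)) U - p e * ?M) + p e * (?M - prod p E * ?N)"
    using insert.hyps by (simp add: algebra_simps)
  moreover have "real (card (insert e E)) * \<kappa> * ?N = \<kappa> * ?N + 1 * (real (card E) * \<kappa> * ?N)"
    using insert.hyps by (simp add: algebra_simps)
  ultimately show ?case using 1 by linarith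
qed

lemma sum_ens_const: "(\<Sum>G\<in>ens A U. c) = c * NN A U" by (simp add: NN_def mult.commute)

lemma mean_term:
  assumes ap: "approx c \<kappa> p" and near: "near d A U" and E: "finite E" "E \<subseteq> {..<m} \<times> {..<n}" "E \<inter> (A \<union> U) = {}"
    and c: "d + 2 \<le> Suc c" "card E \<le> 2" and \<sigma>: "\<bar>\<sigma>\<bar> \<le> (1::real)"
  shows "\<bar>\<Sum>G\<in>ens A U. \<sigma> * (of_bool (E \<subseteq> G) - prod p E)\<bar> \<le> 8 * \<kappa> * NN A U"
proof -
  have "(\<Sum>G\<in>ens A U. \<sigma> * (of_bool (E \<subseteq> G) - prod p E)) = \<sigma> * (NN (A \<union> E) U - prod p E * NN A U)"
    unfolding sum_distrib_left[symmetric] sum_subtractf NN_eq_sum sum_ens_const ..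
  moreover have "\<bar>\<sigma> * (NN (A \<union> E) U - prod p E * NN A U)\<bar> \<le> 1 * (real (card E) * \<kappa> * NN A U)"
    unfolding abs_mult using monomial_approx[OF ap near E] c \<sigma> by (intro mult_mono) auto
  moreover have "real (card E) * \<kappa> * NN A U \<le> 8 * \<kappa> * NN A U"
    using c approxD(1)[OF ap] by (intro mult_right_mono) auto
  ultimately show ?thesis by linarith
qed

text \<open>A covariance: expanding the product leaves the joint event and the two single ones,
  whose main terms cancel because p is multiplicative over disjoint edge sets. Their errors 4
  \<kappa>, 2 \<kappa> and 2 \<kappa> give the constant 8.\<close>

lemma mean_product:
  assumes ap: "approx c \<kappa> p" and near: "near d A U"
    and E: "finite E" "E \<subseteq> {..<m} \<times> {..<n}" "E \<inter> (A \<union> U) = {}" "card E \<le> 2"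
    and E': "finite E'" "E' \<subseteq> {..<m} \<times> {..<n}" "E' \<inter> (A \<union> U) = {}" "card E' \<le> 2"
    and dj: "E \<inter> E' = {}" and c: "d + 4 \<le> Suc c" and \<sigma>: "\<bar>\<sigma>\<bar> \<le> (1::real)" "\<bar>\<sigma>'\<bar> \<le> (1::real)"
  shows "\<bar>\<Sum>G\<in>ens A U. (\<sigma> * (of_bool (E \<subseteq> G) - prod p E)) * (\<sigma>' * (of_bool (E' \<subseteq> G) - prod p E'))\<bar> \<le> 8 * \<kappa> * NN A U"
proof -
  let ?N = "NN A U" and ?x = "prod p E" and ?y = "prod p E'"
  note pb = prod_p_bounds[OF ap]
  have k0: "\<kappa> * ?N \<ge> 0" using approxD(1)[OF ap] by simp
  have "(\<Sum>G\<in>ens A U. (\<sigma> * (of_bool (E \<subseteq> G) - ?x)) * (\<sigma>' * (of_bool (E' \<subseteq> G) - ?y)))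
     = (\<Sum>G\<in>ens A U. \<sigma> * \<sigma>' * (of_bool (E \<union> E' \<subseteq> G) - ?x * of_bool (E' \<subseteq> G) - ?y * of_bool (E \<subseteq> G) + ?x * ?y))"
    by (rule sum.cong[OF refl]) (auto simp: algebra_simps)
  also have "\<dots> = \<sigma> * \<sigma>' * (NN (A \<union> (E \<union> E')) U - ?x * NN (A \<union> E') U - ?y * NN (A \<union> E) U + ?x * ?y * ?N)"
    unfolding sum_distrib_left[symmetric] sum.distrib sum_subtractf NN_eq_sum sum_ens_const by (simp only: mult.assoc)
  also have "\<dots> = \<sigma> * \<sigma>' * ((NN (A \<union> (E \<union> E')) U - ?x * ?y * ?N) - ?x * (NN (A \<union> E') U - ?y * ?N) - ?y * (NN (A \<union> E) U - ?x * ?N))"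
    by (simp add: algebra_simps)
  finally have eq: "(\<Sum>G\<in>ens A U. (\<sigma> * (of_bool (E \<subseteq> G) - ?x)) * (\<sigma>' * (of_bool (E' \<subseteq> G) - ?y))) =
     \<sigma> * \<sigma>' * ((NN (A \<union> (E \<union> E')) U - ?x * ?y * ?N) - ?x * (NN (A \<union> E') U - ?y * ?N) - ?y * (NN (A \<union> E) U - ?x * ?N))" .
  have cU: "card (E \<union> E') \<le> 4" using card_Un_le[of E E'] E E' by linarith
  have "\<bar>NN (A \<union> (E \<union> E')) U - prod p (E \<union> E') * ?N\<bar> \<le> real (card (E \<union> E')) * \<kappa> * ?N"
    by (rule monomial_approx[OF ap near]) (use E E' cU c in auto)
  also have "\<dots> \<le> 4 * (\<kappa> * ?N)" using cU k0 by (auto simp: mult.assoc intro!: mult_right_mono)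
  finally have 1: "\<bar>NN (A \<union> (E \<union> E')) U - ?x * ?y * ?N\<bar> \<le> 4 * (\<kappa> * ?N)"
    using prod.union_disjoint[OF E(1) E'(1) dj, of p] by simp
  have "\<bar>NN (A \<union> E') U - ?y * ?N\<bar> \<le> real (card E') * \<kappa> * ?N"
    by (rule monomial_approx[OF ap near]) (use E' c in auto)
  also have "\<dots> \<le> 2 * (\<kappa> * ?N)" using E' k0 by (auto simp: mult.assoc intro!: mult_right_mono)
  finally have 2: "\<bar>?x * (NN (A \<union> E') U - ?y * ?N)\<bar> \<le> 1 * (2 * (\<kappa> * ?N))"
    unfolding abs_mult using pb[OF E(2)] by (intro mult_mono) auto
  have "\<bar>NN (A \<union> E) U - ?x * ?N\<bar> \<le> real (card E) * \<kappa> * ?N"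
    by (rule monomial_approx[OF ap near]) (use E c in auto)
  also have "\<dots> \<le> 2 * (\<kappa> * ?N)" using E k0 by (auto simp: mult.assoc intro!: mult_right_mono)
  finally have 3: "\<bar>?y * (NN (A \<union> E) U - ?x * ?N)\<bar> \<le> 1 * (2 * (\<kappa> * ?N))"
    unfolding abs_mult using pb[OF E'(2)] by (intro mult_mono) auto
  have b: "\<bar>(NN (A \<union> (E \<union> E')) U - ?x * ?y * ?N) - ?x * (NN (A \<union> E') U - ?y * ?N) - ?y * (NN (A \<union> E) U - ?x * ?N)\<bar> \<le> 8 * (\<kappa> * ?N)"
    using 1 2 3 by linarith
  have "\<bar>\<sigma> * \<sigma>'\<bar> \<le> 1" using \<sigma> by (auto simp: abs_mult intro: mult_le_one)
  from mult_mono[OF this b] show ?thesis unfolding eq abs_mult[of "\<sigma> * \<sigma>'"] by simp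
qed

text \<open>For \<open>G\<close> avoiding \<open>F\<close>, the difference of the two numbers of switchings between rows
\<open>a\<close> and \<open>b\<close> is, up to boundedly many columns, \<open>s a - s b\<close> plus the sum over all columns of
\<open>sphi * of_bool (Ephi \<subseteq> G)\<close>, and the number of reverse switchings is \<open>s b\<close> plus the sum of
\<open>spsi * of_bool (Epsi \<subseteq> G)\<close>. The numbers \<open>nu0\<close> and \<open>D0\<close> are their means if the edges
were independent with probabilities \<open>p\<close>.\<close>

definition sphi :: "nat \<Rightarrow> nat \<Rightarrow> nat \<Rightarrow> real" where
  "sphi a b k = (if (b,k) \<in> F \<and> (a,k) \<notin> F then -1 else if (a,k) \<in> F \<and> (b,k) \<notin> F then 1 else 0)"
definition Ephi :: "nat \<Rightarrow> nat \<Rightarrow> nat \<Rightarrow> (nat \<times> nat) set" where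
  "Ephi a b k = (if (b,k) \<in> F \<and> (a,k) \<notin> F then {(a,k)} else if (a,k) \<in> F \<and> (b,k) \<notin> F then {(b,k)} else {})"
definition spsi :: "nat \<Rightarrow> nat \<Rightarrow> nat \<Rightarrow> real" where
  "spsi a b k = (if (b,k) \<in> F then 0 else -1)"
definition Epsi :: "nat \<Rightarrow> nat \<Rightarrow> nat \<Rightarrow> (nat \<times> nat) set" where
  "Epsi a b k = (if (b,k) \<in> F then {} else if (a,k) \<in> F then {(b,k)} else {(a,k),(b,k)})"

definition nu0 :: "(nat \<times> nat \<Rightarrow> real) \<Rightarrow> nat \<Rightarrow> nat \<Rightarrow> real" where
  "nu0 p a b = real (s a) - real (s b) + (\<Sum>k<n. sphi a b k * prod p (Ephi a b k))"
definition D0 :: "(nat \<times> nat \<Rightarrow> real) \<Rightarrow> nat \<Rightarrow> nat \<Rightarrow> real" where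
  "D0 p a b = real (s b) + (\<Sum>k<n. spsi a b k * prod p (Epsi a b k))"

lemma card_as_sum: "S \<subseteq> {..<n} \<Longrightarrow> real (card S) = (\<Sum>k<n. of_bool (k \<in> S))"
  by (simp add: sum.If_cases of_bool_def Int_absorb1)

lemma row_counts:
  assumes G: "G \<in> ens A U" "F \<subseteq> U"
  shows "- real (card {k. (a,k) \<in> G \<and> (b,k) \<in> F}) + real (card {k. (b,k) \<in> G \<and> (a,k) \<in> F})
      = (\<Sum>k<n. sphi a b k * of_bool (Ephi a b k \<subseteq> G))"
    and "- real (card {k. (b,k) \<in> G \<and> (a,k) \<in> F}) - real (card {k. (b,k) \<in> G \<and> (a,k) \<in> G})
      = (\<Sum>k<n. spsi a b k * of_bool (Epsi a b k \<subseteq> G))"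
proof -
  have box: "G \<subseteq> {..<m} \<times> {..<n}" by (rule ens_box[OF G(1)])
  have FG: "\<And>e. e \<in> F \<Longrightarrow> e \<notin> G" using G by (auto simp: ens_def)
  have c: "real (card {k. (a,k) \<in> G \<and> P k}) = (\<Sum>k<n. of_bool ((a,k) \<in> G \<and> P k))" for a P
    by (subst card_as_sum) (use box in auto)
  show "- real (card {k. (a,k) \<in> G \<and> (b,k) \<in> F}) + real (card {k. (b,k) \<in> G \<and> (a,k) \<in> F})
      = (\<Sum>k<n. sphi a b k * of_bool (Ephi a b k \<subseteq> G))"
    unfolding c sum_negf[symmetric] sum.distrib[symmetric]
    by (rule sum.cong[OF refl]) (auto simp: sphi_def Ephi_def dest: FG)
  show "- real (card {k. (b,k) \<in> G \<and> (a,k) \<in> F}) - real (card {k. (b,k) \<in> G \<and> (a,k) \<in> G})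
      = (\<Sum>k<n. spsi a b k * of_bool (Epsi a b k \<subseteq> G))"
    unfolding c sum_negf[symmetric] sum_subtractf[symmetric]
    by (rule sum.cong[OF refl]) (auto simp: spsi_def Epsi_def dest: FG)
qed

lemma phi_psi_simps:
  "\<bar>sphi a b k\<bar> \<le> 1" "\<bar>spsi a b k\<bar> \<le> 1" "finite (Ephi a b k)" "finite (Epsi a b k)"
  "card (Ephi a b k) \<le> 2" "card (Epsi a b k) \<le> 2"
  "Ephi a b k \<subseteq> {(a,k),(b,k)} - F" "Epsi a b k \<subseteq> {(a,k),(b,k)} - F"
  by (auto simp: sphi_def spsi_def Ephi_def Epsi_def card_insert_if)


lemma sum_F_row: "a < m \<Longrightarrow> (\<Sum>k<n. of_bool ((a,k) \<in> F)) = real (card {k. (a,k) \<in> F})"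
  "a < m \<Longrightarrow> (\<Sum>k<n. of_bool ((a,k) \<in> F)) \<le> L * q"
proof -
  show 1: "(\<Sum>k<n. of_bool ((a,k) \<in> F)) = real (card {k. (a,k) \<in> F})"
    by (subst card_as_sum) (use F_box in auto)
  show "a < m \<Longrightarrow> (\<Sum>k<n. of_bool ((a,k) \<in> F)) \<le> L * q" unfolding 1 by (rule F_row)
qed

lemma sphi_le: "\<bar>sphi a b k\<bar> \<le> of_bool ((a,k) \<in> F) + of_bool ((b,k) \<in> F)"
  by (simp add: sphi_def)

lemma box_phi: assumes "a < m" "b < m" "k < n"
  shows "Ephi a b k \<subseteq> {..<m} \<times> {..<n}" "Epsi a b k \<subseteq> {..<m} \<times> {..<n}"
  using assms by (auto simp: Ephi_def Epsi_def)

lemma nu0_le: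
  assumes ap: "approx c \<kappa> p" and ab: "a < m" "b < m"
  shows "\<bar>nu0 p a b\<bar> \<le> 4 * L * q"
proof -
  have "\<bar>\<Sum>k<n. sphi a b k * prod p (Ephi a b k)\<bar> \<le> (\<Sum>k<n. \<bar>sphi a b k * prod p (Ephi a b k)\<bar>)" by (rule sum_abs)
  also have "\<dots> \<le> (\<Sum>k<n. of_bool ((a,k) \<in> F) + of_bool ((b,k) \<in> F))"
  proof (rule sum_mono)
    fix k assume k: "k \<in> {..<n}"
    have "\<bar>sphi a b k * prod p (Ephi a b k)\<bar> \<le> (of_bool ((a,k) \<in> F) + of_bool ((b,k) \<in> F)) * 1"
      unfolding abs_mult using sphi_le prod_p_bounds[OF ap box_phi(1)[OF ab]] k by (intro mult_mono) auto
    then show "\<bar>sphi a b k * prod p (Ephi a b k)\<bar> \<le> of_bool ((a,k) \<in> F) + of_bool ((b,k) \<in> F)" by simp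
  qed
  also have "\<dots> \<le> 2 * L * q" unfolding sum.distrib using sum_F_row(2)[OF ab(1)] sum_F_row(2)[OF ab(2)] by linarith
  finally show ?thesis unfolding nu0_def using s_dev[OF ab(1)] s_dev[OF ab(2)] by linarith
qed

text \<open>With p near \<open>lam\<close> the sum of the column terms is close to - lam^2 n, so
  \<open>D0\<close> is lam n - lam^2 n up to O(L^4 q): L^3 / q per column, and at most 1 in each of
  the 2 L q columns meeting \<open>F\<close>.\<close>

lemma D0_approx:
  assumes ap: "approx c \<kappa> p" and ab: "a < m" "b < m" "a \<noteq> b"
  shows "\<bar>D0 p a b - gam * real n\<bar> \<le> L ^ 4 * q" "real n / L ^ 3 \<le> D0 p a b" "D0 p a b \<le> 2 * real n"
proof -
  have "(\<Sum>k<n. spsi a b k * prod p (Epsi a b k) + lam\<^sup>2) = (\<Sum>k<n. spsi a b k * prod p (Epsi a b k)) + lam\<^sup>2 * n"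
    by (simp add: sum.distrib)
  then have "D0 p a b - gam * real n = (real (s b) - lam * n) + (\<Sum>k<n. spsi a b k * prod p (Epsi a b k) + lam\<^sup>2)"
    unfolding D0_def by (simp add: algebra_simps power2_eq_square)
  moreover have "\<bar>\<Sum>k<n. spsi a b k * prod p (Epsi a b k) + lam\<^sup>2\<bar> \<le> (\<Sum>k<n. 2 * L ^ 3 / q + of_bool ((a,k) \<in> F) + of_bool ((b,k) \<in> F))"
  proof (rule order_trans[OF sum_abs sum_mono])
    fix k assume k: "k \<in> {..<n}"
    have l2: "0 \<le> lam\<^sup>2" "lam\<^sup>2 \<le> 1" using lam_pos lam1 by (auto simp: power_le_one)
    have q0: "2 * L ^ 3 / q \<ge> 0" using L_pos q_pos by simp
    show "\<bar>spsi a b k * prod p (Epsi a b k) + lam\<^sup>2\<bar> \<le> 2 * L ^ 3 / q + of_bool ((a,k) \<in> F) + of_bool ((b,k) \<in> F)"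
    proof (cases "(a,k) \<in> F \<or> (b,k) \<in> F")
      case True
      have P: "0 \<le> prod p (Epsi a b k)" "prod p (Epsi a b k) \<le> 1" using prod_p_bounds[OF ap box_phi(2)[OF ab(1,2)]] k by auto
      have "\<bar>spsi a b k * prod p (Epsi a b k) + lam\<^sup>2\<bar> \<le> 1"
      proof (cases "(b,k) \<in> F")
        case True
        then show ?thesis using l2 by (simp add: spsi_def)
      next
        case False
        then have "spsi a b k * prod p (Epsi a b k) + lam\<^sup>2 = lam\<^sup>2 - prod p (Epsi a b k)" by (simp add: spsi_def)
        then show ?thesis using P l2 by linarith
      qed
      then show ?thesis using True q0 by auto
    next
      case False
      have ba: "(a,k) \<in> {..<m} \<times> {..<n}" "(b,k) \<in> {..<m} \<times> {..<n}" using ab k by auto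
      have "spsi a b k * prod p (Epsi a b k) + lam\<^sup>2 = - (p (a,k) * (p (b,k) - lam)) - lam * (p (a,k) - lam)"
        using False ab by (simp add: spsi_def Epsi_def algebra_simps power2_eq_square)
      moreover have "\<bar>p (a,k) * (p (b,k) - lam)\<bar> \<le> 1 * (L ^ 3 / q)"
        unfolding abs_mult using approxD(2-4)[OF ap ba(1)] approxD(2-4)[OF ap ba(2)] by (intro mult_mono) auto
      moreover have "\<bar>lam * (p (a,k) - lam)\<bar> \<le> 1 * (L ^ 3 / q)"
        unfolding abs_mult using approxD(2-4)[OF ap ba(1)] lam_pos lam1 by (intro mult_mono) auto
      ultimately show ?thesis using False by simp
    qed
  qed
  moreover have "(\<Sum>k<n. 2 * L ^ 3 / q + of_bool ((a,k) \<in> F) + of_bool ((b,k) \<in> F)) \<le> 2 * L ^ 3 * q + L * q + L * q"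
  proof -
    have "real n * (2 * L ^ 3 / q) = 2 * L ^ 3 * q" using q_pos by (simp add: q2[symmetric] power2_eq_square)
    then show ?thesis unfolding sum.distrib using sum_F_row(2)[OF ab(1)] sum_F_row(2)[OF ab(2)] by simp
  qed
  moreover have "2 * L ^ 3 * q + 3 * L * q \<le> L ^ 4 * q"
  proof -
    have "3 * L ^ 3 * q \<le> L ^ 4 * q" using L_absorb[of 3 4 3] q_pos by (intro mult_right_mono) auto
    moreover have "3 * L ^ 1 * q \<le> L ^ 3 * q" using L_absorb[of 1 3 3] q_pos by (intro mult_right_mono) auto
    ultimately show ?thesis by simp
  qed
  ultimately show 1: "\<bar>D0 p a b - gam * real n\<bar> \<le> L ^ 4 * q" using s_dev[OF ab(2)] by linarith
  have a: "2 * L ^ 4 * q \<le> gam * n"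
  proof -
    have "2 * L ^ 4 * q \<le> L ^ 40 * q" using L_absorb[of 4 40 2] q_pos by (intro mult_right_mono) auto
    then show ?thesis using gamn_ge by linarith
  qed
  have "real n / L ^ 3 \<le> gam * n / 2"
  proof -
    have "real n / L ^ 3 \<le> 1 / L\<^sup>2 * n / 2" using L_ge L_pos n_pos by (simp add: field_simps power_numeral_reduce)
    also have "\<dots> \<le> gam * n / 2" using gam_ge by (intro divide_right_mono mult_right_mono) auto
    finally show ?thesis .
  qed
  then show "real n / L ^ 3 \<le> D0 p a b" using 1 a by linarith
  have "gam * real n \<le> 1 * real n" using gam_le by (intro mult_right_mono) auto
  then show "D0 p a b \<le> 2 * real n" using 1 a n_pos by linarith
qed

text \<open>Near-independence feeds the expansion of the mean quotient. The numerator is random only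
  in the O(L q) columns where \<open>F\<close> meets row a or b, the denominator in up to n columns.
  This asymmetry makes the covariance of order q (n \<kappa> + 1) against a variance of order n (n
  \<kappa> + 1), as the gain of a factor q requires.\<close>

lemma switch_mean_approx:
  assumes ap: "approx c \<kappa> p" and near: "near g A U" and c: "g + 5 \<le> c" "g \<le> 80"
    and ab: "a < m" "b < m" "a \<noteq> b" and k: "k < n" and e: "(a,k) \<notin> A \<union> U" "(b,k) \<notin> A \<union> U"
  shows "\<bar>(\<Sum>G\<in>ens (insert (b,k) A) (insert (a,k) U).
            (real (card (wset A U a b G)) - real (card (wset A U b a G))) / real (card (wset A U b a G)))
       - nu0 p a b / D0 p a b * NN (insert (b,k) A) (insert (a,k) U)\<bar>
     \<le> L ^ 11 * (\<kappa> / q + 1 / q ^ 3 + real g / q\<^sup>2) * NN (insert (b,k) A) (insert (a,k) U)"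
proof -
  let ?A = "insert (b,k) A" and ?U = "insert (a,k) U"
  let ?O = "ens ?A ?U" and ?N = "NN ?A ?U"
  let ?W = "\<lambda>a b G. real (card (wset A U a b G))"
  define \<nu> where "\<nu> G = ?W a b G - ?W b a G" for G
  define D where "D G = ?W b a G" for G
  define x where "x l G = sphi a b l * (of_bool (Ephi a b l \<subseteq> G) - prod p (Ephi a b l))" for l G
  define y where "y l G = spsi a b l * (of_bool (Epsi a b l \<subseteq> G) - prod p (Epsi a b l))" for l G
  \<comment> \<open>In the columns of \<open>K\<close> the relevant edges are unconditioned, so the
    moment bounds apply. \<open>Z\<close> holds the at most g columns touched by extra conditions,
    each costing O(1); \<open>Q\<close> carries all the randomness of the numerator inside
    \<open>K\<close>.\<close>
  define K where "K = {l. l < n \<and> l \<noteq> k \<and> (a,l) \<notin> A \<union> (U - F) \<and> (b,l) \<notin> A \<union> (U - F)}"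
  define Q where "Q = {l \<in> K. (a,l) \<in> F \<or> (b,l) \<in> F}"
  define Z where "Z = {l. l < n \<and> l \<noteq> k \<and> ((a,l) \<in> A \<union> (U - F) \<or> (b,l) \<in> A \<union> (U - F))}"
  have fin: "finite K" "finite Q" "finite Z" unfolding K_def Q_def Z_def by auto
  have near1: "near (Suc (Suc g)) ?A ?U" using near_insert_U[OF near_insert_A[OF near]] ab k by auto
  have FU: "F \<subseteq> U" using near by (simp add: near_def)
  have FU': "F \<subseteq> ?U" using FU by auto
  have keF: "(a,k) \<notin> F" "(b,k) \<notin> F" using e FU by auto
  have g0: "0 \<le> real g" "real g \<le> 80" using c by auto
  have \<kappa>0: "\<kappa> \<ge> 0" by (rule approxD(1)[OF ap])
  have cardK: "card K \<le> n" using card_mono[of "{..<n}" K] by (auto simp: K_def)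
  have cardZ: "real (card Z) \<le> g"
  proof -
    have f: "finite (A \<union> (U - F))" using near_finite[OF near] by auto
    have "Z \<subseteq> snd ` (A \<union> (U - F))" unfolding Z_def by force
    then have "card Z \<le> card (A \<union> (U - F))" using surj_card_le[OF f] by blast
    also have "\<dots> \<le> card A + card (U - F)" by (rule card_Un_le)
    finally show ?thesis using near by (simp add: near_def)
  qed
  have cardQ: "real (card Q) \<le> 2 * L * q"
  proof -
    have "card Q \<le> card ({l. (a,l) \<in> F} \<union> {l. (b,l) \<in> F})"
      by (rule card_mono) (use finite_row[OF F_box] in \<open>auto simp: Q_def\<close>)
    also have "\<dots> \<le> card {l. (a,l) \<in> F} + card {l. (b,l) \<in> F}" by (rule card_Un_le)
    finally show ?thesis using F_row[OF ab(1)] F_row[OF ab(2)] by linarith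
  qed
  have x1: "\<bar>x l G\<bar> \<le> 1" and y1: "\<bar>y l G\<bar> \<le> 1" if "l < n" for l G
  proof -
    have *: "\<bar>of_bool P - r\<bar> \<le> 1" if "0 \<le> r" "r \<le> (1::real)" for P r using that by auto
    show "\<bar>x l G\<bar> \<le> 1" unfolding x_def abs_mult
      by (rule mult_le_one[OF phi_psi_simps(1) _ *]) (use prod_p_bounds[OF ap box_phi(1)[OF ab(1,2) that]] in auto)
    show "\<bar>y l G\<bar> \<le> 1" unfolding y_def abs_mult
      by (rule mult_le_one[OF phi_psi_simps(2) _ *]) (use prod_p_bounds[OF ap box_phi(2)[OF ab(1,2) that]] in auto)
  qed
  have split: "(\<Sum>l<n. f l) = (\<Sum>l\<in>K. f l) + (\<Sum>l\<in>Z. f l) + f k" for f :: "nat \<Rightarrow> real"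
  proof -
    have "{..<n} = insert k (K \<union> Z)" using k by (auto simp: K_def Z_def)
    moreover have "k \<notin> K \<union> Z" "K \<inter> Z = {}" by (auto simp: K_def Z_def)
    ultimately show ?thesis using fin by (simp add: sum.union_disjoint)
  qed
  have sumZ: "\<bar>\<Sum>l\<in>Z. f l\<bar> \<le> g" if "\<And>l. l < n \<Longrightarrow> \<bar>f l\<bar> \<le> 1" for f :: "nat \<Rightarrow> real"
  proof -
    have "\<bar>\<Sum>l\<in>Z. f l\<bar> \<le> (\<Sum>l\<in>Z. \<bar>f l\<bar>)" by (rule sum_abs)
    also have "\<dots> \<le> (\<Sum>l\<in>Z. 1)" by (rule sum_mono) (use that in \<open>auto simp: Z_def\<close>)
    finally show ?thesis using cardZ by simp
  qed
  have com: "{k. (b,k) \<in> G \<and> (a,k) \<in> G} = {k. (a,k) \<in> G \<and> (b,k) \<in> G}" for G by auto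
  have u: "\<bar>(\<nu> G - nu0 p a b) - (\<Sum>l\<in>Q. x l G)\<bar> \<le> 2 * real g" if G: "G \<in> ?O" for G
  proof -
    note wb = wset_card_bounds[OF near G subset_insertI ab(1), of b] wset_card_bounds[OF near G subset_insertI ab(2), of a]
    have "\<bar>\<nu> G - (real (s a) - real (s b) + (\<Sum>l<n. sphi a b l * of_bool (Ephi a b l \<subseteq> G)))\<bar> \<le> g"
      using wb row_counts(1)[OF G FU', of a b] unfolding \<nu>_def com by linarith
    moreover have "(real (s a) - real (s b) + (\<Sum>l<n. sphi a b l * of_bool (Ephi a b l \<subseteq> G))) - nu0 p a b = (\<Sum>l<n. x l G)"
      unfolding nu0_def x_def by (simp add: sum_subtractf algebra_simps)
    moreover have "(\<Sum>l<n. x l G) = (\<Sum>l\<in>K. x l G) + (\<Sum>l\<in>Z. x l G) + x k G" by (rule split)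
    \<comment> \<open>Column k avoids \<open>F\<close> in both rows and does not affect the
      numerator; in the denominator it is responsible for the additional 1 in the bound
      \<open>v\<close>.\<close>
    moreover have "x k G = 0" using keF by (simp add: x_def sphi_def)
    moreover have "(\<Sum>l\<in>K. x l G) = (\<Sum>l\<in>Q. x l G)"
      by (rule sum.mono_neutral_right) (use fin in \<open>auto simp: Q_def x_def sphi_def\<close>)
    moreover have "\<bar>\<Sum>l\<in>Z. x l G\<bar> \<le> g" by (rule sumZ) (rule x1)
    ultimately show ?thesis by linarith
  qed
  have v: "\<bar>(D G - D0 p a b) - (\<Sum>l\<in>K. y l G)\<bar> \<le> 2 * real g + 1" if G: "G \<in> ?O" for G
  proof -
    note wb = wset_card_bounds[OF near G subset_insertI ab(2), of a]
    have "\<bar>D G - (real (s b) + (\<Sum>l<n. spsi a b l * of_bool (Epsi a b l \<subseteq> G)))\<bar> \<le> g"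
      using wb row_counts(2)[OF G FU', of b a] unfolding D_def by linarith
    moreover have "(real (s b) + (\<Sum>l<n. spsi a b l * of_bool (Epsi a b l \<subseteq> G))) - D0 p a b = (\<Sum>l<n. y l G)"
      unfolding D0_def y_def by (simp add: sum_subtractf algebra_simps)
    moreover have "(\<Sum>l<n. y l G) = (\<Sum>l\<in>K. y l G) + (\<Sum>l\<in>Z. y l G) + y k G" by (rule split)
    moreover have "\<bar>y k G\<bar> \<le> 1" using y1[OF k] .
    moreover have "\<bar>\<Sum>l\<in>Z. y l G\<bar> \<le> g" by (rule sumZ) (rule y1)
    ultimately show ?thesis by linarith
  qed
  have EK: "{(a,l),(b,l)} - F \<subseteq> {..<m} \<times> {..<n}" "({(a,l),(b,l)} - F) \<inter> (?A \<union> ?U) = {}" if "l \<in> K" for l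
    using that ab FU by (auto simp: K_def)
  have djs: "S \<inter> X = {}" if "S \<subseteq> T" "T \<inter> X = {}" for S T X :: "(nat \<times> nat) set" using that by blast
  have EK1: "Ephi a b l \<subseteq> {..<m} \<times> {..<n}" "Ephi a b l \<inter> (?A \<union> ?U) = {}"
     "Epsi a b l \<subseteq> {..<m} \<times> {..<n}" "Epsi a b l \<inter> (?A \<union> ?U) = {}" if "l \<in> K" for l
    by (rule order_trans[OF phi_psi_simps(7) EK(1)[OF that]] djs[OF phi_psi_simps(7) EK(2)[OF that]]
        order_trans[OF phi_psi_simps(8) EK(1)[OF that]] djs[OF phi_psi_simps(8) EK(2)[OF that]])+
  have dj: "Ephi a b l \<inter> Epsi a b l' = {}" "Epsi a b l \<inter> Epsi a b l' = {}" if "l \<noteq> l'" for l l'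
  proof -
    have d: "({(a,l),(b,l)} - F) \<inter> ({(a,l'),(b,l')} - F) = {}" using that by auto
    have dd: "S \<inter> S' = {}" if "S \<subseteq> T" "S' \<subseteq> T'" "T \<inter> T' = {}" for S S' T T' :: "(nat \<times> nat) set"
      using that by blast
    show "Ephi a b l \<inter> Epsi a b l' = {}" by (rule dd[OF phi_psi_simps(7,8) d])
    show "Epsi a b l \<inter> Epsi a b l' = {}" by (rule dd[OF phi_psi_simps(8,8) d])
  qed
  have QK: "l \<in> K" "l < n" if "l \<in> Q" for l using that by (auto simp: Q_def K_def)
  have Kn: "l < n" if "l \<in> K" for l using that by (auto simp: K_def)
  have mx: "\<bar>\<Sum>G\<in>?O. x l G\<bar> \<le> 8 * \<kappa> * ?N" and my: "\<bar>\<Sum>G\<in>?O. y l G\<bar> \<le> 8 * \<kappa> * ?N" if "l \<in> K" for l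
    unfolding x_def y_def using EK1[OF that] c
    by (auto intro!: mean_term[OF ap near1 phi_psi_simps(3) _ _ _ phi_psi_simps(5) phi_psi_simps(1)]
       mean_term[OF ap near1 phi_psi_simps(4) _ _ _ phi_psi_simps(6) phi_psi_simps(2)])
  \<comment> \<open>The switching fixes two edges and the product involves up to four more, the last
    being estimated while the other three are fixed: this is the requirement g + 5 \<le> c.\<close>
  have mxy: "\<bar>\<Sum>G\<in>?O. x l G * y l' G\<bar> \<le> 8 * \<kappa> * ?N" if "l \<in> Q" "l' \<in> K" "l \<noteq> l'" for l l'
    unfolding x_def y_def
    by (rule mean_product[OF ap near1 phi_psi_simps(3) EK1(1)[OF QK(1)[OF that(1)]] EK1(2)[OF QK(1)[OF that(1)]] phi_psi_simps(5)
        phi_psi_simps(4) EK1(3)[OF that(2)] EK1(4)[OF that(2)] phi_psi_simps(6) dj(1)[OF that(3)] _ phi_psi_simps(1,2)])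
      (use c in simp)
  have myy: "\<bar>\<Sum>G\<in>?O. y l G * y l' G\<bar> \<le> 8 * \<kappa> * ?N" if "l \<in> K" "l' \<in> K" "l \<noteq> l'" for l l'
    unfolding y_def
    by (rule mean_product[OF ap near1 phi_psi_simps(4) EK1(3)[OF that(1)] EK1(4)[OF that(1)] phi_psi_simps(6)
        phi_psi_simps(4) EK1(3)[OF that(2)] EK1(4)[OF that(2)] phi_psi_simps(6) dj(2)[OF that(3)] _ phi_psi_simps(2,2)])
      (use c in simp)
  have NO: "?N = real (card ?O)" by (simp add: NN_def)
  have sumc: "(\<Sum>G\<in>?O. r) = r * ?N" for r by (rule sum_ens_const)
  have e1: "\<bar>\<Sum>G\<in>?O. \<nu> G - nu0 p a b\<bar> \<le> (2 * L * q * (8 * \<kappa>) + 2 * real g) * ?N"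
  proof -
    have "\<bar>\<Sum>G\<in>?O. (\<nu> G - nu0 p a b) - (\<Sum>l\<in>Q. x l G)\<bar> \<le> (\<Sum>G\<in>?O. 2 * real g)"
      by (rule order_trans[OF sum_abs sum_mono]) (rule u)
    moreover have "\<bar>\<Sum>G\<in>?O. \<Sum>l\<in>Q. x l G\<bar> \<le> 2 * L * q * (8 * \<kappa> * ?N)"
    proof -
      have "\<bar>\<Sum>l\<in>Q. \<Sum>G\<in>?O. x l G\<bar> \<le> (\<Sum>l\<in>Q. 8 * \<kappa> * ?N)"
        by (rule order_trans[OF sum_abs sum_mono]) (use mx QK in auto)
      also have "\<dots> = real (card Q) * (8 * \<kappa> * ?N)" by simp
      also have "\<dots> \<le> 2 * L * q * (8 * \<kappa> * ?N)" using cardQ \<kappa>0 by (intro mult_right_mono) auto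
      finally show ?thesis by (subst sum.swap)
    qed
    ultimately show ?thesis unfolding sum_subtractf[of _ "\<lambda>G. \<Sum>l\<in>Q. x l G"] sumc by (simp add: algebra_simps)
  qed
  have e2: "\<bar>\<Sum>G\<in>?O. D G - D0 p a b\<bar> \<le> (real n * (8 * \<kappa>) + (2 * real g + 1)) * ?N"
  proof -
    have "\<bar>\<Sum>G\<in>?O. (D G - D0 p a b) - (\<Sum>l\<in>K. y l G)\<bar> \<le> (\<Sum>G\<in>?O. 2 * real g + 1)"
      by (rule order_trans[OF sum_abs sum_mono]) (rule v)
    moreover have "\<bar>\<Sum>G\<in>?O. \<Sum>l\<in>K. y l G\<bar> \<le> real n * (8 * \<kappa> * ?N)"
    proof -
      have "\<bar>\<Sum>l\<in>K. \<Sum>G\<in>?O. y l G\<bar> \<le> (\<Sum>l\<in>K. 8 * \<kappa> * ?N)"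
        by (rule order_trans[OF sum_abs sum_mono]) (use my in auto)
      also have "\<dots> = real (card K) * (8 * \<kappa> * ?N)" by simp
      also have "\<dots> \<le> real n * (8 * \<kappa> * ?N)" using cardK \<kappa>0 by (intro mult_right_mono) auto
      finally show ?thesis by (subst sum.swap)
    qed
    ultimately show ?thesis unfolding sum_subtractf[of _ "\<lambda>G. \<Sum>l\<in>K. y l G"] sumc by (simp add: algebra_simps)
  qed
  have D0b: "real n / L ^ 3 \<le> D0 p a b" "D0 p a b \<le> 2 * real n" using D0_approx[OF ap ab] by auto
  have D1: "D G \<ge> 1" and Dn: "D G \<le> n" if "G \<in> ?O" for G
  proof -
    show "D G \<ge> 1" unfolding D_def by (rule wset_ge1[OF that e])
    have "card (wset A U b a G) \<le> card {..<n}" by (rule card_mono) (use ens_box[OF that] in \<open>auto simp: wset_def\<close>)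
    then show "D G \<le> n" by (simp add: D_def)
  qed
  have D0p: "D0 p a b > 0" using D0b(1) n_pos L_pos by (meson divide_pos_pos less_le_trans zero_less_power)
  have V: "\<bar>D G - D0 p a b\<bar> \<le> 2 * real n" if "G \<in> ?O" for G using D1[OF that] Dn[OF that] D0b D0p by linarith
  have e3: "\<bar>\<Sum>G\<in>?O. (\<nu> G - nu0 p a b) * (D G - D0 p a b)\<bar>
     \<le> (2 * L * q * real n * (8 * \<kappa>) + 2 * L * q + 2 * L * q * (2 * real g + 1) + 2 * real g * (2 * real n)) * ?N"
  proof -
    have "\<bar>\<Sum>G\<in>?O. (\<nu> G - nu0 p a b) * (D G - D0 p a b) - (\<Sum>l\<in>Q. x l G) * (\<Sum>l\<in>K. y l G)\<bar>
       \<le> (\<Sum>G\<in>?O. 2 * L * q * (2 * real g + 1) + 2 * real g * (2 * real n))"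
    proof (rule order_trans[OF sum_abs sum_mono])
      fix G assume G: "G \<in> ?O"
      let ?x = "\<Sum>l\<in>Q. x l G" and ?y = "\<Sum>l\<in>K. y l G"
      have "\<bar>?x\<bar> \<le> (\<Sum>l\<in>Q. 1)" by (rule order_trans[OF sum_abs sum_mono]) (use x1 QK in auto)
      then have xq: "\<bar>?x\<bar> \<le> 2 * L * q" using cardQ by simp
      have "(\<nu> G - nu0 p a b) * (D G - D0 p a b) - ?x * ?y
         = ?x * ((D G - D0 p a b) - ?y) + ((\<nu> G - nu0 p a b) - ?x) * (D G - D0 p a b)"
        by (simp add: algebra_simps)
      moreover have "\<bar>?x * ((D G - D0 p a b) - ?y)\<bar> \<le> 2 * L * q * (2 * real g + 1)"
        unfolding abs_mult using xq v[OF G] L_pos q_pos by (intro mult_mono) auto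
      moreover have "\<bar>((\<nu> G - nu0 p a b) - ?x) * (D G - D0 p a b)\<bar> \<le> 2 * real g * (2 * real n)"
        unfolding abs_mult using u[OF G] V[OF G] by (intro mult_mono) auto
      ultimately show "\<bar>(\<nu> G - nu0 p a b) * (D G - D0 p a b) - ?x * ?y\<bar> \<le> 2 * L * q * (2 * real g + 1) + 2 * real g * (2 * real n)"
        by linarith
    qed
    moreover have "\<bar>\<Sum>G\<in>?O. (\<Sum>l\<in>Q. x l G) * (\<Sum>l\<in>K. y l G)\<bar> \<le> (2 * L * q * real n * (8 * \<kappa>) + 2 * L * q) * ?N"
    proof -
      have "\<bar>\<Sum>G\<in>?O. (\<Sum>l\<in>Q. x l G) * (\<Sum>l\<in>K. y l G)\<bar> \<le> (real (card Q) * real (card K) * (8 * \<kappa>) + real (card Q)) * ?N"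
        by (rule abs_double_sum_le[OF fin(2,1) NO]) (use x1 y1 QK Kn mxy \<kappa>0 in auto)
      also have "\<dots> \<le> (2 * L * q * real n * (8 * \<kappa>) + 2 * L * q) * ?N"
        using cardQ cardK \<kappa>0 L_pos q_pos by (intro mult_right_mono add_mono mult_mono) auto
      finally show ?thesis .
    qed
    ultimately show ?thesis unfolding sum_subtractf[of _ "\<lambda>G. (\<Sum>l\<in>Q. x l G) * (\<Sum>l\<in>K. y l G)"] sumc by (simp add: algebra_simps)
  qed
  have e4: "(\<Sum>G\<in>?O. (D G - D0 p a b)\<^sup>2) \<le> (2 * (real n * real n * (8 * \<kappa>) + n) + 2 * (2 * real g + 1)\<^sup>2) * ?N"
  proof -
    have "(\<Sum>G\<in>?O. (D G - D0 p a b)\<^sup>2) \<le> (\<Sum>G\<in>?O. 2 * ((\<Sum>l\<in>K. y l G) * (\<Sum>l\<in>K. y l G)) + 2 * (2 * real g + 1)\<^sup>2)"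
    proof (rule sum_mono)
      fix G assume G: "G \<in> ?O"
      let ?y = "\<Sum>l\<in>K. y l G" and ?r = "(D G - D0 p a b) - (\<Sum>l\<in>K. y l G)"
      have "?r\<^sup>2 \<le> (2 * real g + 1)\<^sup>2" using v[OF G] by (metis abs_ge_zero power2_abs power_mono)
      \<comment> \<open>Parallelogram identity for D - D0 = y + r, so that the square is at most 2
        y^2 + 2 r^2 with r bounded pointwise.\<close>
      moreover have "(D G - D0 p a b)\<^sup>2 + (?y - ?r)\<^sup>2 = 2 * (?y * ?y) + 2 * ?r\<^sup>2" by (simp add: algebra_simps power2_eq_square)
      moreover have "(?y - ?r)\<^sup>2 \<ge> 0" by simp
      ultimately show "(D G - D0 p a b)\<^sup>2 \<le> 2 * (?y * ?y) + 2 * (2 * real g + 1)\<^sup>2" by linarith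
    qed
    also have "\<dots> = 2 * (\<Sum>G\<in>?O. (\<Sum>l\<in>K. y l G) * (\<Sum>l\<in>K. y l G)) + 2 * (2 * real g + 1)\<^sup>2 * ?N"
      unfolding sum.distrib sum_distrib_left[symmetric] sumc by (simp only: mult.assoc)
    also have "(\<Sum>G\<in>?O. (\<Sum>l\<in>K. y l G) * (\<Sum>l\<in>K. y l G)) \<le> (real n * real n * (8 * \<kappa>) + n) * ?N"
    proof -
      have "\<bar>\<Sum>G\<in>?O. (\<Sum>l\<in>K. y l G) * (\<Sum>l\<in>K. y l G)\<bar> \<le> (real (card K) * real (card K) * (8 * \<kappa>) + real (card K)) * ?N"
        by (rule abs_double_sum_le[OF fin(1,1) NO]) (use y1 Kn myy \<kappa>0 in auto)
      also have "\<dots> \<le> (real n * real n * (8 * \<kappa>) + n) * ?N"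
        using cardK \<kappa>0 by (intro mult_right_mono add_mono mult_mono) auto
      finally show ?thesis by linarith
    qed
    finally show ?thesis by (simp add: algebra_simps)
  qed
  have M: "\<bar>\<nu> G\<bar> \<le> 5 * L * q" if "G \<in> ?O" for G
    unfolding \<nu>_def using wset_diff_le[OF near _ that subset_insertI ab(1,2)] c by simp
  have tail: "real (card {G \<in> ?O. D G < n / L ^ 3}) \<le> 1 / (real n)\<^sup>2 * ?N"
    unfolding D_def using switch_tail(1)[OF near _ ab k] c by simp
  have w0: "n / L ^ 3 > 0" using n_pos L_pos by simp
  have M0: "0 \<le> 5 * L * q" using L_pos q_pos by simp
  let ?e1 = "2 * L * q * (8 * \<kappa>) + 2 * real g" and ?e2 = "real n * (8 * \<kappa>) + (2 * real g + 1)"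
  let ?e3 = "2 * L * q * real n * (8 * \<kappa>) + 2 * L * q + 2 * L * q * (2 * real g + 1) + 2 * real g * (2 * real n)"
  let ?e4 = "2 * (real n * real n * (8 * \<kappa>) + n) + 2 * (2 * real g + 1)\<^sup>2"
  have "\<bar>(\<Sum>G\<in>?O. \<nu> G / D G) - nu0 p a b / D0 p a b * ?N\<bar>
     \<le> (?e1 / D0 p a b + (\<bar>nu0 p a b\<bar> * ?e2 + ?e3) / (D0 p a b)\<^sup>2 + 5 * L * q * ?e4 / ((D0 p a b)\<^sup>2 * (n / L ^ 3))
         + 5 * L * q * (2 * real n)\<^sup>2 * (1 / (real n)\<^sup>2) / (D0 p a b)\<^sup>2) * ?N"
    by (rule mean_quotient_approx[OF finite_ens NO D0p w0 D1 M V tail e1 e2 e3 e4 M0])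
  also have "\<dots> \<le> L ^ 11 * (\<kappa> / q + 1 / q ^ 3 + real g / q\<^sup>2) * ?N"
  proof (rule mult_right_mono)
    let ?D = "1 / D0 p a b"
    have Dle: "?D \<le> L ^ 3 / q\<^sup>2" using frac_le[OF _ _ w0 D0b(1), of 1 1] by (simp add: q2)
    have D0': "0 \<le> ?D" using D0p by simp
    note qn = quotient_error_numerics[OF \<kappa>0 g0 D0' Dle nu0_le[OF ap ab(1,2)]]
    show "?e1 / D0 p a b + (\<bar>nu0 p a b\<bar> * ?e2 + ?e3) / (D0 p a b)\<^sup>2 + 5 * L * q * ?e4 / ((D0 p a b)\<^sup>2 * (n / L ^ 3))
         + 5 * L * q * (2 * real n)\<^sup>2 * (1 / (real n)\<^sup>2) / (D0 p a b)\<^sup>2 \<le> L ^ 11 * (\<kappa> / q + 1 / q ^ 3 + real g / q\<^sup>2)"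
      by (rule order_trans[OF eq_refl qn]) (simp add: q2 power_divide)
  qed simp
  finally show ?thesis unfolding \<nu>_def D_def .
qed

text \<open>Here the mean quotient is multiplied by the size of the ensemble with (b,k) present and
  (a,k) absent, which near-independence puts at \<open>p (b,k) * (1 - p (a,k))\<close> times the
  whole, with error 2 \<kappa>.\<close>

lemma switch_difference_approx:
  assumes ap: "approx c \<kappa> p" and near: "near g A U" and c: "g + 5 \<le> c" "g \<le> 80"
    and ab: "a < m" "b < m" "a \<noteq> b" and k: "k < n" and e: "(a,k) \<notin> A \<union> U" "(b,k) \<notin> A \<union> U"
  shows "\<bar>NN (insert (a,k) A) U - NN (insert (b,k) A) U
       - nu0 p a b / D0 p a b * (p (b,k) * (1 - p (a,k))) * NN A U\<bar>
     \<le> L ^ 12 * (\<kappa> / q + 1 / q ^ 3 + real g / q\<^sup>2) * NN A U"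
proof -
  let ?A = "insert (b,k) A" and ?U = "insert (a,k) U"
  let ?N1 = "NN ?A ?U" and ?N = "NN A U" and ?R = "nu0 p a b / D0 p a b"
  let ?E = "\<kappa> / q + 1 / q ^ 3 + real g / q\<^sup>2"
  have \<kappa>0: "\<kappa> \<ge> 0" by (rule approxD(1)[OF ap])
  have E0: "?E \<ge> 0" using \<kappa>0 q_pos by simp
  have box: "(a,k) \<in> {..<m} \<times> {..<n}" "(b,k) \<in> {..<m} \<times> {..<n}" using ab k by auto
  have N1le: "?N1 \<le> ?N" using order_trans[OF NN_insert_le NN_insert_U_le] by auto
  have N1: "\<bar>?N1 - p (b,k) * (1 - p (a,k)) * ?N\<bar> \<le> 2 * (\<kappa> * ?N)"
  proof -
    have eq: "?N1 = NN ?A U - NN (insert (a,k) ?A) U" using NN_split[of ?A U "(a,k)"] by simp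
    have 1: "\<bar>NN ?A U - p (b,k) * ?N\<bar> \<le> \<kappa> * ?N"
      by (rule approxD(5)[OF ap near_mono[OF near] box(2) e(2)]) (use c in simp)
    have "\<bar>NN (insert (a,k) ?A) U - p (a,k) * NN ?A U\<bar> \<le> \<kappa> * NN ?A U"
      by (rule approxD(5)[OF ap near_mono[OF near_insert_A[OF near box(2)]] box(1)]) (use c e ab in auto)
    also have "\<dots> \<le> \<kappa> * ?N" using \<kappa>0 NN_insert_le by (intro mult_left_mono)
    finally have 2: "\<bar>NN (insert (a,k) ?A) U - p (a,k) * NN ?A U\<bar> \<le> \<kappa> * ?N" .
    have 3: "\<bar>(1 - p (a,k)) * (NN ?A U - p (b,k) * ?N)\<bar> \<le> 1 * (\<kappa> * ?N)"
      unfolding abs_mult using 1 approxD(2,3)[OF ap box(1)] by (intro mult_mono) auto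
    have "?N1 - p (b,k) * (1 - p (a,k)) * ?N = (1 - p (a,k)) * (NN ?A U - p (b,k) * ?N) - (NN (insert (a,k) ?A) U - p (a,k) * NN ?A U)"
      unfolding eq by (simp add: algebra_simps)
    then show ?thesis using 2 3 by linarith
  qed
  \<comment> \<open>A numerator of order q over a denominator of order n: multiplying the error of
    the ensemble size by this factor already gains the required 1/q.\<close>
  have R: "\<bar>?R\<bar> \<le> 4 * L ^ 4 / q"
  proof -
    have "\<bar>?R\<bar> = \<bar>nu0 p a b\<bar> / \<bar>D0 p a b\<bar>" by (simp add: abs_divide)
    also have "\<dots> \<le> (4 * L * q) / (n / L ^ 3)"
      using nu0_le[OF ap ab(1,2)] D0_approx(2)[OF ap ab] n_pos L_pos q_pos by (intro frac_le) auto
    also have "\<dots> = 4 * L ^ 4 * (q / n)" by (simp add: power_numeral_reduce)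
    finally show ?thesis unfolding q_over_n by simp
  qed
  have t1: "\<bar>(\<Sum>G\<in>ens ?A ?U. (real (card (wset A U a b G)) - real (card (wset A U b a G))) / real (card (wset A U b a G))) - ?R * ?N1\<bar>
     \<le> L ^ 11 * ?E * ?N"
    by (rule order_trans[OF switch_mean_approx[OF assms] mult_left_mono[OF N1le]]) (use E0 L_pos in simp)
  have t2: "\<bar>?R * (?N1 - p (b,k) * (1 - p (a,k)) * ?N)\<bar> \<le> 4 * L ^ 4 / q * (2 * (\<kappa> * ?N))"
    unfolding abs_mult using R N1 L_pos q_pos by (intro mult_mono) auto
  have t3: "real (card {G \<in> ens (insert (a,k) A) (insert (b,k) U). wset A U b a G = {}}) \<le> ?N / (real n)\<^sup>2"
    using switch_tail(2)[OF near _ ab k] c by simp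
  have alg: "S + T - r * (y * (1 - z)) * M = (S - r * M') + r * (M' - y * (1 - z) * M) + T" for S T r y z M M' :: real
    by (simp add: algebra_simps)
  have "NN (insert (a,k) A) U - NN (insert (b,k) A) U - ?R * (p (b,k) * (1 - p (a,k))) * ?N
    = ((\<Sum>G\<in>ens ?A ?U. (real (card (wset A U a b G)) - real (card (wset A U b a G))) / real (card (wset A U b a G))) - ?R * ?N1)
     + ?R * (?N1 - p (b,k) * (1 - p (a,k)) * ?N)
     + real (card {G \<in> ens (insert (a,k) A) (insert (b,k) U). wset A U b a G = {}})"
    unfolding NN_switch_difference[OF ab(3) e] by (rule alg)
  then have "\<bar>NN (insert (a,k) A) U - NN (insert (b,k) A) U - ?R * (p (b,k) * (1 - p (a,k))) * ?N\<bar>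
    \<le> L ^ 11 * ?E * ?N + 4 * L ^ 4 / q * (2 * (\<kappa> * ?N)) + ?N / (real n)\<^sup>2"
    using t1 t2 t3 by linarith
  also have "\<dots> = (L ^ 11 * ?E + 8 * L ^ 4 * (\<kappa> / q) + 1 / q ^ 4) * ?N"
    by (simp add: algebra_simps q2[symmetric])
  also have "\<dots> \<le> L ^ 12 * ?E * ?N"
  proof (rule mult_right_mono)
    have k1: "0 \<le> \<kappa> / q" using \<kappa>0 q_pos by simp
    have "8 * L ^ 4 * (\<kappa> / q) \<le> L ^ 11 * (\<kappa> / q)" using L_absorb[of 4 11 8] k1 by (intro mult_right_mono) auto
    also have "\<dots> \<le> L ^ 11 * ?E" using L_pos q_pos by (intro mult_left_mono) auto
    finally have 1: "8 * L ^ 4 * (\<kappa> / q) \<le> L ^ 11 * ?E" .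
    have "1 / q ^ 4 \<le> 1 / q ^ 3" using q_ge by (intro divide_left_mono power_increasing) auto
    also have "\<dots> \<le> ?E" using k1 by simp
    also have "\<dots> \<le> L ^ 11 * ?E" using L_mono[of 0 11] E0 mult_right_mono[of 1 "L ^ 11" ?E] by simp
    finally have 2: "1 / q ^ 4 \<le> L ^ 11 * ?E" .
    have "3 * L ^ 11 * ?E \<le> L ^ 12 * ?E" using L_absorb[of 11 12 3] E0 by (intro mult_right_mono) auto
    then have 3: "3 * (L ^ 11 * ?E) \<le> L ^ 12 * ?E" by (simp only: mult.assoc)
    have "x + y + z \<le> w" if "y \<le> x" "z \<le> x" "3 * x \<le> w" for x y z w :: real using that by linarith
    from this[OF 1 2 3] show "L ^ 11 * ?E + 8 * L ^ 4 * (\<kappa> / q) + 1 / q ^ 4 \<le> L ^ 12 * ?E" .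
  qed simp
  finally show ?thesis .
qed

end


lemma approx_shift:
  fixes x r w N :: real
  assumes "\<bar>x - r * N\<bar> \<le> A" "A \<le> B" "\<bar>(r - w) * N\<bar> \<le> C" "B + C \<le> D"
  shows "\<bar>x - w * N\<bar> \<le> D"
proof -
  have "x - w * N = (x - r * N) + (r - w) * N" by (simp add: algebra_simps)
  then show ?thesis using assms by linarith
qed

section \<open>First-order formula for the edge probabilities\<close>

context forb_bip begin

abbreviation oF :: "nat \<Rightarrow> nat \<Rightarrow> real" where "oF a k \<equiv> of_bool ((a,k) \<in> F)"

definition xr :: "nat \<Rightarrow> real" where "xr a = real (card {k. (a,k) \<in> F})"
definition yc :: "nat \<Rightarrow> real" where "yc k = real (card {a. (a,k) \<in> F})"
definition del :: "nat \<Rightarrow> real" where "del a = real (s a) - lam * real n + lam * xr a"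
definition et :: "nat \<Rightarrow> real" where "et k = real (t k) - lam * real m + lam * yc k"
text \<open>\<open>SR a\<close> and \<open>SC k\<close> are the partial derivatives of the sum
  defining \<open>YY\<close>, taken for \<open>F\<close>, with respect to \<open>del a\<close> and
  \<open>et k\<close>.\<close>

definition SR :: "nat \<Rightarrow> real" where "SR a = (\<Sum>k<n. oF a k * et k)"
definition SC :: "nat \<Rightarrow> real" where "SC k = (\<Sum>a<m. oF a k * del a)"

lemma xr_sum: "xr a = (\<Sum>k<n. oF a k)"
  unfolding xr_def by (subst card_as_sum) (use F_box in auto)

lemma yc_sum: "yc k = (\<Sum>a<m. oF a k)"
proof -
  have "{a. (a,k) \<in> F} \<subseteq> {..<m}" using F_box by auto
  then show ?thesis by (simp add: yc_def sum.If_cases of_bool_def Int_absorb1)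
qed

lemma xr_bounds: "0 \<le> xr a" "a < m \<Longrightarrow> xr a \<le> L * q"
  using F_row by (auto simp: xr_def)
lemma yc_bounds: "0 \<le> yc k" "k < n \<Longrightarrow> yc k \<le> L * q"
  using F_col by (auto simp: yc_def)

lemma lam_mult_le: "0 \<le> x \<Longrightarrow> lam * x \<le> x" "0 \<le> x \<Longrightarrow> 0 \<le> lam * x"
  using lam_pos lam1 by (auto simp: mult_left_le_one_le)

lemma del_bound: "a < m \<Longrightarrow> \<bar>del a\<bar> \<le> 2 * L * q"
  using s_dev[of a] xr_bounds[of a] lam_mult_le[of "xr a"] unfolding del_def by linarith
lemma et_bound: "k < n \<Longrightarrow> \<bar>et k\<bar> \<le> 2 * L * q"
  using t_dev[of k] yc_bounds[of k] lam_mult_le[of "yc k"] unfolding et_def by linarith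

lemma sum_xr: "(\<Sum>a<m. xr a) = real (card F)" and sum_yc: "(\<Sum>k<n. yc k) = real (card F)"
proof -
  have "(\<Sum>a<m. xr a) = (\<Sum>e\<in>{..<m} \<times> {..<n}. of_bool (e \<in> F))"
    unfolding xr_sum sum.cartesian_product by (rule sum.cong) auto
  also have "\<dots> = real (card F)" using F_box by (simp add: sum.If_cases of_bool_def Int_absorb1)
  finally show 1: "(\<Sum>a<m. xr a) = real (card F)" .
  have "(\<Sum>k<n. yc k) = (\<Sum>a<m. xr a)" unfolding yc_sum xr_sum by (rule sum.swap)
  then show "(\<Sum>k<n. yc k) = real (card F)" using 1 by simp
qed

lemma sum_del: "(\<Sum>a<m. del a) = lam * real (card F)"
proof -
  have "(\<Sum>a<m. del a) = (\<Sum>a<m. real (s a)) - lam * real n * m + lam * (\<Sum>a<m. xr a)"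
    unfolding del_def by (simp add: sum.distrib sum_subtractf sum_distrib_left)
  then show ?thesis using sum_s sum_xr by simp
qed

lemma sum_et: "(\<Sum>k<n. et k) = lam * real (card F)"
proof -
  have "(\<Sum>k<n. et k) = (\<Sum>k<n. real (t k)) - lam * real m * n + lam * (\<Sum>k<n. yc k)"
    unfolding et_def by (simp add: sum.distrib sum_subtractf sum_distrib_left)
  then show ?thesis using sum_t sum_yc by simp
qed

lemma approx0: "approx 90 (L ^ 6 / q) (\<lambda>e. lam)"
proof -
  have "0 \<le> L ^ 6 / q" "0 \<le> L ^ 3 / q" using L_pos q_pos by auto
  then show ?thesis unfolding approx_def using lam_pos lam1 edge_prob_level0[of 90] by fastforce
qed

lemma qq: "q * q = real n" using q2 by (simp add: power2_eq_square)

lemma sphi_prod: "sphi a b k * prod p (Ephi a b k) = oF a k * (1 - oF b k) * p (b,k) - oF b k * (1 - oF a k) * p (a,k)"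
  by (simp add: sphi_def Ephi_def)

lemma spsi_prod: "a \<noteq> b \<Longrightarrow> spsi a b k * prod p (Epsi a b k) =
   - (p (a,k) * p (b,k) + (1 - oF b k) * oF a k * p (b,k) - (oF a k + oF b k - oF a k * oF b k) * (p (a,k) * p (b,k)))"
  by (simp add: spsi_def Epsi_def)

text \<open>This is where the quantities delta arise: with all edges of probability
  \<open>lam\<close>, the edges of \<open>F\<close> shift the imbalance \<open>s a - s b\<close> of
  the switching counts by lam times the difference of the \<open>F\<close>-degrees.\<close>

lemma nu0_const: "nu0 (\<lambda>e. lam) a b = del a - del b"
proof -
  have "(\<Sum>k<n. sphi a b k * prod (\<lambda>e. lam) (Ephi a b k)) = (\<Sum>k<n. lam * oF a k - lam * oF b k)"
    unfolding sphi_prod by (rule sum.cong) (auto simp: algebra_simps)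
  also have "\<dots> = lam * xr a - lam * xr b" unfolding xr_sum by (simp add: sum_subtractf sum_distrib_left)
  finally show ?thesis unfolding nu0_def del_def by simp
qed

text \<open>The row dependence comes from the quotient (del a - del b) / (gam n) times gam; the term
  in \<open>et k\<close> is then the one that gives the column its prescribed sum.\<close>

definition p1 :: "nat \<times> nat \<Rightarrow> real" where "p1 e = lam + del (fst e) / real n + et (snd e) / real m"

lemma div_n_le: "\<bar>x\<bar> \<le> c * q \<Longrightarrow> \<bar>x / real n\<bar> \<le> c / q"
proof -
  assume "\<bar>x\<bar> \<le> c * q"
  then have "\<bar>x / real n\<bar> \<le> c * q / n" using n_pos by (simp add: abs_divide divide_right_mono)
  then show ?thesis using q_over_n by (metis times_divide_eq_right mult.right_neutral)
qed

lemma div_m_le: "\<bar>x\<bar> \<le> c * q \<Longrightarrow> \<bar>x / real m\<bar> \<le> L * c / q"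
proof -
  assume a: "\<bar>x\<bar> \<le> c * q"
  then have c: "c * q \<ge> 0" by linarith
  have "\<bar>x / real m\<bar> \<le> c * q / m" using a m_pos by (simp add: abs_divide divide_right_mono)
  also have "\<dots> \<le> L * (c * q) / n" by (rule per_m[OF c])
  also have "\<dots> = L * c * (q / n)" by simp
  finally show ?thesis unfolding q_over_n by simp
qed

lemma p1_dev: "a < m \<Longrightarrow> k < n \<Longrightarrow> \<bar>p1 (a,k) - lam\<bar> \<le> L ^ 3 / q"
proof -
  assume "a < m" "k < n"
  then have "\<bar>del a / n\<bar> \<le> 2 * L / q" "\<bar>et k / m\<bar> \<le> L * (2 * L) / q"
    using div_n_le[OF del_bound] div_m_le[OF et_bound] by auto
  then have "\<bar>p1 (a,k) - lam\<bar> \<le> 2 * L / q + L * (2 * L) / q" 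
    unfolding p1_def fst_conv snd_conv by linarith
  also have "\<dots> = (2 * L ^ 1 + 2 * L ^ 2) / q" by (simp add: add_divide_distrib power2_eq_square)
  also have "\<dots> \<le> L ^ 3 / q" using L_absorb[of 1 2 2] L_absorb[of 2 3 3] q_pos by (intro divide_right_mono) auto
  finally show ?thesis .
qed

lemma small_dev: "L ^ 3 / q \<le> 1 / L"
proof -
  have "L ^ 4 \<le> q" by (rule L_le_q) simp
  then have "L ^ 3 * L \<le> q" by (simp add: power_numeral_reduce mult.commute mult.assoc)
  then show ?thesis using L_pos q_pos by (simp add: field_simps)
qed

lemma p1_range: "a < m \<Longrightarrow> k < n \<Longrightarrow> 0 \<le> p1 (a,k)" "a < m \<Longrightarrow> k < n \<Longrightarrow> p1 (a,k) \<le> 1"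
  using p1_dev[of a k] small_dev lam_ge lam_le by linarith+

text \<open>The first round turns the error L^6 / q into order 1/n; the 80 extra conditions
  contribute at the same order, so they may stay.\<close>

lemma level1_difference:
  assumes near: "near 80 A U" and ab: "a < m" "b < m" "a \<noteq> b" and k: "k < n" and e: "(a,k) \<notin> A \<union> U" "(b,k) \<notin> A \<union> U"
  shows "\<bar>NN (insert (a,k) A) U - NN (insert (b,k) A) U - (p1 (a,k) - p1 (b,k)) * NN A U\<bar> \<le> 2 * L ^ 19 / real n * NN A U"
proof -
  let ?p = "\<lambda>e::nat\<times>nat. lam" and ?N = "NN A U"
  have 1: "\<bar>NN (insert (a,k) A) U - NN (insert (b,k) A) U - nu0 ?p a b / D0 ?p a b * gam * ?N\<bar>
      \<le> L ^ 12 * (L ^ 6 / q / q + 1 / q ^ 3 + real 80 / q\<^sup>2) * ?N"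
    by (rule switch_difference_approx[OF approx0 near _ _ ab k e]) auto
  have "1 / q ^ 3 \<le> 1 / q\<^sup>2" using q_ge by (intro divide_left_mono power_increasing) auto
  then have "L ^ 12 * (L ^ 6 / q / q + 1 / q ^ 3 + real 80 / q\<^sup>2) \<le> L ^ 12 * (L ^ 6 / q\<^sup>2 + 1 / q\<^sup>2 + 80 / q\<^sup>2)"
    using L_pos by (intro mult_left_mono) (auto simp: power2_eq_square)
  also have "\<dots> = (L ^ 18 + 81 * L ^ 12) / n" unfolding q2 by (simp add: add_divide_distrib algebra_simps flip: power_add)
  also have "\<dots> \<le> L ^ 19 / n" using L_absorb[of 18 19 2] L_absorb[of 12 18 81] by (intro divide_right_mono) auto
  finally have 2: "L ^ 12 * (L ^ 6 / q / q + 1 / q ^ 3 + real 80 / q\<^sup>2) * ?N \<le> L ^ 19 / n * ?N" by (intro mult_right_mono) auto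
  have D: "\<bar>D0 ?p a b - gam * n\<bar> \<le> L ^ 4 * q" "n / L ^ 3 \<le> D0 ?p a b" using D0_approx[OF approx0 ab] by auto
  have Dp: "D0 ?p a b > 0" using D(2) n_pos L_pos by (meson divide_pos_pos less_le_trans zero_less_power)
  \<comment> \<open>Replacing \<open>D0\<close> by \<open>gam * n\<close> costs a factor of relative
    size 1/q on a term of size 1/q, again order 1/n up to powers of \<open>L\<close>.\<close>
  have "nu0 ?p a b / D0 ?p a b * gam - (p1 (a,k) - p1 (b,k)) = (del a - del b) * (gam * n - D0 ?p a b) / (D0 ?p a b * n)"
    unfolding nu0_const p1_def using Dp n_pos by (simp add: field_simps)
  also have "\<bar>\<dots>\<bar> = \<bar>del a - del b\<bar> * \<bar>D0 ?p a b - gam * n\<bar> / (D0 ?p a b * n)"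
    using Dp n_pos by (simp add: abs_mult abs_minus_commute)
  also have "\<dots> \<le> (4 * L * q) * (L ^ 4 * q) / (n / L ^ 3 * n)"
    using D n_pos L_pos q_pos del_bound[OF ab(1)] del_bound[OF ab(2)]
    by (intro frac_le mult_mono mult_right_mono) auto
  also have "\<dots> = 4 * L ^ 8 / n"
  proof -
    have "(4 * L * q) * (L ^ 4 * q) = 4 * L ^ 5 * n" using qq by (simp add: algebra_simps power_numeral_reduce)
    then show ?thesis using n_pos L_pos by (simp add: field_simps power_numeral_reduce)
  qed
  also have "\<dots> \<le> L ^ 19 / n" using L_absorb[of 8 19 4] by (intro divide_right_mono) auto
  finally have 3: "\<bar>(nu0 ?p a b / D0 ?p a b * gam - (p1 (a,k) - p1 (b,k))) * ?N\<bar> \<le> L ^ 19 / n * ?N"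
    unfolding abs_mult by (intro mult_mono) auto
  show ?thesis by (rule approx_shift[OF 1 2 3]) (simp add: algebra_simps)
qed

lemma sum_allowed:
  fixes f :: "nat \<Rightarrow> real"
  assumes near: "near 80 A U" and k: "k < n" and f: "\<And>b. b < m \<Longrightarrow> \<bar>f b\<bar> \<le> M"
  shows "\<bar>(\<Sum>b | b < m \<and> (b,k) \<notin> A \<union> U. f b) - (\<Sum>b<m. f b)\<bar> \<le> (L * q + 80) * M"
proof -
  let ?J = "{b. b < m \<and> (b,k) \<notin> A \<union> U}" and ?C = "{b. b < m \<and> (b,k) \<in> A \<union> U}"
  have M0: "M \<ge> 0" using f[of 0] m_pos by simp
  have sp: "{..<m} = ?J \<union> ?C" by auto
  have "(\<Sum>b<m. f b) = (\<Sum>b\<in>?J. f b) + (\<Sum>b\<in>?C. f b)"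
    unfolding sp by (rule sum.union_disjoint) auto
  moreover have "\<bar>\<Sum>b\<in>?C. f b\<bar> \<le> (\<Sum>b\<in>?C. M)"
    by (rule order_trans[OF sum_abs sum_mono]) (use f in auto)
  moreover have "(\<Sum>b\<in>?C. M) \<le> (L * q + 80) * M"
  proof -
    have "card {..<m} = card ?J + card ?C" unfolding sp by (rule card_Un_disjoint) auto
    then have "real (card ?C) \<le> L * q + 80" using near_col(2)[OF near _ k] by simp
    then show ?thesis using M0 by (simp add: mult_right_mono)
  qed
  ultimately show ?thesis by linarith
qed

text \<open>What remains after the row differences is the column sum of \<open>p1\<close>, which is
  now correct up to L^4 instead of order q; divided by m this has order 1/n.\<close>

lemma approx1: "approx 80 (L ^ 20 / real n) p1"
  unfolding approx_def
proof (intro conjI allI impI ballI)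
  show "0 \<le> L ^ 20 / real n" using L_pos by simp
  fix e assume "e \<in> {..<m} \<times> {..<n}"
  then show "0 \<le> p1 e" "p1 e \<le> 1" "\<bar>p1 e - lam\<bar> \<le> L ^ 3 / q" using p1_range p1_dev by auto
next
  fix A U e assume near: "near 80 A U" and ebox: "e \<in> {..<m} \<times> {..<n}" and eU: "e \<notin> A \<union> U"
  obtain a k where e: "e = (a,k)" "a < m" "k < n" using ebox by auto
  let ?J = "{b. b < m \<and> (b,k) \<notin> A \<union> U}"
  have 80: "L * q + 80 \<le> 2 * L * q" using Lq_ge by simp
  have b1: "(L * q + 80) * (2 * L / q) \<le> 4 * L\<^sup>2"
  proof -
    have "(L * q + 80) * (2 * L / q) \<le> (2 * L * q) * (2 * L / q)" using 80 L_pos q_pos by (intro mult_right_mono) auto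
    also have "\<dots> = 4 * L\<^sup>2" using q_pos by (simp add: power2_eq_square)
    finally show ?thesis .
  qed
  have b2: "(L * q + 80) * (L * (2 * L) / q) \<le> 4 * L ^ 3"
  proof -
    have "(L * q + 80) * (L * (2 * L) / q) \<le> (2 * L * q) * (L * (2 * L) / q)" using 80 L_pos q_pos by (intro mult_right_mono) auto
    also have "\<dots> = 4 * L ^ 3" using q_pos by (simp add: power3_eq_cube)
    finally show ?thesis .
  qed
  have s1: "\<bar>(\<Sum>b\<in>?J. del b / n) - (\<Sum>b<m. del b / n)\<bar> \<le> 4 * L\<^sup>2"
    by (rule order_trans[OF sum_allowed[OF near e(3)] b1]) (rule div_n_le[OF del_bound])
  have s2: "\<bar>(\<Sum>b\<in>?J. et k / m) - (\<Sum>b<m. et k / m)\<bar> \<le> 4 * L ^ 3"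
    by (rule order_trans[OF sum_allowed[OF near e(3)] b2]) (rule div_m_le[OF et_bound[OF e(3)]])
  \<comment> \<open>The rows forbidden by \<open>F\<close> remove \<open>lam * yc k\<close> from the
    column sum; the summand \<open>lam * yc k\<close> in \<open>et k\<close> restores precisely this
    amount.\<close>
  have s3: "\<bar>(\<Sum>b\<in>?J. lam) - (m - yc k) * lam\<bar> \<le> 80"
  proof -
    have fU: "finite (U - F)" "finite A" using near_finite[OF near] by auto
    let ?C = "{b. b < m \<and> (b,k) \<in> F}" and ?B = "{b. b < m \<and> (b,k) \<notin> F \<and> (b,k) \<in> A \<union> (U - F)}"
    have FU: "F \<subseteq> U" using near by (simp add: near_def)
    have sp: "{..<m} = ?J \<union> (?C \<union> ?B)" using FU by auto
    have "card {..<m} = card ?J + card (?C \<union> ?B)" unfolding sp by (rule card_Un_disjoint) (use FU in auto)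
    also have "card (?C \<union> ?B) = card ?C + card ?B" by (rule card_Un_disjoint) auto
    finally have c1: "real m = real (card ?J) + real (card ?C) + real (card ?B)" by simp
    have "?C = {b. (b,k) \<in> F}" using F_box by auto
    then have c2: "real (card ?C) = yc k" by (simp add: yc_def)
    have "card ?B \<le> card ({b. (b,k) \<in> A} \<union> {b. (b,k) \<in> U - F})"
    proof (rule card_mono)
      have "{b. (b,k) \<in> A} \<subseteq> {..<m}" "{b. (b,k) \<in> U - F} \<subseteq> {..<m}" using near by (auto simp: near_def)
      then show "finite ({b. (b,k) \<in> A} \<union> {b. (b,k) \<in> U - F})" using finite_subset[OF _ finite_lessThan[of m]] by auto
    qed auto
    also have "\<dots> \<le> card {b. (b,k) \<in> A} + card {b. (b,k) \<in> U - F}" by (rule card_Un_le)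
    also have "\<dots> \<le> 80" using card_le_col[OF fU(1), of k] card_le_col[OF fU(2), of k] near by (simp add: near_def)
    finally have c3: "real (card ?B) \<le> 80" by simp
    have "(\<Sum>b\<in>?J. lam) - (m - yc k) * lam = - (real (card ?B) * lam)" using c1 c2 by (simp add: algebra_simps)
    moreover have "real (card ?B) * lam \<le> 80 * 1" by (rule mult_mono[OF c3]) (use lam_pos lam1 in auto)
    moreover have "0 \<le> real (card ?B) * lam" using lam_pos by simp
    ultimately show ?thesis by simp
  qed
  have s4: "(\<Sum>b<m. et k / m) = et k" using m_pos by simp
  \<comment> \<open>The deviations of the row degrees sum to zero, so only the \<open>F\<close>-part
    lam |F| = O(L n) of the sum of \<open>del\<close> survives, rather than m terms of size
    q.\<close>
  have s5: "\<bar>\<Sum>b<m. del b / n\<bar> \<le> L"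
  proof -
    have eq: "(\<Sum>b<m. del b / n) = lam * card F / n" by (simp add: sum_del flip: sum_divide_distrib)
    have "lam * card F \<le> L * n" "0 \<le> lam * card F" using lam_mult_le[of "real (card F)"] F_card by auto
    then have "lam * card F / n \<le> L" "0 \<le> lam * card F / n" using n_pos by (simp_all add: divide_le_eq)
    then show ?thesis unfolding eq by simp
  qed
  have colsum: "\<bar>(\<Sum>b\<in>?J. p1 (b,k)) - t k\<bar> \<le> L ^ 4"
  proof -
    have "(\<Sum>b\<in>?J. p1 (b,k)) = (\<Sum>b\<in>?J. lam) + (\<Sum>b\<in>?J. del b / n) + (\<Sum>b\<in>?J. et k / m)"
      unfolding p1_def by (simp only: fst_conv snd_conv sum.distrib)
    moreover have "(m - yc k) * lam + et k = t k" unfolding et_def by (simp add: algebra_simps)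
    ultimately have "\<bar>(\<Sum>b\<in>?J. p1 (b,k)) - t k\<bar> \<le> 80 + 4 * L\<^sup>2 + 4 * L ^ 3 + L"
      using s1 s2 s3 s4 s5 by linarith
    moreover have "4 * L\<^sup>2 \<le> L ^ 3" "L ^ 1 \<le> L ^ 3" "80 * L ^ 0 \<le> L ^ 3" "7 * L ^ 3 \<le> L ^ 4"
      using L_absorb[of 2 3 4] L_mono[of 1 3] L_absorb[of 0 3 80] L_absorb[of 3 4 7] by auto
    ultimately show ?thesis by simp
  qed
  have "\<bar>NN (insert (a,k) A) U - p1 (a,k) * NN A U\<bar> \<le> (2 * L ^ 19 / n + 2 * (L ^ 4 + real (card A)) / m) * NN A U"
  proof (rule column_closing[OF near _ e(3) e(2), where r = "\<lambda>b. p1 (b,k)"])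
    show "0 \<le> 2 * L ^ 19 / real n" using L_pos by simp
    show "\<bar>NN (insert (a,k) A) U - NN (insert (b,k) A) U - (p1 (a,k) - p1 (b,k)) * NN A U\<bar> \<le> 2 * L ^ 19 / n * NN A U"
      if "b < m" "b \<noteq> a" "(b,k) \<notin> A \<union> U" for b
      by (rule level1_difference[OF near e(2) that(1) _ e(3) _ that(3)]) (use that eU e in auto)
  qed (use colsum eU e in auto)
  also have "\<dots> \<le> L ^ 20 / n * NN A U"
  proof (rule mult_right_mono)
    have "real (card A) \<le> 80" using near by (auto simp: near_def)
    then have "L ^ 4 + real (card A) \<le> 2 * L ^ 4" using L_absorb[of 0 4 80] by simp
    then have "2 * (L ^ 4 + real (card A)) / m \<le> 4 * L ^ 4 / m" by (intro divide_right_mono) auto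
    also have "\<dots> \<le> L * (4 * L ^ 4) / n" by (rule per_m) (use L_pos in simp)
    also have "\<dots> = 4 * L ^ 5 / n" by (simp add: power_numeral_reduce)
    finally have "2 * L ^ 19 / n + 2 * (L ^ 4 + real (card A)) / m \<le> (2 * L ^ 19 + 4 * L ^ 5) / n"
      by (simp add: add_divide_distrib)
    also have "\<dots> \<le> L ^ 20 / n" using L_absorb[of 5 19 4] L_absorb[of 19 20 3] by (intro divide_right_mono) auto
    finally show "2 * L ^ 19 / n + 2 * (L ^ 4 + real (card A)) / m \<le> L ^ 20 / n" .
  qed simp
  finally show "\<bar>NN (insert e A) U - p1 e * NN A U\<bar> \<le> L ^ 20 / n * NN A U" using e by simp
qed

end


section \<open>Second-order formula for the edge probabilities\<close>

lemma abs_sum5: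
  fixes a b c d e :: real
  assumes "\<bar>a\<bar> \<le> A" "\<bar>b\<bar> \<le> B" "\<bar>c\<bar> \<le> C" "\<bar>d\<bar> \<le> D" "\<bar>e\<bar> \<le> E"
  shows "\<bar>a + b + c + d + e\<bar> \<le> A + B + C + D + E"
  using assms by linarith

text \<open>All second-order contributions to the cross-multiplied difference between the expected
  quotient and the increment of the proposed formula. Their exact cancellation is what fixes the
  row-dependent correction terms of that formula.\<close>

lemma level2_identity:
  fixes g N M :: real
  assumes "g \<noteq> 0" "N \<noteq> 0" "M \<noteq> 0"
  shows "g * N * ((db * (xa - z) - da * (xb - z)) / N + (Sa - Sb) / M
      - N * ((Sa - Sb) / (M * N) + (da * xa - db * xb) / N\<^sup>2 + c * (da - db) * e / (g * M * N)))
    + (da - db) * ((1 - l) * db - l * da + c * (N * (e / M)) - ((1 - l) * db - l * da - g * (xa + xb - z))) = 0"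
  using assms by (simp add: field_simps power2_eq_square)

lemma level2_scaled:
  fixes g N M :: real
  assumes "g \<noteq> 0" "N \<noteq> 0" "M \<noteq> 0"
  shows "N * ((Sa - Sb) / (M * N) + (da * xa - db * xb) / N\<^sup>2 + c * (da - db) * e / (g * M * N))
    = (Sa - Sb) / M + da * xa / N - db * xb / N + c * ((da - db) * (e / M)) * (1 / g)"
  using assms by (simp add: field_simps power2_eq_square)

context forb_bip begin

text \<open>The overlap of rows a and b in \<open>F\<close> enters numerator and denominator alike
  and must cancel in the quotient, since the final formula involves rows one at a time.\<close>

definition zz :: "nat \<Rightarrow> nat \<Rightarrow> real" where "zz a b = (\<Sum>k<n. oF a k * oF b k)"

lemma zz_bounds: "0 \<le> zz a b" "a < m \<Longrightarrow> zz a b \<le> L * q"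
proof -
  show "0 \<le> zz a b" unfolding zz_def by (rule sum_nonneg) simp
  have "zz a b \<le> xr a" unfolding zz_def xr_sum by (rule sum_mono) simp
  then show "a < m \<Longrightarrow> zz a b \<le> L * q" using xr_bounds(2)[of a] by linarith
qed

lemma nu0_p1:
  "nu0 p1 a b = (del a - del b) + ((del b * (xr a - zz a b) - del a * (xr b - zz a b)) / real n + (SR a - SR b) / real m)"
proof -
  have "(\<Sum>k<n. sphi a b k * prod p1 (Ephi a b k))
    = (\<Sum>k<n. (lam + del b / n) * (oF a k - oF a k * oF b k) - (lam + del a / n) * (oF b k - oF a k * oF b k)
        + (oF a k * et k - oF b k * et k) / m)"
    unfolding sphi_prod p1_def by (rule sum.cong) (auto simp: algebra_simps)
  also have "\<dots> = (lam + del b / n) * (xr a - zz a b) - (lam + del a / n) * (xr b - zz a b) + (SR a - SR b) / m"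
    unfolding xr_sum zz_def SR_def sum.distrib sum_subtractf sum_divide_distrib[symmetric] sum_distrib_left[symmetric] ..
  also have "\<dots> = lam * xr a - lam * xr b + ((del b * (xr a - zz a b) - del a * (xr b - zz a b)) / n + (SR a - SR b) / m)"
    by (simp add: algebra_simps diff_divide_distrib add_divide_distrib)
  finally show ?thesis unfolding nu0_def del_def by simp
qed

lemma SR_bound: assumes "a < m" shows "\<bar>SR a\<bar> \<le> 2 * L * q * xr a" "\<bar>SR a\<bar> \<le> 2 * L\<^sup>2 * real n"
proof -
  have "\<bar>SR a\<bar> \<le> (\<Sum>k<n. oF a k * (2 * L * q))" unfolding SR_def
    by (rule order_trans[OF sum_abs sum_mono]) (use et_bound in auto)
  then show 1: "\<bar>SR a\<bar> \<le> 2 * L * q * xr a" unfolding xr_sum sum_distrib_right[symmetric] by (simp add: mult.commute)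
  have "2 * L * q * xr a \<le> 2 * L * q * (L * q)" using xr_bounds(2)[OF assms] L_pos q_pos by (intro mult_left_mono) auto
  also have "\<dots> = 2 * L\<^sup>2 * real n" using qq by (simp add: power2_eq_square algebra_simps)
  finally show "\<bar>SR a\<bar> \<le> 2 * L\<^sup>2 * real n" using 1 by linarith
qed

lemma SC_bound: assumes "k < n" shows "\<bar>SC k\<bar> \<le> 2 * L\<^sup>2 * real n"
proof -
  have "\<bar>SC k\<bar> \<le> (\<Sum>a<m. oF a k * (2 * L * q))" unfolding SC_def
    by (rule order_trans[OF sum_abs sum_mono]) (use del_bound in auto)
  then have 1: "\<bar>SC k\<bar> \<le> 2 * L * q * yc k" unfolding yc_sum sum_distrib_right[symmetric] by (simp add: mult.commute)
  have "2 * L * q * yc k \<le> 2 * L * q * (L * q)" using yc_bounds(2)[OF assms] L_pos q_pos by (intro mult_left_mono) auto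
  also have "\<dots> = 2 * L\<^sup>2 * real n" using qq by (simp add: power2_eq_square algebra_simps)
  finally show ?thesis using 1 by linarith
qed

lemma n_over_m: "real n / real m \<le> L" using n_le m_pos by (simp add: divide_le_eq)

lemma prod_dev:
  assumes "\<bar>x - lam\<bar> \<le> c" "\<bar>y - lam\<bar> \<le> c" "0 \<le> x" "x \<le> 1"
  shows "\<bar>x * y - lam\<^sup>2\<bar> \<le> 2 * c"
proof -
  have "x * y - lam\<^sup>2 = x * (y - lam) + lam * (x - lam)" by (simp add: algebra_simps power2_eq_square)
  moreover have "\<bar>x * (y - lam)\<bar> \<le> 1 * c" unfolding abs_mult using assms by (intro mult_mono) auto
  moreover have "\<bar>lam * (x - lam)\<bar> \<le> 1 * c" unfolding abs_mult using assms lam_pos lam1 by (intro mult_mono) auto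
  ultimately show ?thesis by linarith
qed

text \<open>Products of two deviations are of size 1/n up to powers of \<open>L\<close> and sum to
  O(1) over n columns. The terms linear in \<open>et\<close> also give only O(1), because the sum of
  all \<open>et k\<close> is lam |F| and not of order n q.\<close>

lemma sum_p1_p1:
  assumes ab: "a < m" "b < m"
  shows "\<bar>(\<Sum>k<n. p1 (a,k) * p1 (b,k)) - (lam\<^sup>2 * real n + lam * (del a + del b))\<bar> \<le> 11 * L ^ 4"
proof -
  let ?f = "\<lambda>k. et k / real m" and ?A = "lam + del a / real n" and ?B = "lam + del b / real n"
  have "(\<Sum>k<n. p1 (a,k) * p1 (b,k)) = (\<Sum>k<n. ?A * ?B + (?A + ?B) * ?f k + (?f k)\<^sup>2)"
    unfolding p1_def fst_conv snd_conv by (rule sum.cong) (simp_all only: algebra_simps power2_eq_square)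
  also have "\<dots> = real n * (?A * ?B) + (?A + ?B) * (\<Sum>k<n. ?f k) + (\<Sum>k<n. (?f k)\<^sup>2)"
    by (simp add: sum.distrib sum_distrib_left)
  also have "real n * (?A * ?B) = lam\<^sup>2 * real n + lam * (del a + del b) + del a * del b / n"
    using n_pos by (simp add: field_simps power2_eq_square)
  finally have eq: "(\<Sum>k<n. p1 (a,k) * p1 (b,k)) - (lam\<^sup>2 * real n + lam * (del a + del b))
     = del a * del b / n + (?A + ?B) * (\<Sum>k<n. ?f k) + (\<Sum>k<n. (?f k)\<^sup>2)" by simp
  have 1: "\<bar>del a * del b / n\<bar> \<le> 4 * L\<^sup>2"
  proof -
    have "\<bar>del a * del b\<bar> \<le> (2 * L * q) * (2 * L * q)" unfolding abs_mult
      using del_bound[OF ab(1)] del_bound[OF ab(2)] by (intro mult_mono) auto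
    also have "\<dots> = 4 * L\<^sup>2 * n" using qq by (simp add: power2_eq_square algebra_simps)
    finally show ?thesis using n_pos by (simp add: abs_divide divide_le_eq)
  qed
  have Ab: "\<bar>?A + ?B\<bar> \<le> 3"
  proof -
    have "\<bar>del a / n\<bar> \<le> 2 * L / q" "\<bar>del b / n\<bar> \<le> 2 * L / q" using div_n_le[OF del_bound] ab by auto
    moreover have "2 * L / q \<le> 1 / 2" using L_le_q[of 2] L_ge q_pos L_absorb[of 1 2 4] by (simp add: field_simps)
    ultimately show ?thesis using lam_pos lam1 by linarith
  qed
  have S: "\<bar>\<Sum>k<n. ?f k\<bar> \<le> L\<^sup>2"
  proof -
    have e: "(\<Sum>k<n. ?f k) = lam * card F / m" by (simp add: sum_et flip: sum_divide_distrib)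
    have "lam * card F \<le> L * n" "0 \<le> lam * card F" using lam_mult_le[of "real (card F)"] F_card by auto
    moreover have "L * n \<le> L * (L * m)" using n_le L_pos by (intro mult_left_mono) auto
    ultimately have "lam * card F / m \<le> L\<^sup>2" "0 \<le> lam * card F / m"
      using m_pos by (simp_all add: divide_le_eq power2_eq_square mult.assoc)
    then show ?thesis unfolding e by simp
  qed
  have 2: "\<bar>(?A + ?B) * (\<Sum>k<n. ?f k)\<bar> \<le> 3 * L\<^sup>2" unfolding abs_mult using Ab S by (intro mult_mono) auto
  have 3: "\<bar>\<Sum>k<n. (?f k)\<^sup>2\<bar> \<le> 4 * L ^ 4"
  proof -
    have "\<bar>\<Sum>k<n. (?f k)\<^sup>2\<bar> \<le> (\<Sum>k<n. 4 * L ^ 4 / n)"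
    proof (rule order_trans[OF sum_abs sum_mono])
      fix k assume "k \<in> {..<n}"
      then have "\<bar>?f k\<bar> \<le> L * (2 * L) / q" using div_m_le[OF et_bound] by auto
      then have "\<bar>?f k\<bar>\<^sup>2 \<le> (L * (2 * L) / q)\<^sup>2" by (intro power_mono) auto
      then show "\<bar>(?f k)\<^sup>2\<bar> \<le> 4 * L ^ 4 / n" by (simp add: power_divide q2 power_numeral_reduce mult.assoc mult.left_commute power2_eq_square[of "_ / _"] flip: q2)
    qed
    then show ?thesis using n_pos by simp
  qed
  have "L\<^sup>2 \<le> L ^ 4" by (rule L_mono) simp
  then show ?thesis unfolding eq using 1 2 3 by linarith
qed

text \<open>The second round needs \<open>D0\<close> up to O(1), not just O(q): an error O(1) in a
  denominator of order q^2, under a numerator of order q, changes the quotient by order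
  1/q^3.\<close>

lemma D0_p1:
  assumes ab: "a < m" "b < m" "a \<noteq> b"
  shows "\<bar>D0 p1 a b - (gam * real n + ((1 - lam) * del b - lam * del a - gam * (xr a + xr b - zz a b)))\<bar> \<le> L ^ 5"
proof -
  let ?c = "L ^ 3 / q" and ?p = "\<lambda>k. p1 (a,k) * p1 (b,k)"
  let ?u = "\<lambda>k. oF a k - oF a k * oF b k" and ?v = "\<lambda>k. oF a k + oF b k - oF a k * oF b k"
  have "(\<Sum>k<n. spsi a b k * prod p1 (Epsi a b k)) = (\<Sum>k<n. - (?p k) - ?u k * p1 (b,k) + ?v k * ?p k)"
    unfolding spsi_prod[OF ab(3)] by (rule sum.cong) (simp_all add: algebra_simps)
  also have "\<dots> = - (\<Sum>k<n. ?p k) - (\<Sum>k<n. ?u k * p1 (b,k)) + (\<Sum>k<n. ?v k * ?p k)"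
    by (simp only: sum.distrib sum_subtractf sum_negf)
  finally have eq: "D0 p1 a b = real (s b) - (\<Sum>k<n. ?p k) - (\<Sum>k<n. ?u k * p1 (b,k)) + (\<Sum>k<n. ?v k * ?p k)"
    unfolding D0_def by simp
  have c0: "?c \<ge> 0" using L_pos q_pos by simp
  have uu: "\<bar>(\<Sum>k<n. ?u k * p1 (b,k)) - lam * (xr a - zz a b)\<bar> \<le> L ^ 4"
  proof -
    have "(\<Sum>k<n. ?u k * p1 (b,k)) - lam * (xr a - zz a b) = (\<Sum>k<n. ?u k * (p1 (b,k) - lam))"
    proof -
      have "lam * (xr a - zz a b) = (\<Sum>k<n. lam * ?u k)"
        unfolding xr_sum zz_def by (simp only: sum_subtractf[symmetric] sum_distrib_left)
      then show ?thesis by (simp only: sum_subtractf[symmetric]) (rule sum.cong[OF refl], simp only: algebra_simps)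
    qed
    also have "\<bar>\<dots>\<bar> \<le> (\<Sum>k<n. oF a k * ?c)"
    proof (rule order_trans[OF sum_abs sum_mono])
      fix k assume "k \<in> {..<n}"
      then show "\<bar>?u k * (p1 (b,k) - lam)\<bar> \<le> oF a k * ?c" unfolding abs_mult
        using p1_dev[OF ab(2), of k] by (intro mult_mono) auto
    qed
    also have "\<dots> = xr a * ?c" unfolding xr_sum by (simp only: sum_distrib_right)
    also have "\<dots> \<le> (L * q) * ?c" using xr_bounds(2)[OF ab(1)] c0 by (intro mult_right_mono)
    also have "\<dots> = L ^ 4" using q_pos by (simp add: power_numeral_reduce)
    finally show ?thesis .
  qed
  have vv: "\<bar>(\<Sum>k<n. ?v k * ?p k) - lam\<^sup>2 * (xr a + xr b - zz a b)\<bar> \<le> 4 * L ^ 4"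
  proof -
    have eqv: "(\<Sum>k<n. ?v k * ?p k) - lam\<^sup>2 * (xr a + xr b - zz a b) = (\<Sum>k<n. ?v k * (?p k - lam\<^sup>2))"
    proof -
      have "lam\<^sup>2 * (xr a + xr b - zz a b) = (\<Sum>k<n. lam\<^sup>2 * ?v k)"
        unfolding xr_sum zz_def by (simp only: sum_subtractf[symmetric] sum.distrib[symmetric] sum_distrib_left)
      then show ?thesis by (simp only: sum_subtractf[symmetric]) (rule sum.cong[OF refl], simp only: algebra_simps)
    qed
    have "\<bar>\<Sum>k<n. ?v k * (?p k - lam\<^sup>2)\<bar> \<le> (\<Sum>k<n. (oF a k + oF b k) * (2 * ?c))"
    proof (rule order_trans[OF sum_abs sum_mono])
      fix k assume "k \<in> {..<n}"
      then have k: "k < n" by simp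
      show "\<bar>?v k * (?p k - lam\<^sup>2)\<bar> \<le> (oF a k + oF b k) * (2 * ?c)" unfolding abs_mult
        using prod_dev[OF p1_dev[OF ab(1) k] p1_dev[OF ab(2) k] p1_range[OF ab(1) k]] by (intro mult_mono) auto
    qed
    also have "\<dots> = (\<Sum>k<n. oF a k + oF b k) * (2 * ?c)" by (rule sum_distrib_right[symmetric])
    also have "(\<Sum>k<n. oF a k + oF b k) = xr a + xr b" unfolding xr_sum by (rule sum.distrib)
    also have "(xr a + xr b) * (2 * ?c) \<le> (2 * (L * q)) * (2 * ?c)"
    proof (rule mult_right_mono)
      show "xr a + xr b \<le> 2 * (L * q)" using xr_bounds(2)[OF ab(1)] xr_bounds(2)[OF ab(2)] by linarith
      show "0 \<le> 2 * ?c" using c0 by linarith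
    qed
    also have "\<dots> = 4 * L ^ 4" using q_pos by (simp add: power_numeral_reduce)
    finally show ?thesis unfolding eqv .
  qed
  have sb: "real (s b) = del b + lam * n - lam * xr b" unfolding del_def by simp
  have alg: "real (s b) - (lam\<^sup>2 * real n + lam * (del a + del b)) - lam * (xr a - zz a b) + lam\<^sup>2 * (xr a + xr b - zz a b)
    = gam * real n + ((1 - lam) * del b - lam * del a - gam * (xr a + xr b - zz a b))"
    unfolding sb by (simp add: algebra_simps power2_eq_square)
  have "16 * L ^ 4 \<le> L ^ 5" by (rule L_absorb) auto
  then show ?thesis unfolding eq alg[symmetric] using uu vv sum_p1_p1[OF ab(1,2)] by linarith
qed

text \<open>The formula is forced by the increments of \<open>miss_main\<close>: forbidding one more edge
changes the logarithm of the number of graphs by the logarithm of one minus its probability.\<close>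

definition Pst :: "nat \<Rightarrow> nat \<Rightarrow> real" where
  "Pst a k = lam + del a / n + et k / m + del a * xr a / (real n)\<^sup>2 + et k * yc k / (real m)\<^sup>2
     - lam * real (card F) / (real m * real n) + (SR a + SC k) / (real m * real n)
     + (1 - 2 * lam) * del a * et k / (gam * real m * real n)"

text \<open>Cross-multiplication: the hypothesis \<open>id\<close> removes the second-order part of
  the numerator, and only products of a correction with a deviation or a remainder survive.\<close>

lemma level2_algebra:
  fixes Dl db w T e1 d1 er Er Gm N D0' :: real
  assumes "N > 0" "D0' > 0" "D0' = Gm + d1 + Er" and id: "Gm * (w - N * T) + Dl * (e1 - d1) = 0"
  shows "(Dl + w) / D0' * ((Gm + e1 + er) / N) - (Dl / N + T)
    = (w * e1 - N * T * d1 + (Dl + w) * er - (Dl + N * T) * Er) / (D0' * N)"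
proof -
  have "(Dl + w) / D0' * ((Gm + e1 + er) / N) - (Dl / N + T)
     = ((Dl + w) * (Gm + e1 + er) - (Dl + N * T) * D0') / (D0' * N)"
    using assms(1,2) by (simp add: field_simps)
  also have "(Dl + w) * (Gm + e1 + er) - (Dl + N * T) * D0' = (Gm * (w - N * T) + Dl * (e1 - d1)) + (w * e1 - N * T * d1 + (Dl + w) * er - (Dl + N * T) * Er)"
    unfolding assms(3) by (simp add: algebra_simps)
  finally show ?thesis using id by simp
qed

lemma level2_main:
  assumes ab: "a < m" "b < m" "a \<noteq> b" and k: "k < n"
  shows "\<bar>nu0 p1 a b / D0 p1 a b * (p1 (b,k) * (1 - p1 (a,k))) - (Pst a k - Pst b k)\<bar> \<le> L ^ 12 / q ^ 3"
proof -
  let ?Dl = "del a - del b" and ?f = "et k / real m" and ?n = "real n"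
  \<comment> \<open>Up to powers of \<open>L\<close>, the corrections \<open>w\<close> and
    \<open>n * T\<close> and the remainders \<open>er\<close> and \<open>Er\<close> are O(1), while
    the deviations \<open>e1\<close> and \<open>d1\<close> and the main difference are O(q). Hence
    the surviving numerator is O(q), over a denominator of order q^4.\<close>
  define w where "w = (del b * (xr a - zz a b) - del a * (xr b - zz a b)) / ?n + (SR a - SR b) / real m"
  define T where "T = (SR a - SR b) / (real m * ?n) + (del a * xr a - del b * xr b) / ?n\<^sup>2 + (1 - 2 * lam) * ?Dl * et k / (gam * real m * ?n)"
  define e1 where "e1 = (1 - lam) * del b - lam * del a + (1 - 2 * lam) * (?n * ?f)"
  define d1 where "d1 = (1 - lam) * del b - lam * del a - gam * (xr a + xr b - zz a b)"
  define er where "er = - (?n * ((del b / ?n + ?f) * (del a / ?n + ?f)))"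
  define Er where "Er = D0 p1 a b - (gam * ?n + d1)"
  have D: "n / L ^ 3 \<le> D0 p1 a b" using D0_approx(2)[OF approx1 ab] .
  have Dp: "D0 p1 a b > 0" using D n_pos L_pos by (meson divide_pos_pos less_le_trans zero_less_power)
  have P: "Pst a k - Pst b k = ?Dl / ?n + T"
    unfolding Pst_def T_def by (simp add: diff_divide_distrib add_divide_distrib algebra_simps)
  have pp: "p1 (b,k) * (1 - p1 (a,k)) = (gam * ?n + e1 + er) / ?n"
    unfolding p1_def fst_conv snd_conv e1_def er_def using n_pos m_pos by (simp add: field_simps)
  have id: "gam * ?n * (w - ?n * T) + ?Dl * (e1 - d1) = 0"
    unfolding w_def T_def e1_def d1_def using n_pos m_pos gam_pos by (intro level2_identity) auto
  have nu: "nu0 p1 a b = ?Dl + w" unfolding nu0_p1 w_def ..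
  have main: "nu0 p1 a b / D0 p1 a b * (p1 (b,k) * (1 - p1 (a,k))) - (Pst a k - Pst b k)
    = (w * e1 - ?n * T * d1 + (?Dl + w) * er - (?Dl + ?n * T) * Er) / (D0 p1 a b * ?n)"
    unfolding nu P pp by (rule level2_algebra[OF n_pos Dp _ id]) (simp add: Er_def)
  have dd: "\<bar>del a\<bar> \<le> 2 * L * q" "\<bar>del b\<bar> \<le> 2 * L * q" "\<bar>et k\<bar> \<le> 2 * L * q" "\<bar>?Dl\<bar> \<le> 4 * L * q"
    using del_bound[OF ab(1)] del_bound[OF ab(2)] et_bound[OF k] by auto
  have Lq: "L * q > 0" using L_pos q_pos by simp
  have xz: "\<bar>xr a - zz a b\<bar> \<le> L * q" "\<bar>xr b - zz a b\<bar> \<le> L * q" "\<bar>xr a\<bar> \<le> L * q" "\<bar>xr b\<bar> \<le> L * q" "\<bar>xr a + xr b - zz a b\<bar> \<le> 2 * L * q"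
    using xr_bounds[of a] xr_bounds[of b] zz_bounds[of a b] ab by auto
  have pr: "\<bar>x * y / ?n\<bar> \<le> 2 * L\<^sup>2" if "\<bar>x\<bar> \<le> 2 * L * q" "\<bar>y\<bar> \<le> L * q" for x y
  proof -
    have "\<bar>x * y\<bar> \<le> (2 * L * q) * (L * q)" unfolding abs_mult using that Lq by (intro mult_mono) auto
    also have "\<dots> = 2 * L\<^sup>2 * ?n" using qq by (simp add: power2_eq_square algebra_simps)
    finally show ?thesis using n_pos by (simp add: abs_divide divide_le_eq)
  qed
  have SRm: "\<bar>(SR a - SR b) / m\<bar> \<le> 4 * L ^ 3"
  proof -
    have "\<bar>SR a - SR b\<bar> \<le> 4 * L\<^sup>2 * n" using SR_bound(2)[OF ab(1)] SR_bound(2)[OF ab(2)] by linarith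
    also have "\<dots> \<le> 4 * L\<^sup>2 * (L * m)" using n_le L_pos by (intro mult_left_mono) auto
    finally show ?thesis using m_pos by (simp add: abs_divide divide_le_eq power2_eq_square power3_eq_cube)
  qed
  have Lp: "L\<^sup>2 \<le> L ^ 3" "4 * L ^ 3 \<le> L ^ 4" "8 * L ^ 3 \<le> L ^ 4" using L_mono[of 2 3] L_absorb[of 3 4] by auto
  have wb: "\<bar>w\<bar> \<le> L ^ 4"
  proof -
    have "w = del b * (xr a - zz a b) / ?n - del a * (xr b - zz a b) / ?n + (SR a - SR b) / m"
      unfolding w_def by (simp add: diff_divide_distrib)
    then have "\<bar>w\<bar> \<le> 2 * L\<^sup>2 + 2 * L\<^sup>2 + 4 * L ^ 3" using pr[OF dd(2) xz(1)] pr[OF dd(1) xz(2)] SRm by linarith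
    then show ?thesis using Lp by linarith
  qed
  have lamx: "\<bar>lam * x\<bar> \<le> \<bar>x\<bar>" "\<bar>(1 - lam) * x\<bar> \<le> \<bar>x\<bar>" "\<bar>(1 - 2 * lam) * x\<bar> \<le> \<bar>x\<bar>" "\<bar>gam * x\<bar> \<le> \<bar>x\<bar>" for x
  proof -
    have g: "\<bar>gam\<bar> \<le> 1" "\<bar>1 - 2 * lam\<bar> \<le> 1" "\<bar>lam\<bar> \<le> 1" "\<bar>1 - lam\<bar> \<le> 1" using lam_pos lam1 gam_pos gam_le by auto
    have "\<bar>c * x\<bar> \<le> \<bar>x\<bar>" if "\<bar>c\<bar> \<le> 1" for c using mult_right_mono[OF that, of "\<bar>x\<bar>"] by (simp add: abs_mult)
    then show "\<bar>lam * x\<bar> \<le> \<bar>x\<bar>" "\<bar>(1 - lam) * x\<bar> \<le> \<bar>x\<bar>" "\<bar>(1 - 2 * lam) * x\<bar> \<le> \<bar>x\<bar>" "\<bar>gam * x\<bar> \<le> \<bar>x\<bar>" using g by auto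
  qed
  have nf: "\<bar>?n * ?f\<bar> \<le> 2 * L\<^sup>2 * q"
  proof -
    have "\<bar>?n * ?f\<bar> = (?n / m) * \<bar>et k\<bar>" by (simp add: abs_mult abs_divide)
    also have "\<dots> \<le> L * (2 * L * q)" using n_over_m dd(3) L_pos by (intro mult_mono) auto
    finally show ?thesis by (simp add: power2_eq_square)
  qed
  have tri: "\<bar>x - y + z\<bar> \<le> A + B + C" "\<bar>x - y - z\<bar> \<le> A + B + C" if "\<bar>x\<bar> \<le> A" "\<bar>y\<bar> \<le> B" "\<bar>z\<bar> \<le> C" for x y z A B C :: real
    using that by linarith+
  have e1b: "\<bar>e1\<bar> \<le> L ^ 3 * q"
  proof -
    have "\<bar>e1\<bar> \<le> 2 * L * q + 2 * L * q + 2 * L\<^sup>2 * q"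
      unfolding e1_def by (rule tri(1)[OF order_trans[OF lamx(2) dd(2)] order_trans[OF lamx(1) dd(1)] order_trans[OF lamx(3) nf]])
    also have "\<dots> = (4 * L ^ 1 + 2 * L\<^sup>2) * q" by (simp add: algebra_simps)
    also have "\<dots> \<le> L ^ 3 * q" using L_absorb[of 1 2 4] L_absorb[of 2 3 3] q_pos by (intro mult_right_mono) auto
    finally show ?thesis .
  qed
  have d1b: "\<bar>d1\<bar> \<le> L\<^sup>2 * q"
  proof -
    have "\<bar>d1\<bar> \<le> 2 * L * q + 2 * L * q + 2 * L * q"
      unfolding d1_def by (rule tri(2)[OF order_trans[OF lamx(2) dd(2)] order_trans[OF lamx(1) dd(1)] order_trans[OF lamx(4) xz(5)]])
    also have "\<dots> = 6 * L ^ 1 * q" by simp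
    also have "\<dots> \<le> L\<^sup>2 * q" using L_absorb[of 1 2 6] q_pos by (intro mult_right_mono) auto
    finally show ?thesis .
  qed
  have Tb: "\<bar>?n * T\<bar> \<le> L ^ 6"
  proof -
    have e: "?n * T = (SR a - SR b) / m + del a * xr a / ?n - del b * xr b / ?n + ((1 - 2 * lam) * (?Dl * ?f)) * (1 / gam)"
      unfolding T_def using n_pos m_pos gam_pos by (intro level2_scaled) auto
    have "\<bar>?Dl * ?f\<bar> \<le> (4 * L * q) * (L * (2 * L) / q)"
      unfolding abs_mult using dd(4) div_m_le[OF dd(3)] Lq by (intro mult_mono) auto
    also have "\<dots> = 8 * L ^ 3" using q_pos by (simp add: power3_eq_cube)
    finally have "\<bar>(1 - 2 * lam) * (?Dl * ?f)\<bar> \<le> 8 * L ^ 3" using lamx(3)[of "?Dl * ?f"] by linarith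
    moreover have "\<bar>1 / gam\<bar> \<le> L\<^sup>2"
    proof -
      have "1 / gam \<le> 1 / (1 / L\<^sup>2)" using gam_ge gam_pos L_pos by (intro frac_le) auto
      then show ?thesis using gam_pos by simp
    qed
    ultimately have "\<bar>((1 - 2 * lam) * (?Dl * ?f)) * (1 / gam)\<bar> \<le> (8 * L ^ 3) * L\<^sup>2"
      unfolding abs_mult[of _ "1 / gam"] using L_pos by (intro mult_mono) auto
    then have "\<bar>?n * T\<bar> \<le> 4 * L ^ 3 + 2 * L\<^sup>2 + 2 * L\<^sup>2 + (8 * L ^ 3) * L\<^sup>2"
      unfolding e using SRm pr[OF dd(1) xz(3)] pr[OF dd(2) xz(4)] by linarith
    also have "\<dots> = 4 * L ^ 3 + 4 * L\<^sup>2 + 8 * L ^ 5" by (simp add: power_numeral_reduce)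
    also have "\<dots> \<le> L ^ 6" using L_absorb[of 3 5 4] L_absorb[of 2 5 4] L_absorb[of 5 6 10] by linarith
    finally show ?thesis .
  qed
  have erb: "\<bar>er\<bar> \<le> L ^ 6"
  proof -
    have 1: "\<bar>del b / ?n + ?f\<bar> \<le> L ^ 3 / q" "\<bar>del a / ?n + ?f\<bar> \<le> L ^ 3 / q"
      using p1_dev[OF ab(2) k] p1_dev[OF ab(1) k] unfolding p1_def by (simp_all add: add.assoc)
    have "\<bar>er\<bar> = ?n * (\<bar>del b / ?n + ?f\<bar> * \<bar>del a / ?n + ?f\<bar>)" unfolding er_def by (simp add: abs_mult)
    also have "\<dots> \<le> ?n * ((L ^ 3 / q) * (L ^ 3 / q))" using 1 L_pos q_pos by (intro mult_left_mono mult_mono) auto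
    also have "\<dots> = L ^ 6" using q_pos by (simp add: qq[symmetric] flip: power_add)
    finally show ?thesis .
  qed
  have Erb: "\<bar>Er\<bar> \<le> L ^ 5" unfolding Er_def d1_def by (rule D0_p1[OF ab])
  have big: "L ^ 6 \<le> q" by (rule L_le_q) simp
  have t1: "\<bar>w * e1\<bar> \<le> L ^ 7 * q"
  proof -
    have "\<bar>w * e1\<bar> \<le> L ^ 4 * (L ^ 3 * q)" unfolding abs_mult using wb e1b L_pos by (intro mult_mono) auto
    then show ?thesis by (simp add: power_numeral_reduce mult.assoc)
  qed
  have t2: "\<bar>?n * T * d1\<bar> \<le> L ^ 8 * q"
  proof -
    have "\<bar>?n * T * d1\<bar> \<le> L ^ 6 * (L\<^sup>2 * q)" unfolding abs_mult[of "?n * T"] using Tb d1b L_pos by (intro mult_mono) auto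
    then show ?thesis by (simp add: power_numeral_reduce mult.assoc)
  qed
  have t3: "\<bar>(?Dl + w) * er\<bar> \<le> 5 * L ^ 7 * q"
  proof -
    have "L ^ 4 \<le> L * q" using L_mono[of 4 6] big mult_right_mono[OF L1, of q] q_pos by linarith
    then have "\<bar>?Dl + w\<bar> \<le> 5 * L * q" using dd(4) wb by linarith
    then have "\<bar>(?Dl + w) * er\<bar> \<le> (5 * L * q) * L ^ 6" unfolding abs_mult using erb Lq by (intro mult_mono) auto
    then show ?thesis by (simp add: power_numeral_reduce algebra_simps)
  qed
  have t4: "\<bar>(?Dl + ?n * T) * Er\<bar> \<le> 5 * L ^ 6 * q"
  proof -
    have "L ^ 6 \<le> L * q" using big q_pos mult_right_mono[OF L1, of q] by linarith
    then have "\<bar>?Dl + ?n * T\<bar> \<le> 5 * L * q" using dd(4) Tb by linarith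
    then have "\<bar>(?Dl + ?n * T) * Er\<bar> \<le> (5 * L * q) * L ^ 5" unfolding abs_mult using Erb Lq by (intro mult_mono) auto
    then show ?thesis by (simp add: power_numeral_reduce algebra_simps)
  qed
  have tot: "\<bar>w * e1 - ?n * T * d1 + (?Dl + w) * er - (?Dl + ?n * T) * Er\<bar> \<le> L ^ 9 * q"
  proof -
    have "L ^ 7 * q \<le> L ^ 8 * q" "5 * L ^ 7 * q \<le> L ^ 8 * q" "5 * L ^ 6 * q \<le> L ^ 8 * q" "4 * L ^ 8 * q \<le> L ^ 9 * q"
      using L_mono[of 7 8] L_absorb[of 7 8 5] L_absorb[of 6 8 5] L_absorb[of 8 9 4] q_pos by (auto intro!: mult_right_mono)
    then show ?thesis using t1 t2 t3 t4 by linarith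
  qed
  have Dn: "n / L ^ 3 * ?n \<le> \<bar>D0 p1 a b * ?n\<bar>"
    using mult_right_mono[OF D, of ?n] Dp by (simp add: abs_mult)
  have "\<bar>(w * e1 - ?n * T * d1 + (?Dl + w) * er - (?Dl + ?n * T) * Er) / (D0 p1 a b * ?n)\<bar> \<le> L ^ 9 * q / (n / L ^ 3 * ?n)"
    unfolding abs_divide by (rule frac_le[OF _ tot _ Dn]) (use L_pos q_pos n_pos in auto)
  also have "\<dots> = L ^ 12 / q ^ 3"
    using q_pos L_pos by (simp add: q2[symmetric] field_simps power_numeral_reduce)
  finally show ?thesis unfolding main .
qed

text \<open>Checks the part of the formula that differences of rows cannot see. The O(1) terms
  cancel in pairs: e y / M against the rows removed from the column, and l X / N and S / N against
  the sum of \<open>del\<close> over the remaining rows. What is left has order 1/q up to powers of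
  \<open>L\<close>.\<close>

lemma column_sum_identity:
  fixes M N :: real
  assumes "M \<noteq> 0" "N \<noteq> 0" "g \<noteq> 0"
  shows "(M - y) * (l + e / M + e * y / M\<^sup>2 - l * X / (M * N) + S / (M * N))
     + (l * X - S) * (1 / N + c * e / (g * M * N)) + Q1 / N\<^sup>2 + Q2 / (M * N) - (e + l * M - l * y)
   = - (e * y\<^sup>2 / M\<^sup>2) + y * (l * X - S) / (M * N) + c * e * (l * X - S) / (g * M * N) + Q1 / N\<^sup>2 + Q2 / (M * N)"
  using assms by (simp add: field_simps power2_eq_square)

lemma div_mn_le: "\<bar>x\<bar> \<le> c * q * real n \<Longrightarrow> \<bar>x / (real m * real n)\<bar> \<le> L * c / q"
proof -
  assume "\<bar>x\<bar> \<le> c * q * real n"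
  then have "\<bar>x / n\<bar> \<le> c * q" using n_pos by (simp add: abs_divide divide_le_eq)
  from div_m_le[OF this] show ?thesis by (simp add: mult.commute)
qed

lemma Pst_column_sum:
  assumes k: "k < n"
  shows "\<bar>(\<Sum>b | b < m \<and> (b,k) \<notin> {} \<union> F. Pst b k) - real (t k)\<bar> \<le> L ^ 7 / q"
proof -
  let ?o = "\<lambda>b. 1 - oF b k" and ?X = "real (card F)" and ?M = "real m" and ?N = "real n"
  let ?y = "yc k" and ?e = "et k" and ?S = "SC k"
  define c1 where "c1 = lam + ?e / ?M + ?e * ?y / ?M\<^sup>2 - lam * ?X / (?M * ?N) + ?S / (?M * ?N)"
  define c2 where "c2 = 1 / ?N + (1 - 2 * lam) * ?e / (gam * ?M * ?N)"
  define Q1 where "Q1 = (\<Sum>b<m. ?o b * (del b * xr b))"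
  define Q2 where "Q2 = (\<Sum>b<m. ?o b * SR b)"
  have P: "Pst b k = c1 + del b * c2 + del b * xr b * (1 / ?N\<^sup>2) + SR b * (1 / (?M * ?N))" for b
    unfolding Pst_def c1_def c2_def by (simp add: algebra_simps add_divide_distrib)
  have "(\<Sum>b | b < m \<and> (b,k) \<notin> {} \<union> F. Pst b k) = (\<Sum>b<m. if (b,k) \<notin> F then Pst b k else 0)"
    by (simp add: sum.inter_filter[symmetric])
  also have "\<dots> = (\<Sum>b<m. ?o b * c1 + ?o b * del b * c2 + ?o b * (del b * xr b) * (1 / ?N\<^sup>2) + ?o b * SR b * (1 / (?M * ?N)))"
    by (rule sum.cong[OF refl]) (simp add: P)
  also have "\<dots> = (\<Sum>b<m. ?o b) * c1 + (\<Sum>b<m. ?o b * del b) * c2 + Q1 * (1 / ?N\<^sup>2) + Q2 * (1 / (?M * ?N))"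
    unfolding Q1_def Q2_def by (simp only: sum.distrib sum_distrib_right)
  also have "(\<Sum>b<m. ?o b) = ?M - ?y" unfolding yc_sum by (subst sum_subtractf) simp
  also have "(\<Sum>b<m. ?o b * del b) = lam * ?X - ?S"
  proof -
    have "(\<Sum>b<m. ?o b * del b) = (\<Sum>b<m. del b - oF b k * del b)" by (rule sum.cong) (simp_all only: algebra_simps)
    also have "\<dots> = (\<Sum>b<m. del b) - (\<Sum>b<m. oF b k * del b)" by (rule sum_subtractf)
    finally show ?thesis unfolding SC_def sum_del .
  qed
  finally have S: "(\<Sum>b | b < m \<and> (b,k) \<notin> {} \<union> F. Pst b k) = (?M - ?y) * c1 + (lam * ?X - ?S) * c2 + Q1 * (1 / ?N\<^sup>2) + Q2 * (1 / (?M * ?N))" .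
  have tk: "real (t k) = ?e + lam * ?M - lam * ?y" unfolding et_def by simp
  have g0: "gam \<noteq> 0" using gam_pos by linarith
  have main: "(\<Sum>b | b < m \<and> (b,k) \<notin> {} \<union> F. Pst b k) - real (t k) = - (?e * ?y\<^sup>2 / ?M\<^sup>2) + ?y * (lam * ?X - ?S) / (?M * ?N)
     + (1 - 2 * lam) * ?e * (lam * ?X - ?S) / (gam * ?M * ?N) + Q1 / ?N\<^sup>2 + Q2 / (?M * ?N)"
    unfolding S tk c1_def c2_def mult_1_right times_divide_eq_right
    by (rule column_sum_identity) (use m_pos n_pos g0 in auto)
  have yb: "\<bar>?y\<bar> \<le> L * q" "?y\<^sup>2 \<le> L\<^sup>2 * ?N"
  proof -
    show "\<bar>?y\<bar> \<le> L * q" using yc_bounds[of k] k by auto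
    then have "\<bar>?y\<bar>\<^sup>2 \<le> (L * q)\<^sup>2" by (intro power_mono) auto
    then show "?y\<^sup>2 \<le> L\<^sup>2 * ?N" by (simp add: power_mult_distrib q2)
  qed
  have eb: "\<bar>?e\<bar> \<le> 2 * L * q" by (rule et_bound[OF k])
  have a1: "\<bar>- (?e * ?y\<^sup>2 / ?M\<^sup>2)\<bar> \<le> 2 * L ^ 5 / q"
  proof -
    have "\<bar>?e / ?M\<bar> \<le> L * (2 * L) / q" by (rule div_m_le[OF eb])
    moreover have "?y\<^sup>2 / ?M \<le> L ^ 3"
    proof -
      have "L\<^sup>2 * ?N \<le> L\<^sup>2 * (L * ?M)" using n_le L_pos by (intro mult_left_mono) auto
      then show ?thesis using yb(2) m_pos by (simp add: divide_le_eq power2_eq_square power3_eq_cube)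
    qed
    ultimately have "\<bar>?e / ?M\<bar> * (?y\<^sup>2 / ?M) \<le> (L * (2 * L) / q) * L ^ 3" using L_pos q_pos by (intro mult_mono) auto
    then show ?thesis by (simp add: abs_mult abs_divide power2_eq_square power_numeral_reduce algebra_simps)
  qed
  have V: "\<bar>lam * ?X - ?S\<bar> \<le> 3 * L\<^sup>2 * ?N"
  proof -
    have "lam * ?X \<le> L * ?N" "0 \<le> lam * ?X" using lam_mult_le[of ?X] F_card by auto
    moreover have "L * ?N \<le> L\<^sup>2 * ?N" using L_mono[of 1 2] by (intro mult_right_mono) auto
    ultimately show ?thesis using SC_bound[OF k] by linarith
  qed
  have a2: "\<bar>?y * (lam * ?X - ?S) / (?M * ?N)\<bar> \<le> L * (3 * L ^ 3) / q"
  proof (rule div_mn_le)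
    have "\<bar>?y * (lam * ?X - ?S)\<bar> \<le> (L * q) * (3 * L\<^sup>2 * ?N)" unfolding abs_mult using yb(1) V by (intro mult_mono) auto
    then show "\<bar>?y * (lam * ?X - ?S)\<bar> \<le> 3 * L ^ 3 * q * ?N" by (simp add: power_numeral_reduce algebra_simps)
  qed
  have a3: "\<bar>(1 - 2 * lam) * ?e * (lam * ?X - ?S) / (gam * ?M * ?N)\<bar> \<le> L * (6 * L ^ 5) / q"
  proof -
    have "\<bar>1 / gam\<bar> \<le> L\<^sup>2"
    proof -
      have "1 / gam \<le> 1 / (1 / L\<^sup>2)" using gam_ge gam_pos L_pos by (intro frac_le) auto
      then show ?thesis using gam_pos by simp
    qed
    moreover have "\<bar>1 - 2 * lam\<bar> \<le> 1" using lam_pos lam1 by auto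
    moreover have "\<bar>?e * (lam * ?X - ?S)\<bar> \<le> (2 * L * q) * (3 * L\<^sup>2 * ?N)" unfolding abs_mult using eb V by (intro mult_mono) auto
    ultimately have "\<bar>1 / gam\<bar> * (\<bar>1 - 2 * lam\<bar> * \<bar>?e * (lam * ?X - ?S)\<bar>) \<le> L\<^sup>2 * (1 * ((2 * L * q) * (3 * L\<^sup>2 * ?N)))"
      using L_pos q_pos by (intro mult_mono) auto
    then have "\<bar>1 / gam * ((1 - 2 * lam) * (?e * (lam * ?X - ?S)))\<bar> \<le> 6 * L ^ 5 * q * ?N"
      unfolding abs_mult by (simp add: power_numeral_reduce algebra_simps)
    from div_mn_le[OF this] show ?thesis by (simp add: mult.assoc mult.left_commute)
  qed
  have F2: "\<bar>Q\<bar> \<le> 2 * L\<^sup>2 * q * ?N" if "\<bar>Q\<bar> \<le> (\<Sum>b<m. 2 * L * q * xr b)" for Q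
  proof -
    have "(\<Sum>b<m. 2 * L * q * xr b) = 2 * L * q * ?X" by (simp add: sum_xr flip: sum_distrib_left)
    also have "\<dots> \<le> 2 * L * q * (L * ?N)" using F_card L_pos q_pos by (intro mult_left_mono) auto
    finally show ?thesis using that by (simp add: power2_eq_square algebra_simps)
  qed
  have a4: "\<bar>Q1 / ?N\<^sup>2\<bar> \<le> 2 * L\<^sup>2 / q"
  proof -
    have "\<bar>Q1\<bar> \<le> (\<Sum>b<m. 2 * L * q * xr b)" unfolding Q1_def
    proof (rule order_trans[OF sum_abs sum_mono])
      fix b assume "b \<in> {..<m}"
      then have "\<bar>del b * xr b\<bar> \<le> 2 * L * q * xr b"
        unfolding abs_mult using del_bound[of b] xr_bounds[of b] by (intro mult_mono) auto
      moreover have "\<bar>?o b * (del b * xr b)\<bar> \<le> 1 * \<bar>del b * xr b\<bar>" unfolding abs_mult[of "?o b"] by (intro mult_right_mono) auto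
      ultimately show "\<bar>?o b * (del b * xr b)\<bar> \<le> 2 * L * q * xr b" by linarith
    qed
    then have "\<bar>Q1\<bar> \<le> 2 * L\<^sup>2 * q * ?N" by (rule F2)
    then have "\<bar>Q1 / ?N\<bar> \<le> 2 * L\<^sup>2 * q" using n_pos by (simp add: abs_divide divide_le_eq)
    from div_n_le[OF this] show ?thesis by (simp add: power2_eq_square)
  qed
  have a5: "\<bar>Q2 / (?M * ?N)\<bar> \<le> L * (2 * L\<^sup>2) / q"
  proof (rule div_mn_le, rule F2)
    show "\<bar>Q2\<bar> \<le> (\<Sum>b<m. 2 * L * q * xr b)" unfolding Q2_def
    proof (rule order_trans[OF sum_abs sum_mono])
      fix b assume "b \<in> {..<m}"
      then have "\<bar>SR b\<bar> \<le> 2 * L * q * xr b" using SR_bound by auto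
      moreover have "\<bar>?o b * SR b\<bar> \<le> 1 * \<bar>SR b\<bar>" unfolding abs_mult[of "?o b"] by (intro mult_right_mono) auto
      ultimately show "\<bar>?o b * SR b\<bar> \<le> 2 * L * q * xr b" by linarith
    qed
  qed
  have "\<bar>(\<Sum>b | b < m \<and> (b,k) \<notin> {} \<union> F. Pst b k) - real (t k)\<bar>
     \<le> 2 * L ^ 5 / q + L * (3 * L ^ 3) / q + L * (6 * L ^ 5) / q + 2 * L\<^sup>2 / q + L * (2 * L\<^sup>2) / q"
    unfolding main by (rule abs_sum5[OF a1 a2 a3 a4 a5])
  also have "\<dots> = (2 * L ^ 5 + 3 * L ^ 4 + 6 * L ^ 6 + 2 * L\<^sup>2 + 2 * L ^ 3) / q"
    by (simp add: add_divide_distrib power_numeral_reduce mult.left_commute)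
  also have "\<dots> \<le> L ^ 7 / q"
  proof (rule divide_right_mono)
    show "2 * L ^ 5 + 3 * L ^ 4 + 6 * L ^ 6 + 2 * L\<^sup>2 + 2 * L ^ 3 \<le> L ^ 7"
      using L_absorb[of 5 6 2] L_absorb[of 4 6 3] L_absorb[of 2 6 2] L_absorb[of 3 6 2] L_absorb[of 6 7 10] by linarith
  qed (use q_pos in simp)
  finally show ?thesis .
qed

text \<open>The second round is run without extra conditions, so the term g/q^2 vanishes, and with
  \<kappa> of order 1/n the term \<kappa>/q has order 1/q^3. The column sum is correct to order 1/q
  and contributes order 1/(q m).\<close>

lemma edge_prob_level2:
  assumes a: "a < m" and k: "k < n" and e: "(a,k) \<notin> F"
  shows "\<bar>NN {(a,k)} F - Pst a k * NN {} F\<bar> \<le> L ^ 34 / q ^ 3 * NN {} F"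
proof -
  have near: "near 0 {} F" by (rule near_base)
  have "\<bar>NN (insert (a,k) {}) F - Pst a k * NN {} F\<bar> \<le> (2 * L ^ 33 / q ^ 3 + 2 * (L ^ 7 / q + real (card ({} :: (nat \<times> nat) set))) / m) * NN {} F"
  proof (rule column_closing[OF near _ k a, where r = "\<lambda>b. Pst b k"])
    show "\<bar>(\<Sum>b | b < m \<and> (b,k) \<notin> {} \<union> F. Pst b k) - real (t k)\<bar> \<le> L ^ 7 / q" by (rule Pst_column_sum[OF k])
    show "0 \<le> 2 * L ^ 33 / q ^ 3" using L_pos q_pos by simp
    fix b assume b: "b < m" "b \<noteq> a" "(b,k) \<notin> {} \<union> F"
    have 1: "\<bar>NN (insert (a,k) {}) F - NN (insert (b,k) {}) F - nu0 p1 a b / D0 p1 a b * (p1 (b,k) * (1 - p1 (a,k))) * NN {} F\<bar>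
       \<le> L ^ 12 * (L ^ 20 / n / q + 1 / q ^ 3 + real 0 / q\<^sup>2) * NN {} F"
      by (rule switch_difference_approx[OF approx1 near]) (use a b k e in auto)
    have "L ^ 12 * (L ^ 20 / n / q + 1 / q ^ 3 + real 0 / q\<^sup>2) = (L ^ 32 + L ^ 12) / q ^ 3"
      using q_pos by (simp add: q2[symmetric] field_simps power_numeral_reduce)
    also have "\<dots> \<le> L ^ 33 / q ^ 3"
      using L_absorb[of 12 32 1] L_absorb[of 32 33 2] q_pos by (intro divide_right_mono) auto
    finally have 2: "L ^ 12 * (L ^ 20 / n / q + 1 / q ^ 3 + real 0 / q\<^sup>2) * NN {} F \<le> L ^ 33 / q ^ 3 * NN {} F"
      by (intro mult_right_mono) auto
    have 3: "\<bar>(nu0 p1 a b / D0 p1 a b * (p1 (b,k) * (1 - p1 (a,k))) - (Pst a k - Pst b k)) * NN {} F\<bar> \<le> L ^ 12 / q ^ 3 * NN {} F"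
      unfolding abs_mult[of _ "NN {} F"] using level2_main[OF a b(1) _ k] b by (intro mult_mono) auto
    show "\<bar>NN (insert (a,k) {}) F - NN (insert (b,k) {}) F - (Pst a k - Pst b k) * NN {} F\<bar> \<le> 2 * L ^ 33 / q ^ 3 * NN {} F"
    proof (rule approx_shift[OF 1 2 3])
      have "L ^ 12 / q ^ 3 \<le> L ^ 33 / q ^ 3" using L_mono[of 12 33] q_pos by (intro divide_right_mono) auto
      then have "L ^ 12 / q ^ 3 * NN {} F \<le> L ^ 33 / q ^ 3 * NN {} F" by (intro mult_right_mono) auto
      then show "L ^ 33 / q ^ 3 * NN {} F + L ^ 12 / q ^ 3 * NN {} F \<le> 2 * L ^ 33 / q ^ 3 * NN {} F" by simp
    qed
  qed (use e in auto)
  also have "\<dots> \<le> L ^ 34 / q ^ 3 * NN {} F"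
  proof (rule mult_right_mono)
    have "2 * (L ^ 7 / q) / m \<le> L * (2 * (L ^ 7 / q)) / n" by (rule per_m) (use L_pos q_pos in simp)
    also have "\<dots> = 2 * L ^ 8 / q ^ 3" using q_pos by (simp add: q2[symmetric] field_simps power_numeral_reduce)
    finally have "2 * L ^ 33 / q ^ 3 + 2 * (L ^ 7 / q + real (card ({} :: (nat \<times> nat) set))) / m \<le> (2 * L ^ 33 + 2 * L ^ 8) / q ^ 3"
      by (simp add: add_divide_distrib)
    also have "\<dots> \<le> L ^ 34 / q ^ 3"
      using L_absorb[of 8 33 2] L_absorb[of 33 34 3] q_pos by (intro divide_right_mono) auto
    finally show "2 * L ^ 33 / q ^ 3 + 2 * (L ^ 7 / q + real (card ({} :: (nat \<times> nat) set))) / m \<le> L ^ 34 / q ^ 3" .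
  qed simp
  finally show ?thesis .
qed

end


section \<open>Forbidding the edges one at a time\<close>

lemma quadratic_derivative_bound:
  fixes u :: real
  assumes u: "\<bar>u\<bar> \<le> r" and der: "\<And>x. \<bar>x\<bar> \<le> r \<Longrightarrow> (g has_real_derivative g' x) (at x)"
    and bd: "\<And>x. \<bar>x\<bar> \<le> \<bar>u\<bar> \<Longrightarrow> \<bar>g' x\<bar> \<le> B"
  shows "norm (g u - g 0) \<le> B * norm (u - 0)"
proof (rule field_differentiable_bound[where S = "{- \<bar>u\<bar>..\<bar>u\<bar>}"])
  show "(g has_real_derivative g' z) (at z within {- \<bar>u\<bar>..\<bar>u\<bar>})" if "z \<in> {- \<bar>u\<bar>..\<bar>u\<bar>}" for z
    by (rule has_field_derivative_at_within[OF der]) (use that u in auto)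
  show "norm (g' z) \<le> B" if "z \<in> {- \<bar>u\<bar>..\<bar>u\<bar>}" for z using bd[of z] that by auto
qed auto

text \<open>The derivative of the bracket is - x^2 / (1 - x), at most 2 u^2 in absolute value
  between -|u| and |u|.\<close>

lemma ln_one_minus_bound:
  fixes u :: real
  assumes "\<bar>u\<bar> \<le> 1 / 2"
  shows "\<bar>ln (1 - u) + u + u\<^sup>2 / 2\<bar> \<le> 2 * \<bar>u\<bar> ^ 3"
proof -
  let ?g = "\<lambda>x::real. ln (1 - x) + x + x\<^sup>2 / 2" and ?g' = "\<lambda>x::real. - (x\<^sup>2 / (1 - x))"
  have der: "(?g has_real_derivative ?g' x) (at x)" if "\<bar>x\<bar> \<le> 1 / 2" for x
  proof -
    have "1 - x > 0" using that by linarith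
    then have "(?g has_real_derivative (- 1 / (1 - x) + 1 + x)) (at x)"
      by (auto intro!: derivative_eq_intros)
    moreover have "- 1 / (1 - x) + 1 + x = ?g' x" using \<open>1 - x > 0\<close> by (simp add: field_simps power2_eq_square)
    ultimately show ?thesis by simp
  qed
  have bd: "\<bar>?g' x\<bar> \<le> 2 * \<bar>u\<bar>\<^sup>2" if "\<bar>x\<bar> \<le> \<bar>u\<bar>" for x
  proof -
    have h: "1 - x \<ge> 1 / 2" using that assms by linarith
    have "\<bar>?g' x\<bar> = \<bar>x\<bar>\<^sup>2 / (1 - x)" using h by simp
    also have "\<dots> \<le> \<bar>u\<bar>\<^sup>2 / (1 / 2)" using h that by (intro frac_le power_mono) auto
    finally show ?thesis by simp
  qed
  have "norm (?g u - ?g 0) \<le> 2 * \<bar>u\<bar>\<^sup>2 * norm (u - 0)"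
    by (rule quadratic_derivative_bound[OF assms der bd])
  then show ?thesis by (simp add: power2_eq_square power3_eq_cube abs_mult)
qed

text \<open>When an edge joins \<open>F\<close>, the degree x of its row grows by 1 and its
  deviation d by l. This is the change of the terms with only powers of N in the denominator; the
  same identity with M serves the column. The last summand has order q / n^2 and will be an error
  term.\<close>

lemma increment_row:
  fixes l N :: real
  assumes "l \<noteq> 1" "N \<noteq> 0"
  shows "l / (2 * (1 - l)) * (1 / N) - 1 / (1 - l) * (((d + l) * (x + 1) - d * x) / N)
      + l / (2 * (1 - l)) * (((x + 1)\<^sup>2 - x\<^sup>2) / N)
      + l * (1 - 2 * l) / (6 * (1 - l)\<^sup>2) * (((x + 1) ^ 3 - x ^ 3) / N\<^sup>2)
      - (1 - 2 * l) / (2 * (1 - l)\<^sup>2) * (((d + l) * (x + 1)\<^sup>2 - d * x\<^sup>2) / N\<^sup>2)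
      - 1 / (2 * (1 - l)\<^sup>2) * (((d + l)\<^sup>2 * (x + 1) - d\<^sup>2 * x) / N\<^sup>2)
    = - (d / N + d * x / N\<^sup>2) / (1 - l) - d\<^sup>2 / N\<^sup>2 / (2 * (1 - l)\<^sup>2)
      + (l * (1 - 2 * l) * (3 * x + 1) / 6 - (1 - 2 * l) * (d + 2 * l * x + l) / 2 - (2 * d * l + l\<^sup>2 * x + l\<^sup>2) / 2)
        / ((1 - l)\<^sup>2 * N\<^sup>2)"
proof -
  define i where "i = 1 / N"
  define u where "u = 1 / (1 - l)"
  have "(1 - l) * u = 1" using assms by (simp add: u_def)
  moreover have "u\<^sup>2 - u\<^sup>2 * l = u * ((1 - l) * u)" by (simp add: power2_eq_square algebra_simps)
  ultimately have u: "u\<^sup>2 - u\<^sup>2 * l = u" by simp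
  have r: "x / N = x * i" "x / N\<^sup>2 = x * i\<^sup>2" "x / (1 - l) = x * u" "x / (2 * (1 - l)) = x * u / 2"
     "x / (2 * (1 - l)\<^sup>2) = x * u\<^sup>2 / 2" "x / (6 * (1 - l)\<^sup>2) = x * u\<^sup>2 / 6" "x / ((1 - l)\<^sup>2 * N\<^sup>2) = x * u\<^sup>2 * i\<^sup>2" for x :: real
    by (simp_all add: i_def u_def power_divide)
  have "l * u / 2 * (1 * i) - 1 * u * (((d + l) * (x + 1) - d * x) * i)
      + l * u / 2 * (((x + 1)\<^sup>2 - x\<^sup>2) * i)
      + l * (1 - 2 * l) * u\<^sup>2 / 6 * (((x + 1) ^ 3 - x ^ 3) * i\<^sup>2)
      - (1 - 2 * l) * u\<^sup>2 / 2 * (((d + l) * (x + 1)\<^sup>2 - d * x\<^sup>2) * i\<^sup>2)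
      - 1 * u\<^sup>2 / 2 * (((d + l)\<^sup>2 * (x + 1) - d\<^sup>2 * x) * i\<^sup>2)
    = - (d * i * u + d * x * i\<^sup>2 * (u\<^sup>2 - u\<^sup>2 * l)) - d\<^sup>2 * i\<^sup>2 * u\<^sup>2 / 2
      + (l * (1 - 2 * l) * (3 * x + 1) / 6 - (1 - 2 * l) * (d + 2 * l * x + l) / 2 - (2 * d * l + l\<^sup>2 * x + l\<^sup>2) / 2)
        * u\<^sup>2 * i\<^sup>2"
    by (simp add: field_simps power2_eq_square power3_eq_cube)
  then show ?thesis unfolding r u by (simp add: ring_distribs)
qed

text \<open>The product d e appears through the partial fraction 1/(l(1-l)) = (1-2l)/(l(1-l)^2) +
  1/(1-l)^2: the first part is the source of the coefficient 1 - 2 lam in \<open>Pst\<close>, the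
  second is the cross term of the square in the logarithm.\<close>

lemma increment_cross:
  fixes l M N :: real
  assumes "l \<noteq> 1" "l \<noteq> 0" "N \<noteq> 0" "M \<noteq> 0"
  shows "l * ((X + 1)\<^sup>2 - X\<^sup>2) / (2 * (1 - l) * M * N) - (l * S + (d + l) * (e + l)) / (l * (1 - l) * M * N)
    = - (- l * X / (M * N) + S / (M * N) + (1 - 2 * l) * d * e / (l * (1 - l) * M * N)) / (1 - l)
      - 2 * (d / N) * (e / M) / (2 * (1 - l)\<^sup>2) + (l / 2 - d - e - l) / ((1 - l) * (M * N))"
proof -
  define w where "w = 1 / (M * N)"
  define u where "u = 1 / (1 - l)"
  define v where "v = 1 / l"
  have u: "u * l = u - 1" using assms by (simp add: u_def field_simps)
  have v: "v * l = 1" using assms by (simp add: v_def)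
  have r: "x / (2 * (1 - l) * M * N) = x * u * w / 2" "x / (l * (1 - l) * M * N) = x * u * v * w" "x / (M * N) = x * w"
    "x / (1 - l) = x * u" "x / (2 * (1 - l)\<^sup>2) = x * u\<^sup>2 / 2" "x / ((1 - l) * (M * N)) = x * u * w" for x :: real
    by (simp_all add: w_def u_def v_def power_divide)
  have r2: "2 * (d / N) * (e / M) = 2 * d * e * w" by (simp add: w_def)
  have "(l * S + (d + l) * (e + l)) * u * v * w = (S * (v * l) + d * e * v + d * (v * l) + e * (v * l) + l * (v * l)) * u * w"
    by (simp add: algebra_simps)
  then have 1: "(l * S + (d + l) * (e + l)) * u * v * w = (S + d * e * v + d + e + l) * u * w" unfolding v by simp
  have "(1 - 2 * l) * d * e * u * v * w = d * e * w * (u * v - 2 * u * (v * l))" by (simp add: algebra_simps)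
  then have 2: "(1 - 2 * l) * d * e * u * v * w = d * e * w * (u * v - 2 * u)" unfolding v by simp
  have 3: "u * v = u * u * v - u * u"
  proof -
    have "u * u * v - u * u * (v * l) = u * v * (u - u * l)" by (simp add: algebra_simps)
    then show ?thesis unfolding u v by simp
  qed
  have 4: "d * e * w * (u * v) = d * e * w * (u * u * v - u * u)" using 3 by simp
  have 5: "(S + d * e * v + d + e + l) * u * w = d * e * w * (u * v) + (S + d + e + l) * u * w" by (simp add: algebra_simps)
  show ?thesis unfolding r r2 1 2 5 4 by (simp add: field_simps power2_eq_square)
qed

lemma increment_split:
  fixes l :: real
  shows "(l * (X + 1) / c * (p + q) + l * (X + 1)\<^sup>2 / w - u * ((R11 + r11) / N + (C11 + s11) / M) - (Y + dy) / v
    + f * ((R02 + r02) / N + (C02 + s02) / M) + g * ((R03 + r03) / N2 + (C03 + s03) / M2)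
    - h * ((R12 + r12) / N2 + (C12 + s12) / M2) - k * ((R21 + r21) / N2 + (C21 + s21) / M2))
   - (l * X / c * (p + q) + l * X\<^sup>2 / w - u * (R11 / N + C11 / M) - Y / v
    + f * (R02 / N + C02 / M) + g * (R03 / N2 + C03 / M2)
    - h * (R12 / N2 + C12 / M2) - k * (R21 / N2 + C21 / M2))
  = (l / c * p - u * (r11 / N) + f * (r02 / N) + g * (r03 / N2) - h * (r12 / N2) - k * (r21 / N2))
   + (l / c * q - u * (s11 / M) + f * (s02 / M) + g * (s03 / M2) - h * (s12 / M2) - k * (s21 / M2))
   + (l * ((X + 1)\<^sup>2 - X\<^sup>2) / w - dy / v)"
  by (simp add: ring_distribs add_divide_distrib diff_divide_distrib)

section \<open>Increments of the exponent when one edge is added\<close>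

context forb_bip begin

lemma defs_lam: "sbar m s = lam * real n" "tbar n t = lam * real m" "Defs.lam m n s = lam"
proof -
  show 1: "sbar m s = lam * real n" unfolding sbar_def sum_s using m_pos by simp
  show "tbar n t = lam * real m" unfolding tbar_def sum_t using n_pos by simp
  show "Defs.lam m n s = lam" unfolding lam_def 1 using n_pos by simp
qed

lemma finite_F: "finite F" using F_box by (rule finite_subset) auto

lemma deg_u_F: "real (deg_u F j) = xr j" and deg_v_F: "real (deg_v F k) = yc k"
  by (simp_all add: deg_u_def deg_v_def xr_def yc_def)

lemma delta_F: "delta m n s F j = del j" and eta_F: "eta m n s t F k = et k"
  unfolding delta_def eta_def defs_lam deg_u_F deg_v_F del_def et_def by simp_all

lemma sum_F: "(\<Sum>(j,l)\<in>F. f j l) = (\<Sum>j<m. \<Sum>l<n. oF j l * f j l)"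
proof -
  have "(\<Sum>(j,l)\<in>F. f j l) = (\<Sum>e\<in>{..<m} \<times> {..<n}. of_bool (e \<in> F) * (case e of (j,l) \<Rightarrow> f j l))"
    using F_box by (subst sum.mono_neutral_left[of "{..<m} \<times> {..<n}" F, symmetric, where g = "\<lambda>e. of_bool (e \<in> F) * (case e of (j,l) \<Rightarrow> f j l)"])
      (auto intro!: sum.cong)
  also have "\<dots> = (\<Sum>j<m. \<Sum>l<n. oF j l * f j l)"
    unfolding sum.cartesian_product by (rule sum.cong) auto
  finally show ?thesis .
qed

context
  fixes a k assumes a: "a < m" and k: "k < n" and e: "(a,k) \<notin> F"
begin

lemma deg_u_ins: "real (deg_u (insert (a,k) F) j) = xr j + of_bool (j = a)"
proof (cases "j = a")
  case True
  have "{l. (a,l) \<in> insert (a,k) F} = insert k {l. (a,l) \<in> F}" by auto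
  then show ?thesis using e finite_row[OF F_box, of a] True by (simp add: deg_u_def xr_def)
next
  case False
  then have "{l. (j,l) \<in> insert (a,k) F} = {l. (j,l) \<in> F}" by auto
  then show ?thesis using False by (simp add: deg_u_def xr_def)
qed

lemma deg_v_ins: "real (deg_v (insert (a,k) F) l) = yc l + of_bool (l = k)"
proof (cases "l = k")
  case True
  have "{j. (j,k) \<in> insert (a,k) F} = insert a {j. (j,k) \<in> F}" by auto
  then show ?thesis using e finite_col[OF F_box, of k] True by (simp add: deg_v_def yc_def)
next
  case False
  then have "{j. (j,l) \<in> insert (a,k) F} = {j. (j,l) \<in> F}" by auto
  then show ?thesis using False by (simp add: deg_v_def yc_def)
qed

lemma delta_ins: "delta m n s (insert (a,k) F) j = del j + lam * of_bool (j = a)"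
  unfolding delta_def defs_lam deg_u_ins del_def by (simp add: algebra_simps)

lemma eta_ins: "eta m n s t (insert (a,k) F) l = et l + lam * of_bool (l = k)"
  unfolding eta_def defs_lam deg_v_ins et_def by (simp add: algebra_simps)

lemma RR_ins: "RR m n s (insert (a,k) F) h p = RR m n s F h p + ((del a + lam) ^ h * (xr a + 1) ^ p - del a ^ h * xr a ^ p)"
proof -
  have "RR m n s (insert (a,k) F) h p = (\<Sum>j<m. del j ^ h * xr j ^ p + (if j = a then (del a + lam) ^ h * (xr a + 1) ^ p - del a ^ h * xr a ^ p else 0))"
    unfolding RR_def delta_ins deg_u_ins by (rule sum.cong) auto
  also have "\<dots> = RR m n s F h p + ((del a + lam) ^ h * (xr a + 1) ^ p - del a ^ h * xr a ^ p)"
    unfolding RR_def delta_F deg_u_F sum.distrib using a by simp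
  finally show ?thesis .
qed

lemma CC_ins: "CC m n s t (insert (a,k) F) h p = CC m n s t F h p + ((et k + lam) ^ h * (yc k + 1) ^ p - et k ^ h * yc k ^ p)"
proof -
  have "CC m n s t (insert (a,k) F) h p = (\<Sum>j<n. et j ^ h * yc j ^ p + (if j = k then (et k + lam) ^ h * (yc k + 1) ^ p - et k ^ h * yc k ^ p else 0))"
    unfolding CC_def eta_ins deg_v_ins by (rule sum.cong) auto
  also have "\<dots> = CC m n s t F h p + ((et k + lam) ^ h * (yc k + 1) ^ p - et k ^ h * yc k ^ p)"
    unfolding CC_def eta_F deg_v_F sum.distrib using k by simp
  finally show ?thesis .
qed

lemma XX_ins: "XX (insert (a,k) F) = XX F + 1" using finite_F e by (simp add: XX_def)

text \<open>Old edges in row a gain lam et, those in column k gain lam del; none gains both, because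
  (a,k) is not in \<open>F\<close>. The new edge contributes the product of the two shifted
  deviations.\<close>

lemma YY_ins: "YY m n s t (insert (a,k) F) = YY m n s t F + (lam * (SR a + SC k) + (del a + lam) * (et k + lam))"
proof -
  have "YY m n s t (insert (a,k) F) = (del a + lam) * (et k + lam)
      + (\<Sum>(j,l)\<in>F. (del j + lam * of_bool (j = a)) * (et l + lam * of_bool (l = k)))"
    unfolding YY_def delta_ins eta_ins using finite_F e by simp
  also have "(\<Sum>(j,l)\<in>F. (del j + lam * of_bool (j = a)) * (et l + lam * of_bool (l = k)))
     = (\<Sum>(j,l)\<in>F. del j * et l + lam * (of_bool (j = a) * et l) + lam * (of_bool (l = k) * del j))"
    by (rule sum.cong) (use e in \<open>auto simp: algebra_simps\<close>)
  also have "\<dots> = (\<Sum>(j,l)\<in>F. del j * et l) + lam * (\<Sum>(j,l)\<in>F. of_bool (j = a) * et l) + lam * (\<Sum>(j,l)\<in>F. of_bool (l = k) * del j)"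
    by (simp add: sum.distrib sum_distrib_left case_prod_beta)
  also have "(\<Sum>(j,l)\<in>F. of_bool (j = a) * et l) = SR a"
  proof -
    have "(\<Sum>(j,l)\<in>F. of_bool (j = a) * et l) = (\<Sum>j<m. if j = a then \<Sum>l<n. oF a l * et l else 0)"
      unfolding sum_F by (rule sum.cong) auto
    then show ?thesis using a by (simp add: SR_def)
  qed
  also have "(\<Sum>(j,l)\<in>F. of_bool (l = k) * del j) = SC k"
  proof -
    have "(\<Sum>(j,l)\<in>F. of_bool (l = k) * del j) = (\<Sum>j<m. \<Sum>l<n. if l = k then oF j k * del j else 0)"
      unfolding sum_F by (intro sum.cong) auto
    then show ?thesis using k by (simp add: SC_def)
  qed
  finally show ?thesis unfolding YY_def delta_F eta_F by (simp add: algebra_simps)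
qed

text \<open>Up to the last bracket this is the Taylor polynomial - u - u^2 / 2 of ln (1 - u) at u =
  (Pst a k - lam) / (1 - lam), where the square keeps only the first-order part of
  \<open>Pst a k - lam\<close>.\<close>

lemma miss_main_ins:
  "miss_main m n s t (insert (a,k) F) - miss_main m n s t F
   = - (Pst a k - lam) / (1 - lam) - (del a / n + et k / m)\<^sup>2 / (2 * (1 - lam)\<^sup>2)
     + ((lam * (1 - 2 * lam) * (3 * xr a + 1) / 6 - (1 - 2 * lam) * (del a + 2 * lam * xr a + lam) / 2 - (2 * del a * lam + lam\<^sup>2 * xr a + lam\<^sup>2) / 2)
        / ((1 - lam)\<^sup>2 * (real n)\<^sup>2)
      + (lam * (1 - 2 * lam) * (3 * yc k + 1) / 6 - (1 - 2 * lam) * (et k + 2 * lam * yc k + lam) / 2 - (2 * et k * lam + lam\<^sup>2 * yc k + lam\<^sup>2) / 2)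
        / ((1 - lam)\<^sup>2 * (real m)\<^sup>2)
      + (lam / 2 - del a - et k - lam) / ((1 - lam) * (real m * real n)))"
proof -
  let ?N = "real n" and ?M = "real m" and ?l = lam
  have nz: "lam \<noteq> 1" "lam \<noteq> 0" "?N \<noteq> 0" "?M \<noteq> 0" using lam_pos lam1 n_pos m_pos by auto
  note row = increment_row[OF nz(1,3), of "del a" "xr a"]
  note col = increment_row[OF nz(1,4), of "et k" "yc k"]
  note cross = increment_cross[OF nz, of "XX F" "SR a + SC k" "del a" "et k"]
  have P: "Pst a k - lam = (del a / ?N + del a * xr a / ?N\<^sup>2) + (et k / ?M + et k * yc k / ?M\<^sup>2)
     + (- lam * XX F / (?M * ?N) + (SR a + SC k) / (?M * ?N) + (1 - 2 * lam) * del a * et k / (lam * (1 - lam) * ?M * ?N))"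
    unfolding Pst_def XX_def by simp
  have sq: "(del a / ?N + et k / ?M)\<^sup>2 = (del a)\<^sup>2 / ?N\<^sup>2 + (et k)\<^sup>2 / ?M\<^sup>2 + 2 * (del a / ?N) * (et k / ?M)"
    by (simp add: power2_sum power_divide)
  have alg: "- (A + B + C) / c - (x + y + z) / d = (- A / c - x / d) + (- B / c - y / d) + (- C / c - z / d)" for A B C c d x y z :: real
    by (simp add: add_divide_distrib diff_divide_distrib)
  have "miss_main m n s t (insert (a,k) F) - miss_main m n s t F =
     (?l / (2 * (1 - ?l)) * (1 / ?N) - 1 / (1 - ?l) * (((del a + ?l) * (xr a + 1) - del a * xr a) / ?N)
      + ?l / (2 * (1 - ?l)) * (((xr a + 1)\<^sup>2 - (xr a)\<^sup>2) / ?N)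
      + ?l * (1 - 2 * ?l) / (6 * (1 - ?l)\<^sup>2) * (((xr a + 1) ^ 3 - xr a ^ 3) / ?N\<^sup>2)
      - (1 - 2 * ?l) / (2 * (1 - ?l)\<^sup>2) * (((del a + ?l) * (xr a + 1)\<^sup>2 - del a * (xr a)\<^sup>2) / ?N\<^sup>2)
      - 1 / (2 * (1 - ?l)\<^sup>2) * (((del a + ?l)\<^sup>2 * (xr a + 1) - (del a)\<^sup>2 * xr a) / ?N\<^sup>2))
   + (?l / (2 * (1 - ?l)) * (1 / ?M) - 1 / (1 - ?l) * (((et k + ?l) * (yc k + 1) - et k * yc k) / ?M)
      + ?l / (2 * (1 - ?l)) * (((yc k + 1)\<^sup>2 - (yc k)\<^sup>2) / ?M)
      + ?l * (1 - 2 * ?l) / (6 * (1 - ?l)\<^sup>2) * (((yc k + 1) ^ 3 - yc k ^ 3) / ?M\<^sup>2)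
      - (1 - 2 * ?l) / (2 * (1 - ?l)\<^sup>2) * (((et k + ?l) * (yc k + 1)\<^sup>2 - et k * (yc k)\<^sup>2) / ?M\<^sup>2)
      - 1 / (2 * (1 - ?l)\<^sup>2) * (((et k + ?l)\<^sup>2 * (yc k + 1) - (et k)\<^sup>2 * yc k) / ?M\<^sup>2))
   + (?l * ((XX F + 1)\<^sup>2 - (XX F)\<^sup>2) / (2 * (1 - ?l) * ?M * ?N) - (?l * (SR a + SC k) + (del a + ?l) * (et k + ?l)) / (?l * (1 - ?l) * ?M * ?N))"
    unfolding miss_main_def Let_def defs_lam RR_ins CC_ins XX_ins YY_ins power_0 power_one_right mult_1_left
    by (rule increment_split)
  then show ?thesis unfolding row col cross P sq alg by simp
qed

lemma inv_lam: "0 < 1 / (1 - lam)" "1 / (1 - lam) \<le> L"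
proof -
  show "0 < 1 / (1 - lam)" using lam1 by simp
  have "1 / (1 - lam) \<le> 1 / (1 / L)" using lam_le L_pos by (intro frac_le) auto
  then show "1 / (1 - lam) \<le> L" by simp
qed

lemma inv_sq: "\<bar>1 / (1 - lam)\<^sup>2\<bar> \<le> L\<^sup>2"
proof -
  have "(1 / (1 - lam))\<^sup>2 \<le> L\<^sup>2" using inv_lam by (intro power_mono) auto
  then show ?thesis by (simp add: power_divide)
qed

lemma Pst_second_order: "\<bar>Pst a k - lam - (del a / n + et k / m)\<bar> \<le> L ^ 6 / q\<^sup>2"
proof -
  let ?N = "real n" and ?M = "real m"
  have d: "\<bar>del a\<bar> \<le> 2 * L * q" "\<bar>et k\<bar> \<le> 2 * L * q" "\<bar>xr a\<bar> \<le> L * q" "\<bar>yc k\<bar> \<le> L * q"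
    using del_bound[OF a] et_bound[OF k] xr_bounds[of a] yc_bounds[of k] a k by auto
  have Lq: "0 < L * q" using L_pos q_pos by simp
  have b1: "\<bar>del a * xr a / ?N\<^sup>2\<bar> \<le> 2 * L\<^sup>2 / ?N"
  proof -
    have "\<bar>del a * xr a\<bar> \<le> (2 * L * q) * (L * q)" unfolding abs_mult using d Lq by (intro mult_mono) auto
    also have "\<dots> = 2 * L\<^sup>2 * ?N" using qq by (simp add: power2_eq_square algebra_simps)
    finally have "\<bar>del a * xr a\<bar> / ?N\<^sup>2 \<le> 2 * L\<^sup>2 * ?N / ?N\<^sup>2" by (intro divide_right_mono) auto
    then show ?thesis using n_pos by (simp add: abs_divide power2_eq_square)
  qed
  have b2: "\<bar>et k * yc k / ?M\<^sup>2\<bar> \<le> 2 * L ^ 4 / ?N"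
  proof -
    have "\<bar>et k / ?M\<bar> * \<bar>yc k / ?M\<bar> \<le> (L * (2 * L) / q) * (L * L / q)"
      using div_m_le[OF d(2)] div_m_le[OF d(4)] L_pos q_pos by (intro mult_mono) auto
    also have "\<dots> = 2 * L ^ 4 / ?N" by (simp add: qq[symmetric] power_numeral_reduce algebra_simps)
    finally show ?thesis by (simp add: abs_mult power2_eq_square)
  qed
  have mn: "\<bar>x / (?M * ?N)\<bar> \<le> L * c / ?N" if "\<bar>x\<bar> \<le> c * ?N" for x c
  proof -
    have "\<bar>x / ?N\<bar> \<le> c" using that n_pos by (simp add: abs_divide divide_le_eq)
    then have "\<bar>x / ?N\<bar> / ?M \<le> c / ?M" by (intro divide_right_mono) auto
    also have "\<dots> \<le> L * c / ?N" by (rule per_m) (use \<open>\<bar>x / ?N\<bar> \<le> c\<close> in linarith)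
    finally show ?thesis by (simp add: abs_divide abs_mult mult.commute)
  qed
  have b3: "\<bar>- (lam * real (card F)) / (?M * ?N)\<bar> \<le> L * L / ?N"
    by (rule mn) (use lam_mult_le[of "real (card F)"] F_card in auto)
  have b4: "\<bar>(SR a + SC k) / (?M * ?N)\<bar> \<le> L * (4 * L\<^sup>2) / ?N"
    by (rule mn) (use SR_bound(2)[OF a] SC_bound[OF k] in linarith)
  have b5: "\<bar>(1 - 2 * lam) * del a * et k / (gam * ?M * ?N)\<bar> \<le> L * (4 * L ^ 4) / ?N"
  proof -
    have "\<bar>1 / gam\<bar> \<le> L\<^sup>2"
    proof -
      have "1 / gam \<le> 1 / (1 / L\<^sup>2)" using gam_ge gam_pos L_pos by (intro frac_le) auto
      then show ?thesis using gam_pos by simp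
    qed
    moreover have "\<bar>1 - 2 * lam\<bar> \<le> 1" using lam_pos lam1 by auto
    moreover have "\<bar>del a * et k\<bar> \<le> (2 * L * q) * (2 * L * q)" unfolding abs_mult using d Lq by (intro mult_mono) auto
    ultimately have "\<bar>1 / gam\<bar> * (\<bar>1 - 2 * lam\<bar> * \<bar>del a * et k\<bar>) \<le> L\<^sup>2 * (1 * ((2 * L * q) * (2 * L * q)))"
      using L_pos q_pos by (intro mult_mono) auto
    also have "\<dots> = 4 * L ^ 4 * ?N" using qq by (simp add: power_numeral_reduce algebra_simps)
    finally have "\<bar>1 / gam * ((1 - 2 * lam) * (del a * et k))\<bar> \<le> 4 * L ^ 4 * ?N" unfolding abs_mult .
    from mn[OF this] show ?thesis by (simp add: mult.assoc mult.left_commute)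
  qed
  have eq: "Pst a k - lam - (del a / n + et k / m) = del a * xr a / ?N\<^sup>2 + et k * yc k / ?M\<^sup>2 + - (lam * real (card F)) / (?M * ?N)
     + (SR a + SC k) / (?M * ?N) + (1 - 2 * lam) * del a * et k / (gam * ?M * ?N)"
    unfolding Pst_def by simp
  have "\<bar>Pst a k - lam - (del a / n + et k / m)\<bar> \<le> 2 * L\<^sup>2 / ?N + 2 * L ^ 4 / ?N + L * L / ?N + L * (4 * L\<^sup>2) / ?N + L * (4 * L ^ 4) / ?N"
    unfolding eq by (rule abs_sum5[OF b1 b2 b3 b4 b5])
  also have "\<dots> = (3 * L\<^sup>2 + 2 * L ^ 4 + 4 * L ^ 3 + 4 * L ^ 5) / ?N"
    by (simp add: add_divide_distrib power_numeral_reduce mult.left_commute)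
  also have "\<dots> \<le> L ^ 6 / ?N"
    using L_absorb[of 2 5 3] L_absorb[of 4 5 2] L_absorb[of 3 5 4] L_absorb[of 5 6 7] by (intro divide_right_mono) auto
  finally show ?thesis unfolding q2 .
qed

lemma increment_residual:
  "\<bar>(lam * (1 - 2 * lam) * (3 * xr a + 1) / 6 - (1 - 2 * lam) * (del a + 2 * lam * xr a + lam) / 2 - (2 * del a * lam + lam\<^sup>2 * xr a + lam\<^sup>2) / 2)
        / ((1 - lam)\<^sup>2 * (real n)\<^sup>2)
      + (lam * (1 - 2 * lam) * (3 * yc k + 1) / 6 - (1 - 2 * lam) * (et k + 2 * lam * yc k + lam) / 2 - (2 * et k * lam + lam\<^sup>2 * yc k + lam\<^sup>2) / 2)
        / ((1 - lam)\<^sup>2 * (real m)\<^sup>2)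
      + (lam / 2 - del a - et k - lam) / ((1 - lam) * (real m * real n))\<bar> \<le> L ^ 6 / q ^ 3"
proof -
  let ?f = "\<lambda>d x. lam * (1 - 2 * lam) * (3 * x + 1) / 6 - (1 - 2 * lam) * (d + 2 * lam * x + lam) / 2 - (2 * d * lam + lam\<^sup>2 * x + lam\<^sup>2) / 2"
  have le1: "\<bar>c * y\<bar> \<le> \<bar>y\<bar>" if "\<bar>c\<bar> \<le> 1" for c y :: real using mult_right_mono[OF that, of "\<bar>y\<bar>"] by (simp add: abs_mult)
  have c1: "\<bar>lam * (1 - 2 * lam)\<bar> \<le> 1" "\<bar>1 - 2 * lam\<bar> \<le> 1" "\<bar>lam\<bar> \<le> 1" "\<bar>lam\<^sup>2\<bar> \<le> 1"
    using lam_pos lam1 by (auto simp: abs_mult power_le_one intro!: mult_le_one)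
  have fb: "\<bar>?f d x\<bar> \<le> 6 * (L * q)" if dx: "\<bar>d\<bar> \<le> 2 * (L * q)" "0 \<le> x" "x \<le> L * q" for d x
  proof -
    have Lq1: "L * q \<ge> 1000" using Lq_ge by simp
    have 1: "\<bar>lam * (1 - 2 * lam) * (3 * x + 1)\<bar> \<le> 3 * (L * q) + 1"
      using le1[OF c1(1), of "3 * x + 1"] dx by linarith
    have lx: "\<bar>lam * x\<bar> \<le> L * q" using le1[OF c1(3), of x] dx by linarith
    have "\<bar>d + 2 * lam * x + lam\<bar> \<le> 4 * (L * q) + 1" using lx dx c1(3) by linarith
    then have 2: "\<bar>(1 - 2 * lam) * (d + 2 * lam * x + lam)\<bar> \<le> 4 * (L * q) + 1"
      using le1[OF c1(2), of "d + 2 * lam * x + lam"] by linarith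
    have "\<bar>d * lam\<bar> \<le> 2 * (L * q)" using le1[OF c1(3), of d] dx by (simp add: mult.commute)
    moreover have "\<bar>lam\<^sup>2 * x\<bar> \<le> L * q" using le1[OF c1(4), of x] dx by linarith
    ultimately have 3: "\<bar>2 * d * lam + lam\<^sup>2 * x + lam\<^sup>2\<bar> \<le> 5 * (L * q) + 1" using c1(4) by linarith
    have "\<bar>A / 6 - B / 2 - C / 2\<bar> \<le> 6 * r" if "\<bar>A\<bar> \<le> 3 * r + 1" "\<bar>B\<bar> \<le> 4 * r + 1" "\<bar>C\<bar> \<le> 5 * r + 1" "r \<ge> 1000" for A B C r :: real
      using that by linarith
    from this[OF 1 2 3 Lq1] show ?thesis .
  qed
  have r0: "\<bar>?f (del a) (xr a)\<bar> \<le> 6 * (L * q)" "\<bar>?f (et k) (yc k)\<bar> \<le> 6 * (L * q)"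
    using fb[of "del a" "xr a"] fb[of "et k" "yc k"] del_bound[OF a] et_bound[OF k] xr_bounds[of a] yc_bounds[of k] a k by auto
  have qn: "q / (real n)\<^sup>2 = 1 / q ^ 3" using q_pos by (simp add: q2[symmetric] field_simps power_numeral_reduce)
  have r1: "\<bar>?f (del a) (xr a) / ((1 - lam)\<^sup>2 * (real n)\<^sup>2)\<bar> \<le> 6 * L ^ 3 / q ^ 3"
  proof -
    have "\<bar>?f (del a) (xr a) / ((1 - lam)\<^sup>2 * (real n)\<^sup>2)\<bar> = \<bar>1 / (1 - lam)\<^sup>2\<bar> * \<bar>?f (del a) (xr a)\<bar> / (real n)\<^sup>2"
      by (simp add: abs_divide abs_mult)
    also have "\<dots> \<le> L\<^sup>2 * (6 * (L * q)) / (real n)\<^sup>2"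
      using r0(1) inv_sq L_pos by (intro divide_right_mono mult_mono) auto
    also have "\<dots> = 6 * L ^ 3 * (q / (real n)\<^sup>2)" by (simp add: power_numeral_reduce algebra_simps)
    finally show ?thesis unfolding qn by simp
  qed
  have r2: "\<bar>?f (et k) (yc k) / ((1 - lam)\<^sup>2 * (real m)\<^sup>2)\<bar> \<le> 6 * L ^ 5 / q ^ 3"
  proof -
    have m2: "(real n)\<^sup>2 / L\<^sup>2 \<le> (real m)\<^sup>2"
    proof -
      have "(real n)\<^sup>2 \<le> (L * real m)\<^sup>2" using n_le by (intro power_mono) auto
      then show ?thesis using L_pos by (simp add: power_mult_distrib divide_le_eq mult.commute)
    qed
    have "\<bar>?f (et k) (yc k) / ((1 - lam)\<^sup>2 * (real m)\<^sup>2)\<bar> = \<bar>1 / (1 - lam)\<^sup>2\<bar> * \<bar>?f (et k) (yc k)\<bar> / (real m)\<^sup>2"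
      by (simp add: abs_divide abs_mult)
    also have "\<dots> \<le> L\<^sup>2 * (6 * (L * q)) / ((real n)\<^sup>2 / L\<^sup>2)"
      using r0(2) inv_sq L_pos q_pos n_pos m2 by (intro frac_le mult_mono) auto
    also have "\<dots> = 6 * L ^ 5 * (q / (real n)\<^sup>2)" using L_pos by (simp add: power_numeral_reduce algebra_simps)
    finally show ?thesis unfolding qn by simp
  qed
  have r3: "\<bar>(lam / 2 - del a - et k - lam) / ((1 - lam) * (real m * real n))\<bar> \<le> 5 * L ^ 3 / q ^ 3"
  proof -
    have mn: "(real n)\<^sup>2 / L \<le> real m * real n"
      using mult_right_mono[OF n_le, of "real n"] L_pos by (simp add: divide_le_eq power2_eq_square algebra_simps)
    have "\<bar>lam / 2 - del a - et k - lam\<bar> \<le> 5 * (L * q)"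
      using del_bound[OF a] et_bound[OF k] lam_pos lam1 Lq_ge by linarith
    moreover have "\<bar>(lam / 2 - del a - et k - lam) / ((1 - lam) * (real m * real n))\<bar> = \<bar>1 / (1 - lam)\<bar> * \<bar>lam / 2 - del a - et k - lam\<bar> / (real m * real n)"
      by (simp add: abs_divide abs_mult)
    ultimately have "\<bar>(lam / 2 - del a - et k - lam) / ((1 - lam) * (real m * real n))\<bar> \<le> L * (5 * (L * q)) / ((real n)\<^sup>2 / L)"
      using inv_lam L_pos q_pos n_pos mn by (simp only:) (intro frac_le mult_mono, auto)
    also have "\<dots> = 5 * L ^ 3 * (q / (real n)\<^sup>2)" using L_pos by (simp add: power_numeral_reduce algebra_simps)
    finally show ?thesis unfolding qn by simp
  qed
  have "\<bar>A + B + C\<bar> \<le> a + b + c" if "\<bar>A\<bar> \<le> a" "\<bar>B\<bar> \<le> b" "\<bar>C\<bar> \<le> c" for A B C a b c :: real using that by linarith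
  note tri = this[OF r1 r2 r3]
  have "6 * L ^ 3 / q ^ 3 + 6 * L ^ 5 / q ^ 3 + 5 * L ^ 3 / q ^ 3 = (11 * L ^ 3 + 6 * L ^ 5) / q ^ 3" by (simp add: add_divide_distrib)
  also have "\<dots> \<le> L ^ 6 / q ^ 3" using L_absorb[of 3 5 11] L_absorb[of 5 6 7] q_pos by (intro divide_right_mono) auto
  finally show ?thesis using tri by linarith
qed

text \<open>The ratio of the two counts is one minus the probability of (a,k). It is bounded away
  from 0, so the enlarged ensemble stays nonempty and the step can be repeated.\<close>

lemma forbid_step:
  assumes pos: "NN {} F > 0"
  shows "NN {} (insert (a,k) F) > 0"
    and "\<bar>ln (NN {} (insert (a,k) F)) - ln (NN {} F) - ln (1 - lam)
        - (miss_main m n s t (insert (a,k) F) - miss_main m n s t F)\<bar> \<le> L ^ 36 / q ^ 3"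
proof -
  define P where "P = NN {(a,k)} F / NN {} F"
  define z1 where "z1 = del a / n + et k / m"
  define c where "c = 1 / (1 - lam)"
  \<comment> \<open>Chosen so that 1 - P = (1 - lam) * (1 - u): the factor 1 - lam is split off
    exactly and u is only of order 1/q, so the logarithm is needed to second order.\<close>
  define u where "u = (P - lam) * c"
  have cb: "0 < c" "c \<le> L" "\<bar>c\<bar> \<le> L" "c\<^sup>2 \<le> L\<^sup>2" using inv_lam by (auto simp: c_def intro!: power_mono)
  have c1: "(1 - lam) * c = 1" using lam1 by (simp add: c_def)
  have e3: "\<bar>P - Pst a k\<bar> \<le> L ^ 34 / q ^ 3"
  proof -
    have "P - Pst a k = (NN {(a,k)} F - Pst a k * NN {} F) / NN {} F" unfolding P_def using pos by (simp add: diff_divide_distrib)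
    then have "\<bar>P - Pst a k\<bar> = \<bar>NN {(a,k)} F - Pst a k * NN {} F\<bar> / NN {} F" using pos by (simp add: abs_divide)
    then show ?thesis using edge_prob_level2[OF a k e] pos by (simp add: divide_le_eq)
  qed
  have z1b: "\<bar>z1\<bar> \<le> L ^ 3 / q" using p1_dev[OF a k] unfolding p1_def z1_def by (simp add: add.assoc)
  have w2: "\<bar>Pst a k - lam - z1\<bar> \<le> L ^ 6 / q\<^sup>2" unfolding z1_def by (rule Pst_second_order)
  have s1: "L ^ 34 / q ^ 3 \<le> L ^ 6 / q\<^sup>2"
  proof -
    have "L ^ 34 = L ^ 28 * L ^ 6" by (simp flip: power_add)
    also have "\<dots> \<le> q * L ^ 6" using L_le_q[of 28] L_pos by (intro mult_right_mono) auto
    finally have "L ^ 34 / q ^ 3 \<le> q * L ^ 6 / q ^ 3" using q_pos by (intro divide_right_mono) auto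
    also have "\<dots> = L ^ 6 / q\<^sup>2" using q_pos by (simp add: field_simps power_numeral_reduce)
    finally show ?thesis .
  qed
  have s2: "L ^ 6 / q\<^sup>2 \<le> L ^ 3 / q"
  proof -
    have "L ^ 6 = L ^ 3 * L ^ 3" by (simp flip: power_add)
    also have "\<dots> \<le> q * L ^ 3" using L_le_q[of 3] L_pos by (intro mult_right_mono) auto
    finally have "L ^ 6 / q\<^sup>2 \<le> q * L ^ 3 / q\<^sup>2" using q_pos by (intro divide_right_mono) auto
    also have "\<dots> = L ^ 3 / q" using q_pos by (simp add: power2_eq_square)
    finally show ?thesis .
  qed
  have d1: "\<bar>(P - lam) - z1\<bar> \<le> 2 * (L ^ 6 / q\<^sup>2)" using e3 w2 s1 by linarith
  have d2: "\<bar>P - lam\<bar> \<le> 3 * (L ^ 3 / q)" using d1 s2 z1b by linarith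
  have ub: "\<bar>u\<bar> \<le> L ^ 5 / q"
  proof -
    have "\<bar>u\<bar> \<le> 3 * (L ^ 3 / q) * L" unfolding u_def abs_mult using d2 cb by (intro mult_mono) auto
    also have "\<dots> = 3 * L ^ 4 / q" by (simp add: power_numeral_reduce)
    also have "\<dots> \<le> L ^ 5 / q" using L_absorb[of 4 5 3] q_pos by (intro divide_right_mono) auto
    finally show ?thesis .
  qed
  have uh: "\<bar>u\<bar> \<le> 1 / 2"
  proof -
    have "2 * L ^ 5 \<le> q" using L_absorb[of 5 6 2] L_le_q[of 6] by linarith
    then have "L ^ 5 / q \<le> 1 / 2" using q_pos by (simp add: field_simps)
    then show ?thesis using ub by linarith
  qed
  have NNe: "NN {} (insert (a,k) F) = NN {} F * ((1 - lam) * (1 - u))"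
  proof -
    have "(1 - lam) * (1 - u) = (1 - lam) - (P - lam) * ((1 - lam) * c)" unfolding u_def by (simp add: algebra_simps)
    then have "(1 - lam) * (1 - u) = 1 - P" unfolding c1 by simp
    moreover have "NN {} (insert (a,k) F) = NN {} F - NN {(a,k)} F" using NN_split[of "{}" F "(a,k)"] by simp
    moreover have "NN {} F * (1 - P) = NN {} F - NN {(a,k)} F" unfolding P_def using pos by (simp add: field_simps)
    ultimately show ?thesis by simp
  qed
  have u1: "1 - u > 0" using uh by linarith
  show "NN {} (insert (a,k) F) > 0" unfolding NNe using pos u1 lam1 by simp
  have ln1: "ln (NN {} (insert (a,k) F)) - ln (NN {} F) - ln (1 - lam) = ln (1 - u)"
    unfolding NNe using pos u1 lam1 by (simp add: ln_mult)
  define \<tau> where "\<tau> = ln (1 - u) + u + u\<^sup>2 / 2"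
  have t1: "\<bar>\<tau>\<bar> \<le> 2 * L ^ 15 / q ^ 3"
  proof -
    have "\<bar>\<tau>\<bar> \<le> 2 * \<bar>u\<bar> ^ 3" unfolding \<tau>_def by (rule ln_one_minus_bound[OF uh])
    also have "\<dots> \<le> 2 * (L ^ 5 / q) ^ 3" using ub by (intro mult_left_mono power_mono) auto
    also have "\<dots> = 2 * L ^ 15 / q ^ 3" by (simp add: power_divide flip: power_mult)
    finally show ?thesis .
  qed
  define \<rho> where "\<rho> = (lam * (1 - 2 * lam) * (3 * xr a + 1) / 6 - (1 - 2 * lam) * (del a + 2 * lam * xr a + lam) / 2 - (2 * del a * lam + lam\<^sup>2 * xr a + lam\<^sup>2) / 2)
        / ((1 - lam)\<^sup>2 * (real n)\<^sup>2)
      + (lam * (1 - 2 * lam) * (3 * yc k + 1) / 6 - (1 - 2 * lam) * (et k + 2 * lam * yc k + lam) / 2 - (2 * et k * lam + lam\<^sup>2 * yc k + lam\<^sup>2) / 2)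
        / ((1 - lam)\<^sup>2 * (real m)\<^sup>2)
      + (lam / 2 - del a - et k - lam) / ((1 - lam) * (real m * real n))"
  have t2: "\<bar>\<rho>\<bar> \<le> L ^ 6 / q ^ 3" unfolding \<rho>_def by (rule increment_residual)
  have mm: "miss_main m n s t (insert (a,k) F) - miss_main m n s t F = - ((Pst a k - lam) * c) - z1\<^sup>2 * c\<^sup>2 / 2 + \<rho>"
    unfolding miss_main_ins \<rho>_def c_def z1_def by (simp add: power_divide diff_divide_distrib mult.commute)
  have t3: "\<bar>(P - Pst a k) * c\<bar> \<le> L ^ 35 / q ^ 3"
  proof -
    have "\<bar>(P - Pst a k) * c\<bar> \<le> (L ^ 34 / q ^ 3) * L" unfolding abs_mult using e3 cb by (intro mult_mono) auto
    then show ?thesis by (simp add: power_numeral_reduce)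
  qed
  have t4: "\<bar>((P - lam)\<^sup>2 - z1\<^sup>2) * c\<^sup>2 / 2\<bar> \<le> 4 * L ^ 11 / q ^ 3"
  proof -
    have "(P - lam)\<^sup>2 - z1\<^sup>2 = ((P - lam) - z1) * ((P - lam) + z1)" by (simp add: power2_eq_square algebra_simps)
    moreover have "\<bar>(P - lam) + z1\<bar> \<le> 4 * (L ^ 3 / q)" using d2 z1b by linarith
    ultimately have "\<bar>(P - lam)\<^sup>2 - z1\<^sup>2\<bar> \<le> (2 * (L ^ 6 / q\<^sup>2)) * (4 * (L ^ 3 / q))"
      using d1 L_pos by (simp only: abs_mult) (intro mult_mono, auto)
    then have "\<bar>(P - lam)\<^sup>2 - z1\<^sup>2\<bar> * c\<^sup>2 \<le> ((2 * (L ^ 6 / q\<^sup>2)) * (4 * (L ^ 3 / q))) * L\<^sup>2"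
      using cb L_pos q_pos by (intro mult_mono) auto
    also have "\<dots> = 8 * L ^ 11 / q ^ 3" by (simp add: power_numeral_reduce)
    finally show ?thesis by (simp add: abs_mult)
  qed
  \<comment> \<open>Four errors of order 1/q^3: P against \<open>Pst\<close>, the square of P - lam
    against that of its first-order part, the remainder of the logarithm, and the residue of the
    increment.\<close>
  have eqn: "ln (1 - u) - (- ((Pst a k - lam) * c) - z1\<^sup>2 * c\<^sup>2 / 2 + \<rho>) = - ((P - Pst a k) * c) - ((P - lam)\<^sup>2 - z1\<^sup>2) * c\<^sup>2 / 2 + \<tau> - \<rho>"
    unfolding \<tau>_def u_def by (simp add: field_simps power2_eq_square)
  have "\<bar>- A - B + C - D\<bar> \<le> x + y + z + w" if "\<bar>A\<bar> \<le> x" "\<bar>B\<bar> \<le> y" "\<bar>C\<bar> \<le> z" "\<bar>D\<bar> \<le> w" for A B C D x y z w :: real using that by linarith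
  note tri = this[OF t3 t4 t1 t2]
  have "L ^ 35 / q ^ 3 + 4 * L ^ 11 / q ^ 3 + 2 * L ^ 15 / q ^ 3 + L ^ 6 / q ^ 3 = (L ^ 35 + 4 * L ^ 11 + 2 * L ^ 15 + L ^ 6) / q ^ 3"
    by (simp add: add_divide_distrib)
  also have "\<dots> \<le> L ^ 36 / q ^ 3"
    using L_absorb[of 11 35 4] L_absorb[of 15 35 2] L_mono[of 6 35] L_absorb[of 35 36 4] q_pos by (intro divide_right_mono) auto
  finally show "\<bar>ln (NN {} (insert (a,k) F)) - ln (NN {} F) - ln (1 - lam)
        - (miss_main m n s t (insert (a,k) F) - miss_main m n s t F)\<bar> \<le> L ^ 36 / q ^ 3"
    unfolding ln1 mm eqn using tri by linarith
qed

end

end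


section \<open>Telescoping over the edges of the forbidden graph\<close>

context dense_bip begin

text \<open>The sparsity conditions pass to subsets, so every intermediate set is covered, in
  whatever order the edges are added.\<close>

lemma forb_bip_subset:
  assumes H: "forb_bip m n s t lam L q H" and F: "F \<subseteq> H"
  shows "forb_bip m n s t lam L q F"
proof -
  interpret H: forb_bip m n s t lam L q H by (rule H)
  have box: "F \<subseteq> {..<m} \<times> {..<n}" using F H.F_box by blast
  show ?thesis
  proof
    show "F \<subseteq> {..<m} \<times> {..<n}" by (rule box)
    show "real (card {k. (i,k) \<in> F}) \<le> L * q" if "i < m" for i
    proof -
      have "card {k. (i,k) \<in> F} \<le> card {k. (i,k) \<in> H}"
        by (rule card_mono[OF finite_row[OF H.F_box]]) (use F in auto)
      then show ?thesis using H.F_row[OF that] by linarith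
    qed
    show "real (card {i. (i,k) \<in> F}) \<le> L * q" if "k < n" for k
    proof -
      have "card {i. (i,k) \<in> F} \<le> card {i. (i,k) \<in> H}"
        by (rule card_mono[OF finite_col[OF H.F_box]]) (use F in auto)
      then show ?thesis using H.F_col[OF that] by linarith
    qed
    have "card F \<le> card H" by (rule card_mono[OF H.finite_F F])
    then show "real (card F) \<le> L * real n" using H.F_card by linarith
  qed
qed

lemma miss_main_empty: "miss_main m n s t {} = 0"
  unfolding miss_main_def Let_def by (simp add: RR_def CC_def YY_def XX_def deg_u_def deg_v_def)

text \<open>At most L n steps with error L^36 / q^3 each, and n = q^2, give L^37 / q. Positivity
  belongs to the induction because each step divides by the previous count and takes its
  logarithm.\<close>

lemma NN_forbidden:
  assumes H: "forb_bip m n s t lam L q H" and pos: "NN {} {} > 0"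
  shows "NN {} H > 0"
    and "\<bar>ln (NN {} H) - ln (NN {} {}) - real (card H) * ln (1 - lam) - miss_main m n s t H\<bar> \<le> L ^ 37 / q"
proof -
  interpret H: forb_bip m n s t lam L q H by (rule H)
  let ?P = "\<lambda>F. NN {} F > 0 \<and> \<bar>ln (NN {} F) - ln (NN {} {}) - real (card F) * ln (1 - lam) - miss_main m n s t F\<bar>
       \<le> real (card F) * (L ^ 36 / q ^ 3)"
  have "?P H" using H.finite_F subset_refl
  proof (induction H rule: finite_subset_induct')
    case empty
    show ?case using pos miss_main_empty by simp
  next
    case (insert e F)
    obtain a k where e: "e = (a,k)" "a < m" "k < n" using insert H.F_box by (cases e) auto
    have fb: "forb_bip m n s t lam L q F" by (rule forb_bip_subset[OF H]) (use insert in auto)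
    have "(a,k) \<notin> F" using insert e by simp
    note st = forb_bip.forbid_step[OF fb e(2,3) this]
    have "NN {} F > 0" using insert by simp
    note st = st[OF this]
    have "finite F" using insert by (auto intro: finite_subset[OF _ H.finite_F])
    then have c: "real (card (insert (a,k) F)) = real (card F) + 1" using insert e by simp
    have "\<bar>ln (NN {} (insert e F)) - ln (NN {} {}) - real (card (insert e F)) * ln (1 - lam) - miss_main m n s t (insert e F)\<bar>
       \<le> real (card F) * (L ^ 36 / q ^ 3) + L ^ 36 / q ^ 3"
    proof -
      have tri: "\<bar>Y - Z - (c + 1) * l - B\<bar> \<le> r + r'" if "\<bar>X - Z - c * l - A\<bar> \<le> r" "\<bar>Y - X - l - (B - A)\<bar> \<le> r'" for X Y Z c l A B r r' :: real
        using that unfolding ring_distribs by linarith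
      show ?thesis unfolding e(1) c by (rule tri[OF _ st(2)]) (use insert in simp)
    qed
    then show ?case using st(1) unfolding e(1) c distrib_right mult_1 by simp
  qed
  then show "NN {} H > 0" by simp
  have "real (card H) * (L ^ 36 / q ^ 3) \<le> (L * real n) * (L ^ 36 / q ^ 3)"
    using H.F_card L_pos q_pos by (intro mult_right_mono) auto
  also have "\<dots> = L ^ 37 / q" using q_pos by (simp add: q2[symmetric] field_simps power_numeral_reduce)
  finally show "\<bar>ln (NN {} H) - ln (NN {} {}) - real (card H) * ln (1 - lam) - miss_main m n s t H\<bar> \<le> L ^ 37 / q"
    using \<open>?P H\<close> by linarith
qed

lemma prob_miss:
  assumes H: "forb_bip m n s t lam L q H" and ne: "bip_graphs m n s t \<noteq> {}"
  shows "\<exists>E. \<bar>E\<bar> \<le> L ^ 37 / q \<and>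
     prob_B m n s t (\<lambda>G. G \<inter> H = {}) = (1 - lam) ^ card H * exp (miss_main m n s t H + E)"
proof -
  have e0: "ens {} {} = bip_graphs m n s t" "ens {} H = {G \<in> bip_graphs m n s t. G \<inter> H = {}}" by (auto simp: ens_def)
  have pos: "NN {} {} > 0" using ne finite_bip_graphs by (simp add: NN_def e0 card_gt_0_iff)
  note N = NN_forbidden[OF H pos]
  define E where "E = ln (NN {} H) - ln (NN {} {}) - real (card H) * ln (1 - lam) - miss_main m n s t H"
  have "prob_B m n s t (\<lambda>G. G \<inter> H = {}) = NN {} H / NN {} {}" by (simp add: prob_B_def NN_def e0)
  also have "\<dots> = exp (ln (NN {} H) - ln (NN {} {}))" using N(1) pos by (simp add: exp_diff)
  also have "ln (NN {} H) - ln (NN {} {}) = real (card H) * ln (1 - lam) + (miss_main m n s t H + E)" unfolding E_def by simp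
  also have "exp \<dots> = (1 - lam) ^ card H * exp (miss_main m n s t H + E)"
    using lam1 by (simp add: exp_add exp_of_nat_mult)
  finally show ?thesis using N(2) unfolding E_def by blast
qed

end

section \<open>Containing a graph via complements\<close>

definition compl_graph :: "nat \<Rightarrow> nat \<Rightarrow> (nat \<times> nat) set \<Rightarrow> (nat \<times> nat) set" where
  "compl_graph m n G = {..<m} \<times> {..<n} - G"

lemma deg_compl:
  assumes "G \<subseteq> {..<m} \<times> {..<n}"
  shows "j < m \<Longrightarrow> deg_u (compl_graph m n G) j = n - deg_u G j" "k < n \<Longrightarrow> deg_v (compl_graph m n G) k = m - deg_v G k"
proof -
  have "{k. (j,k) \<in> G} \<subseteq> {..<n}" "{j. (j,k) \<in> G} \<subseteq> {..<m}" for j k using assms by auto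
  note sub = this
  show "deg_u (compl_graph m n G) j = n - deg_u G j" if "j < m"
  proof -
    have "{k. (j,k) \<in> compl_graph m n G} = {..<n} - {k. (j,k) \<in> G}" using that by (auto simp: compl_graph_def)
    then show ?thesis using sub(1)[of j] by (simp add: deg_u_def card_Diff_subset finite_subset[OF sub(1)])
  qed
  show "deg_v (compl_graph m n G) k = m - deg_v G k" if "k < n"
  proof -
    have "{j. (j,k) \<in> compl_graph m n G} = {..<m} - {j. (j,k) \<in> G}" using that by (auto simp: compl_graph_def)
    then show ?thesis using sub(2)[of k] by (simp add: deg_v_def card_Diff_subset finite_subset[OF sub(2)])
  qed
qed

lemma deg_le:
  assumes "G \<in> bip_graphs m n s t"
  shows "j < m \<Longrightarrow> s j \<le> n" "k < n \<Longrightarrow> t k \<le> m"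
proof -
  have box: "G \<subseteq> {..<m} \<times> {..<n}" by (rule bip_graphs_sub[OF assms])
  have "card {k. (j,k) \<in> G} \<le> card {..<n}" for j by (rule card_mono) (use box in auto)
  moreover have "card {j. (j,k) \<in> G} \<le> card {..<m}" for k by (rule card_mono) (use box in auto)
  moreover have "j < m \<Longrightarrow> s j = card {k. (j,k) \<in> G}" "k < n \<Longrightarrow> t k = card {j. (j,k) \<in> G}"
    using assms by (simp_all add: bip_graphs_def deg_u_def deg_v_def)
  ultimately show "j < m \<Longrightarrow> s j \<le> n" "k < n \<Longrightarrow> t k \<le> m" by simp_all
qed

lemma compl_bip_graphs:
  assumes "G \<in> bip_graphs m n s t"
  shows "compl_graph m n G \<in> bip_graphs m n (\<lambda>j. n - s j) (\<lambda>k. m - t k)"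
  using deg_compl[OF bip_graphs_sub[OF assms]] assms by (auto simp: bip_graphs_def compl_graph_def)

lemma compl_compl: "G \<subseteq> {..<m} \<times> {..<n} \<Longrightarrow> compl_graph m n (compl_graph m n G) = G"
  by (auto simp: compl_graph_def)

lemma prob_compl:
  assumes ne: "bip_graphs m n s t \<noteq> {}" and H: "H \<subseteq> {..<m} \<times> {..<n}"
  shows "prob_B m n s t (\<lambda>G. H \<subseteq> G) = prob_B m n (\<lambda>j. n - s j) (\<lambda>k. m - t k) (\<lambda>G. G \<inter> H = {})"
proof -
  obtain G0 where G0: "G0 \<in> bip_graphs m n s t" using ne by auto
  let ?c = "compl_graph m n" and ?B = "bip_graphs m n s t" and ?B' = "bip_graphs m n (\<lambda>j. n - s j) (\<lambda>k. m - t k)"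
  have inv_mem: "?c G \<in> ?B" if "G \<in> ?B'" for G
    using compl_bip_graphs[OF that] deg_le[OF G0] by (auto simp: bip_graphs_def)
  have cc: "?c (?c G) = G" if "G \<in> bip_graphs m n s' t'" for G s' t'
    by (rule compl_compl[OF bip_graphs_sub[OF that]])
  have bij: "bij_betw ?c {G \<in> ?B. P G} {G \<in> ?B'. P (?c G)}" for P
  proof (rule bij_betw_byWitness[where f' = ?c])
    show "\<forall>G\<in>{G \<in> ?B. P G}. ?c (?c G) = G" "\<forall>G\<in>{G \<in> ?B'. P (?c G)}. ?c (?c G) = G"
      by (rule ballI, elim CollectE conjE, erule cc)+
    show "?c ` {G \<in> ?B. P G} \<subseteq> {G \<in> ?B'. P (?c G)}"
    proof (rule image_subsetI)
      fix G assume "G \<in> {G \<in> ?B. P G}"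
      then have "G \<in> ?B" "P G" by auto
      then show "?c G \<in> {G \<in> ?B'. P (?c G)}" using compl_bip_graphs[of G] cc[of G s t] by simp
    qed
    show "?c ` {G \<in> ?B'. P (?c G)} \<subseteq> {G \<in> ?B. P G}" using inv_mem by auto
  qed
  have "(H \<subseteq> ?c G) = (G \<inter> H = {})" for G using H by (auto simp: compl_graph_def)
  then have "card {G \<in> ?B. H \<subseteq> G} = card {G \<in> ?B'. G \<inter> H = {}}"
    using bij_betw_same_card[OF bij[of "\<lambda>G. H \<subseteq> G"]] by simp
  moreover have "card ?B = card ?B'" using bij_betw_same_card[OF bij[of "\<lambda>G. True"]] by simp
  ultimately show ?thesis by (simp add: prob_B_def)
qed

text \<open>Under complementation the density becomes 1 - l and a deviation d of a row of degree x
  becomes x - d. With A, B, C, D, E standing for the combined sums with indices (1,1), (0,2), (0,3),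
  (1,2), (2,1), this sends A to B - A, D to C - D and E to C - 2 D + E.\<close>

lemma complement_coefficients:
  fixes l :: real
  assumes "l \<noteq> 0"
  shows "- (1 / l * (B - A)) + (1 - l) / (2 * l) * B + (1 - l) * (1 - 2 * (1 - l)) / (6 * l\<^sup>2) * C
      - (1 - 2 * (1 - l)) / (2 * l\<^sup>2) * (C - D) - 1 / (2 * l\<^sup>2) * (C - 2 * D + E)
    = 1 / l * A - 1 / (2 * l\<^sup>2) * E - (1 + l) / (2 * l) * B + (1 + 2 * l) / (2 * l\<^sup>2) * D - (1 + l) * (1 + 2 * l) / (6 * l\<^sup>2) * C"
  using assms by (simp add: field_simps power2_eq_square)

text \<open>A graph contains \<open>H\<close> exactly when its complement avoids it, so the second
  expansion is the first one for the complementary degrees, rewritten in the original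
  quantities.\<close>

lemma miss_main_compl:
  assumes G: "G \<in> bip_graphs m n s t" and mn: "m > 0" "n > 0" and l: "lam m n s \<noteq> 0"
    and H: "H \<subseteq> {..<m} \<times> {..<n}"
  shows "miss_main m n (\<lambda>j. n - s j) (\<lambda>k. m - t k) H = hit_main m n s t H"
proof -
  let ?s = "\<lambda>j. n - s j" and ?t = "\<lambda>k. m - t k"
  let ?x = "\<lambda>j. real (deg_u H j)" and ?y = "\<lambda>k. real (deg_v H k)"
  have sb: "sbar m ?s = real n - sbar m s"
  proof -
    have "(\<Sum>j<m. real (n - s j)) = (\<Sum>j<m. real n - real (s j))"
      by (rule sum.cong) (use deg_le(1)[OF G] in \<open>auto simp: of_nat_diff\<close>)
    then show ?thesis unfolding sbar_def using mn by (simp add: sum_subtractf diff_divide_distrib)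
  qed
  have tb: "tbar n ?t = real m - tbar n t"
  proof -
    have "(\<Sum>j<n. real (m - t j)) = (\<Sum>j<n. real m - real (t j))"
      by (rule sum.cong) (use deg_le(2)[OF G] in \<open>auto simp: of_nat_diff\<close>)
    then show ?thesis unfolding tbar_def using mn by (simp add: sum_subtractf diff_divide_distrib)
  qed
  have lb: "lam m n ?s = 1 - lam m n s" unfolding lam_def sb using mn by (simp add: diff_divide_distrib)
  have d: "delta m n ?s H j = ?x j - delta m n s H j" if "j < m" for j
    unfolding delta_def sb lb using deg_le(1)[OF G that] by (simp add: of_nat_diff algebra_simps)
  have e: "eta m n ?s ?t H k = ?y k - eta m n s t H k" if "k < n" for k
    unfolding eta_def tb lb using deg_le(2)[OF G that] by (simp add: of_nat_diff algebra_simps)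
  have R: "RR m n ?s H 1 1 = RR m n s H 0 2 - RR m n s H 1 1" "RR m n ?s H 0 2 = RR m n s H 0 2"
    "RR m n ?s H 0 3 = RR m n s H 0 3" "RR m n ?s H 1 2 = RR m n s H 0 3 - RR m n s H 1 2"
    "RR m n ?s H 2 1 = RR m n s H 0 3 - 2 * RR m n s H 1 2 + RR m n s H 2 1"
    unfolding RR_def sum_subtractf[symmetric] sum_distrib_left sum.distrib[symmetric]
    by (auto intro!: sum.cong simp: d algebra_simps power2_eq_square power3_eq_cube)
  have C: "CC m n ?s ?t H 1 1 = CC m n s t H 0 2 - CC m n s t H 1 1" "CC m n ?s ?t H 0 2 = CC m n s t H 0 2"
    "CC m n ?s ?t H 0 3 = CC m n s t H 0 3" "CC m n ?s ?t H 1 2 = CC m n s t H 0 3 - CC m n s t H 1 2"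
    "CC m n ?s ?t H 2 1 = CC m n s t H 0 3 - 2 * CC m n s t H 1 2 + CC m n s t H 2 1"
    unfolding CC_def sum_subtractf[symmetric] sum_distrib_left sum.distrib[symmetric]
    by (auto intro!: sum.cong simp: e algebra_simps power2_eq_square power3_eq_cube)
  have Y: "YY m n ?s ?t H = YY m n s t H - Y01 m n s H - Y10 m n s t H + Y11 H"
  proof -
    have "YY m n ?s ?t H = (\<Sum>(j,k)\<in>H. (?x j - delta m n s H j) * (?y k - eta m n s t H k))"
      unfolding YY_def by (rule sum.cong) (use H d e in auto)
    also have "\<dots> = YY m n s t H - Y01 m n s H - Y10 m n s t H + Y11 H"
      unfolding YY_def Y01_def Y10_def Y11_def sum_subtractf[symmetric] sum.distrib[symmetric]
      by (rule sum.cong) (auto simp: algebra_simps)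
    finally show ?thesis .
  qed
  let ?l = "lam m n s" and ?N = "real n" and ?M = "real m"
  let ?A = "RR m n s H 1 1 / ?N + CC m n s t H 1 1 / ?M" and ?B = "RR m n s H 0 2 / ?N + CC m n s t H 0 2 / ?M"
  let ?C = "RR m n s H 0 3 / ?N\<^sup>2 + CC m n s t H 0 3 / ?M\<^sup>2" and ?D = "RR m n s H 1 2 / ?N\<^sup>2 + CC m n s t H 1 2 / ?M\<^sup>2"
  let ?E = "RR m n s H 2 1 / ?N\<^sup>2 + CC m n s t H 2 1 / ?M\<^sup>2"
  have c1: "(RR m n s H 0 2 - RR m n s H 1 1) / ?N + (CC m n s t H 0 2 - CC m n s t H 1 1) / ?M = ?B - ?A"
    "(RR m n s H 0 3 - RR m n s H 1 2) / ?N\<^sup>2 + (CC m n s t H 0 3 - CC m n s t H 1 2) / ?M\<^sup>2 = ?C - ?D"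
    "(RR m n s H 0 3 - 2 * RR m n s H 1 2 + RR m n s H 2 1) / ?N\<^sup>2 + (CC m n s t H 0 3 - 2 * CC m n s t H 1 2 + CC m n s t H 2 1) / ?M\<^sup>2 = ?C - 2 * ?D + ?E"
    by (simp_all add: add_divide_distrib diff_divide_distrib)
  have l1: "1 - (1 - ?l) = ?l" by simp
  have l2: "(1 - ?l) * ?l * ?M * ?N = ?l * (1 - ?l) * ?M * ?N" by simp
  show ?thesis
    unfolding miss_main_def hit_main_def Let_def lb R C Y c1 l1 l2
    using complement_coefficients[OF l, of ?B ?A ?C ?D ?E] by linarith
qed

lemma dense_bip_compl:
  assumes D: "dense_bip m n s t l L q" and G: "G \<in> bip_graphs m n s t"
  shows "dense_bip m n (\<lambda>j. n - s j) (\<lambda>k. m - t k) (1 - l) L q"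
proof -
  interpret dense_bip m n s t l L q by (rule D)
  have s: "real (n - s j) = real n - real (s j)" if "j < m" for j using deg_le(1)[OF G that] by (simp add: of_nat_diff)
  have t: "real (m - t k) = real m - real (t k)" if "k < n" for k using deg_le(2)[OF G that] by (simp add: of_nat_diff)
  show ?thesis
  proof
    show "\<bar>real (n - s j) - (1 - l) * real n\<bar> \<le> L * q" if "j < m" for j
      using s_dev[OF that] s[OF that] by (simp add: algebra_simps abs_minus_commute)
    show "\<bar>real (m - t k) - (1 - l) * real m\<bar> \<le> L * q" if "k < n" for k
      using t_dev[OF that] t[OF that] by (simp add: algebra_simps abs_minus_commute)
    have "(\<Sum>j<m. real (n - s j)) = (\<Sum>j<m. real n - real (s j))" by (rule sum.cong) (use s in auto)
    then show "(\<Sum>j<m. real (n - s j)) = (1 - l) * real m * real n" using sum_s by (simp add: sum_subtractf algebra_simps)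
    have "(\<Sum>k<n. real (m - t k)) = (\<Sum>k<n. real m - real (t k))" by (rule sum.cong) (use t in auto)
    then show "(\<Sum>k<n. real (m - t k)) = (1 - l) * real m * real n" using sum_t by (simp add: sum_subtractf algebra_simps)
  qed (use q2 q_pos L_ge L_q lam_ge lam_le m_le n_le in auto)
qed

lemma prob_hit:
  assumes H: "forb_bip m n s t l L q H" and ne: "bip_graphs m n s t \<noteq> {}"
  shows "\<exists>E. \<bar>E\<bar> \<le> L ^ 37 / q \<and>
     prob_B m n s t (\<lambda>G. H \<subseteq> G) = l ^ card H * exp (hit_main m n s t H + E)"
proof -
  interpret forb_bip m n s t l L q H by (rule H)
  obtain G where G: "G \<in> bip_graphs m n s t" using ne by auto
  have D': "dense_bip m n (\<lambda>j. n - s j) (\<lambda>k. m - t k) (1 - l) L q"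
    by (rule dense_bip_compl[OF dense_bip_axioms G])
  then interpret c: dense_bip m n "\<lambda>j. n - s j" "\<lambda>k. m - t k" "1 - l" L q .
  have fb: "forb_bip m n (\<lambda>j. n - s j) (\<lambda>k. m - t k) (1 - l) L q H"
    by (rule forb_bip.intro[OF D']) (unfold_locales, use F_box F_row F_col F_card in auto)
  have ne': "bip_graphs m n (\<lambda>j. n - s j) (\<lambda>k. m - t k) \<noteq> {}" using compl_bip_graphs[OF G] by auto
  have mn: "m > 0" "n > 0" using m_pos n_pos by auto
  have "lam m n s \<noteq> 0" unfolding defs_lam(3) using lam_pos by simp
  then have mh: "miss_main m n (\<lambda>j. n - s j) (\<lambda>k. m - t k) H = hit_main m n s t H"
    by (rule miss_main_compl[OF G mn _ F_box])
  show ?thesis using c.prob_miss[OF fb ne'] unfolding mh prob_compl[OF ne F_box] by simp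
qed


section \<open>The asymptotic statement\<close>

text \<open>Since (1 - 2 l)^2 = 1 - 4 l (1 - l), the bound reads 1 \<le> 4 (1 + c) l (1 - l); both l
  and 1 - l exceed their product.\<close>

lemma dense_from_log_bound:
  fixes l r A c :: real
  assumes g: "l * (1 - l) / 2 > 0" and r: "r \<ge> 1" and le: "(1 - 2 * l)\<^sup>2 / (8 * (l * (1 - l) / 2)) * r \<le> c"
    and A: "4 * (1 + c) \<le> A"
  shows "1 / A \<le> l" "1 / A \<le> 1 - l"
proof -
  let ?g = "l * (1 - l)"
  have g0: "?g > 0" using g by simp
  have l: "0 < l" "l < 1" using g0 by (auto simp: zero_less_mult_iff)
  have n: "(1 - 2 * l)\<^sup>2 / (8 * (?g / 2)) \<ge> 0" using g0 by simp
  have "(1 - 2 * l)\<^sup>2 / (8 * (?g / 2)) * 1 \<le> (1 - 2 * l)\<^sup>2 / (8 * (?g / 2)) * r" using r n by (intro mult_left_mono)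
  then have "(1 - 2 * l)\<^sup>2 / (4 * ?g) \<le> c" using le by simp
  moreover have "(1 - 2 * l)\<^sup>2 = 1 - 4 * ?g" by (simp add: power2_eq_square algebra_simps)
  ultimately have "1 \<le> 4 * (1 + c) * ?g" using g0 l by (simp add: divide_le_eq) (simp add: algebra_simps)
  also have "\<dots> \<le> A * ?g" using A g0 by (intro mult_right_mono) auto
  finally have Ag: "1 \<le> A * ?g" .
  then have A0: "A > 0" using g0 by (smt (verit) mult_nonpos_nonneg)
  have "?g \<le> l" "?g \<le> 1 - l" using l by (auto simp: mult_left_le mult_right_le_one_le mult_left_le_one_le)
  then have "A * ?g \<le> A * l" "A * ?g \<le> A * (1 - l)" using A0 by (auto intro!: mult_left_mono simp del: mult_le_cancel_left_pos)
  then have "1 \<le> l * A" "1 \<le> (1 - l) * A" using Ag by (simp_all only: mult.commute[of _ A])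
  then show "1 / A \<le> l" "1 / A \<le> 1 - l" using A0 by (simp_all only: pos_divide_le_eq)
qed

text \<open>Of the exponent 3 \<epsilon> in \<open>L\<close>, one \<epsilon> eventually absorbs the
  constant K and the other two the excess in the bound on the number of edges of \<open>H\<close>;
  the logarithm in the density condition is smaller than any power.\<close>

lemma eventually_forb_bip:
  fixes a \<epsilon> :: real and m n :: "nat \<Rightarrow> nat" and s t :: "nat \<Rightarrow> nat \<Rightarrow> nat" and H :: "nat \<Rightarrow> (nat \<times> nat) set"
  assumes a: "a > 0" and \<epsilon>: "0 < \<epsilon>" "\<epsilon> < 1 / 300"
    and m: "filterlim m at_top sequentially" and n: "filterlim n at_top sequentially"
    and sums: "\<And>N. (\<Sum>j<m N. s N j) = (\<Sum>k<n N. t N k)" and box: "\<And>N. H N \<subseteq> {..<m N} \<times> {..<n N}"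
    and bounds: "\<forall>\<^sub>F N in sequentially.
          (\<forall>j<m N. \<bar>real (s N j) - sbar (m N) (s N)\<bar> \<le> K * real (n N) powr (1/2 + \<epsilon>)
                   \<and> real (deg_u (H N) j) \<le> K * real (n N) powr (1/2 + \<epsilon>)) \<and>
          (\<forall>k<n N. \<bar>real (t N k) - tbar (n N) (t N)\<bar> \<le> K * real (n N) powr (1/2 + \<epsilon>)
                   \<and> real (deg_v (H N) k) \<le> K * real (n N) powr (1/2 + \<epsilon>)) \<and>
          XX (H N) \<le> K * real (n N) powr (1 + 2 * \<epsilon>)"
    and nm: "(\<lambda>N. real (n N)) \<in> o(\<lambda>N. real (m N) powr (1 + \<epsilon>))"
    and mn: "(\<lambda>N. real (m N)) \<in> o(\<lambda>N. real (n N) powr (1 + \<epsilon>))"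
    and dens: "\<forall>\<^sub>F N in sequentially.
          AA (m N) (n N) (s N) > 0 \<and>
          (1 - 2 * lam (m N) (n N) (s N))\<^sup>2 / (8 * AA (m N) (n N) (s N))
            * (1 + 5 * real (m N) / (6 * real (n N)) + 5 * real (n N) / (6 * real (m N)))
          \<le> a * ln (real (n N))"
  shows "\<forall>\<^sub>F N in sequentially. forb_bip (m N) (n N) (s N) (t N) (lam (m N) (n N) (s N))
            (real (n N) powr (3 * \<epsilon>)) (sqrt (real (n N))) (H N)"
proof -
  have x: "filterlim (\<lambda>N. real (n N)) at_top sequentially"
    by (rule filterlim_compose[OF filterlim_real_sequentially n])
  have ev: "\<forall>\<^sub>F N in sequentially. P (real (n N))" if "\<forall>\<^sub>F y in at_top. P y" for P
    using x that by (simp add: filterlim_iff)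
  have m1: "\<forall>\<^sub>F N in sequentially. m N \<ge> 1" using m by (simp add: filterlim_at_top)
  have n1: "\<forall>\<^sub>F N in sequentially. real (n N) \<ge> 1" by (rule ev[OF eventually_ge_at_top])
  have e1: "\<forall>\<^sub>F N in sequentially. real (n N) powr (3 * \<epsilon>) \<ge> 1000"
  proof (rule ev)
    have "filterlim (\<lambda>y::real. y powr (3 * \<epsilon>)) at_top at_top" using \<epsilon> by real_asymp
    then show "\<forall>\<^sub>F y in at_top. 1000 \<le> y powr (3 * \<epsilon>)" by (simp add: filterlim_at_top)
  qed
  have e2: "\<forall>\<^sub>F N in sequentially. K \<le> real (n N) powr \<epsilon>"
  proof (rule ev)
    have "filterlim (\<lambda>y::real. y powr \<epsilon>) at_top at_top" using \<epsilon> by real_asymp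
    then show "\<forall>\<^sub>F y in at_top. K \<le> y powr \<epsilon>" by (simp add: filterlim_at_top)
  qed
  have e3: "\<forall>\<^sub>F N in sequentially. 4 * (1 + a * ln (real (n N))) \<le> real (n N) powr (3 * \<epsilon>)"
    by (rule ev) (use a \<epsilon> in real_asymp)
  have e4: "\<forall>\<^sub>F N in sequentially. real (n N) \<le> real (m N) powr (1 + \<epsilon>)"
    using landau_o.smallD[OF nm, of 1] by simp
  have e5: "\<forall>\<^sub>F N in sequentially. real (m N) \<le> real (n N) powr (1 + \<epsilon>)"
    using landau_o.smallD[OF mn, of 1] by simp
  show ?thesis using m1 n1 e1 e2 e3 e4 e5 bounds dens
  proof eventually_elim
    case (elim N)
    let ?m = "m N" and ?n = "n N" and ?s = "s N" and ?t = "t N" and ?H = "H N"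
    define y where "y = real ?n"
    define L where "L = y powr (3 * \<epsilon>)"
    define l where "l = lam ?m ?n ?s"
    have y1: "y \<ge> 1" and y0: "y > 0" using elim by (auto simp: y_def)
    have mp: "real ?m > 0" using elim by simp
    have sq: "sqrt y = y powr (1/2)" using y0 by (simp add: powr_half_sqrt)
    have Ls: "L * sqrt y = y powr (1/2 + 3 * \<epsilon>)" unfolding L_def sq by (simp add: powr_add[symmetric] add.commute)
    have Kb: "K * y powr (1/2 + \<epsilon>) \<le> L * sqrt y"
    proof -
      have "K * y powr (1/2 + \<epsilon>) \<le> y powr \<epsilon> * y powr (1/2 + \<epsilon>)" using elim by (intro mult_right_mono) (auto simp: y_def)
      also have "\<dots> = y powr (1/2 + 2 * \<epsilon>)" by (simp add: powr_add[symmetric] algebra_simps)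
      also have "\<dots> \<le> y powr (1/2 + 3 * \<epsilon>)" using y1 \<epsilon> by (intro powr_mono) auto
      finally show ?thesis unfolding Ls .
    qed
    have KX: "K * y powr (1 + 2 * \<epsilon>) \<le> L * y"
    proof -
      have "K * y powr (1 + 2 * \<epsilon>) \<le> y powr \<epsilon> * y powr (1 + 2 * \<epsilon>)" using elim by (intro mult_right_mono) (auto simp: y_def)
      also have "\<dots> = y powr (3 * \<epsilon>) * y powr 1"
        unfolding powr_add[symmetric] by (rule arg_cong[where f = "\<lambda>r. y powr r"]) simp
      finally show ?thesis unfolding L_def using y0 by simp
    qed
    have sb: "sbar ?m ?s = l * y" unfolding l_def lam_def y_def using y0 y_def by simp
    have s_sum: "(\<Sum>j<?m. real (?s j)) = l * real ?m * y"
    proof -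
      have "(\<Sum>j<?m. real (?s j)) = sbar ?m ?s * real ?m" unfolding sbar_def using mp by simp
      then show ?thesis unfolding sb by simp
    qed
    have t_sum: "(\<Sum>k<?n. real (?t k)) = l * real ?m * y"
    proof -
      have "(\<Sum>k<?n. real (?t k)) = (\<Sum>j<?m. real (?s j))" using sums[of N] by (simp flip: of_nat_sum)
      then show ?thesis using s_sum by simp
    qed
    have tb: "tbar ?n ?t = l * real ?m" unfolding tbar_def t_sum using y0 by (simp add: y_def)
    have r1: "1 \<le> 1 + 5 * real ?m / (6 * real ?n) + 5 * real ?n / (6 * real ?m)" by simp
    have g: "l * (1 - l) / 2 > 0" "(1 - 2 * l)\<^sup>2 / (8 * (l * (1 - l) / 2)) * (1 + 5 * real ?m / (6 * real ?n) + 5 * real ?n / (6 * real ?m)) \<le> a * ln y"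
      using elim(9) unfolding AA_def l_def y_def by auto
    have A: "4 * (1 + a * ln y) \<le> L" using elim(5) by (simp add: L_def y_def)
    note lb = dense_from_log_bound[OF g(1) r1 g(2) A]
    have "dense_bip ?m ?n ?s ?t l L (sqrt y)"
    proof
      show "(sqrt y)\<^sup>2 = real ?n" by (simp add: y_def)
      show "0 < sqrt y" using y0 by simp
      show "1000 \<le> L" using elim by (simp add: L_def y_def)
      \<comment> \<open>This is the origin of \<epsilon> < 1/300: L^50 has exponent 150 \<epsilon>,
        which must not exceed 1/2.\<close>
      show "L ^ 50 \<le> sqrt y"
      proof -
        have "L ^ 50 = y powr (150 * \<epsilon>)" unfolding L_def using y0 by (simp add: powr_realpow[symmetric] powr_powr)
        also have "\<dots> \<le> y powr (1/2)" using y1 \<epsilon> by (intro powr_mono) auto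
        finally show ?thesis unfolding sq .
      qed
      show "1 / L \<le> l" "1 / L \<le> 1 - l" using lb by auto
      show "real ?m \<le> L * real ?n"
      proof -
        have "real ?m \<le> y powr (1 + \<epsilon>)" using elim by (simp add: y_def)
        also have "\<dots> \<le> y powr (3 * \<epsilon> + 1)" using y1 \<epsilon> by (intro powr_mono) auto
        also have "\<dots> = L * y" unfolding L_def powr_add using y0 by simp
        finally show ?thesis by (simp add: y_def)
      qed
      show "real ?n \<le> L * real ?m"
      proof -
        have "y \<le> real ?m powr (1 + \<epsilon>)" using elim by (simp add: y_def)
        \<comment> \<open>Inverting n \<le> m powr (1 + \<epsilon>) approximately: raised to the
          power 1 - \<epsilon> the exponent of m becomes 1 - \<epsilon>^2, below 1, and the missing
          n powr \<epsilon> is part of \<open>L\<close>.\<close>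
        then have "y powr (1 - \<epsilon>) \<le> (real ?m powr (1 + \<epsilon>)) powr (1 - \<epsilon>)" using y0 \<epsilon> by (intro powr_mono2) auto
        also have "\<dots> = real ?m powr (1 - \<epsilon> * \<epsilon>)" by (simp add: powr_powr algebra_simps)
        also have "\<dots> \<le> real ?m powr 1" using elim(1) \<epsilon> by (intro powr_mono) auto
        finally have "y powr (1 - \<epsilon>) \<le> real ?m" using mp by simp
        then have "y powr \<epsilon> * y powr (1 - \<epsilon>) \<le> L * real ?m"
          unfolding L_def using y1 \<epsilon> by (intro mult_mono powr_mono) auto
        then show ?thesis using y0 by (simp add: powr_add[symmetric] y_def)
      qed
      show "\<bar>real (?s j) - l * real ?n\<bar> \<le> L * sqrt y" if "j < ?m" for j
        using elim(8) that Kb sb unfolding y_def by fastforce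
      show "\<bar>real (?t k) - l * real ?m\<bar> \<le> L * sqrt y" if "k < ?n" for k
        using elim(8) that Kb tb unfolding y_def by fastforce
      show "(\<Sum>j<?m. real (?s j)) = l * real ?m * real ?n" using s_sum by (simp add: y_def)
      show "(\<Sum>k<?n. real (?t k)) = l * real ?m * real ?n" using t_sum by (simp add: y_def)
    qed
    then have "forb_bip ?m ?n ?s ?t l L (sqrt y) ?H"
    proof (rule forb_bip.intro, unfold_locales)
      show "?H \<subseteq> {..<?m} \<times> {..<?n}" by (rule box)
      show "real (card {k. (i,k) \<in> ?H}) \<le> L * sqrt y" if "i < ?m" for i
        using elim(8) that Kb unfolding y_def deg_u_def by fastforce
      show "real (card {i. (i,k) \<in> ?H}) \<le> L * sqrt y" if "k < ?n" for k
        using elim(8) that Kb unfolding y_def deg_v_def by fastforce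
      show "real (card ?H) \<le> L * real ?n" using elim(8) KX unfolding y_def XX_def by linarith
    qed
    then show ?case unfolding l_def L_def y_def .
  qed
qed

lemma error_sequence:
  fixes P X :: "nat \<Rightarrow> real" and n :: "nat \<Rightarrow> nat"
  assumes "\<forall>\<^sub>F N in sequentially. \<exists>E. \<bar>E\<bar> \<le> real (n N) powr (- b) \<and> P N = X N * exp (M N + E)"
  shows "\<exists>E. E \<in> O(\<lambda>N. real (n N) powr (- b)) \<and> (\<forall>\<^sub>F N in sequentially. P N = X N * exp (M N + E N))"
proof -
  \<comment> \<open>For the finitely many N without a suitable error the value is arbitrary; only
    eventual statements are made about it.\<close>
  define E where "E N = (SOME E. \<bar>E\<bar> \<le> real (n N) powr (- b) \<and> P N = X N * exp (M N + E))" for N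
  have ev: "\<forall>\<^sub>F N in sequentially. \<bar>E N\<bar> \<le> real (n N) powr (- b) \<and> P N = X N * exp (M N + E N)"
    using assms unfolding E_def by eventually_elim (rule someI_ex)
  have "E \<in> O(\<lambda>N. real (n N) powr (- b))"
    by (rule bigoI[of _ 1]) (use ev in \<open>auto elim!: eventually_mono\<close>)
  then show ?thesis using ev by (intro exI[of _ E] conjI) (auto elim!: eventually_mono)
qed

theorem theorem2p2:
  fixes a b :: real
  assumes "a > 0" and "b > 0" and "a + b < 1 / 2"
  shows "\<exists>\<epsilon>0>0. \<forall>\<epsilon>::real. 0 < \<epsilon> \<and> \<epsilon> < \<epsilon>0 \<longrightarrow>
    (\<forall>(m :: nat \<Rightarrow> nat) (n :: nat \<Rightarrow> nat) (s :: nat \<Rightarrow> nat \<Rightarrow> nat) (t :: nat \<Rightarrow> nat \<Rightarrow> nat)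
       (H :: nat \<Rightarrow> (nat \<times> nat) set).
      filterlim m at_top sequentially \<longrightarrow>
      filterlim n at_top sequentially \<longrightarrow>
      (\<forall>N. \<forall>j<m N. s N j > 0) \<longrightarrow>
      (\<forall>N. \<forall>k<n N. t N k > 0) \<longrightarrow>
      (\<forall>N. (\<Sum>j<m N. s N j) = (\<Sum>k<n N. t N k)) \<longrightarrow>
      (\<forall>N. H N \<subseteq> {..<m N} \<times> {..<n N}) \<longrightarrow>
      (\<forall>\<^sub>F N in sequentially. bip_graphs (m N) (n N) (s N) (t N) \<noteq> {}) \<longrightarrow>
      (\<exists>K. \<forall>\<^sub>F N in sequentially.
          (\<forall>j<m N. \<bar>real (s N j) - sbar (m N) (s N)\<bar> \<le> K * real (n N) powr (1/2 + \<epsilon>)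
                   \<and> real (deg_u (H N) j) \<le> K * real (n N) powr (1/2 + \<epsilon>)) \<and>
          (\<forall>k<n N. \<bar>real (t N k) - tbar (n N) (t N)\<bar> \<le> K * real (n N) powr (1/2 + \<epsilon>)
                   \<and> real (deg_v (H N) k) \<le> K * real (n N) powr (1/2 + \<epsilon>)) \<and>
          XX (H N) \<le> K * real (n N) powr (1 + 2 * \<epsilon>)) \<longrightarrow>
      (\<lambda>N. real (n N)) \<in> o(\<lambda>N. real (m N) powr (1 + \<epsilon>)) \<longrightarrow>
      (\<lambda>N. real (m N)) \<in> o(\<lambda>N. real (n N) powr (1 + \<epsilon>)) \<longrightarrow>
      (\<forall>\<^sub>F N in sequentially.
          AA (m N) (n N) (s N) > 0 \<and>
          (1 - 2 * lam (m N) (n N) (s N))\<^sup>2 / (8 * AA (m N) (n N) (s N))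
            * (1 + 5 * real (m N) / (6 * real (n N)) + 5 * real (n N) / (6 * real (m N)))
          \<le> a * ln (real (n N))) \<longrightarrow>
      (\<exists>E1 E2 :: nat \<Rightarrow> real.
          E1 \<in> O(\<lambda>N. real (n N) powr (- b)) \<and>
          E2 \<in> O(\<lambda>N. real (n N) powr (- b)) \<and>
          (\<forall>\<^sub>F N in sequentially.
             prob_B (m N) (n N) (s N) (t N) (\<lambda>G. G \<inter> H N = {})
               = (1 - lam (m N) (n N) (s N)) ^ card (H N)
                 * exp (miss_main (m N) (n N) (s N) (t N) (H N) + E1 N) \<and>
             prob_B (m N) (n N) (s N) (t N) (\<lambda>G. H N \<subseteq> G)
               = lam (m N) (n N) (s N) ^ card (H N)
                 * exp (hit_main (m N) (n N) (s N) (t N) (H N) + E2 N))))"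
proof -
  \<comment> \<open>The error L^37 / q equals n powr (111 \<epsilon> - 1/2), so 111 \<epsilon> \<le>
    1/2 - b is needed; since b is positive, the divisor 200 also gives \<epsilon> < 1/400, within
    the bound 1/300.\<close>
  define \<epsilon>0 where "\<epsilon>0 = (1 / 2 - b) / 200"
  have pos: "\<epsilon>0 > 0" using assms by (simp add: \<epsilon>0_def)
  show ?thesis
  proof (rule exI[of _ \<epsilon>0], intro conjI allI impI, rule pos)
    fix \<epsilon> :: real and m n :: "nat \<Rightarrow> nat" and s t :: "nat \<Rightarrow> nat \<Rightarrow> nat" and H :: "nat \<Rightarrow> (nat \<times> nat) set"
    assume eps: "0 < \<epsilon> \<and> \<epsilon> < \<epsilon>0" and m: "filterlim m at_top sequentially" and n: "filterlim n at_top sequentially"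
      and sums: "\<forall>N. (\<Sum>j<m N. s N j) = (\<Sum>k<n N. t N k)" and box: "\<forall>N. H N \<subseteq> {..<m N} \<times> {..<n N}"
      and ne: "\<forall>\<^sub>F N in sequentially. bip_graphs (m N) (n N) (s N) (t N) \<noteq> {}"
      and bounds: "\<exists>K. \<forall>\<^sub>F N in sequentially.
          (\<forall>j<m N. \<bar>real (s N j) - sbar (m N) (s N)\<bar> \<le> K * real (n N) powr (1/2 + \<epsilon>)
                   \<and> real (deg_u (H N) j) \<le> K * real (n N) powr (1/2 + \<epsilon>)) \<and>
          (\<forall>k<n N. \<bar>real (t N k) - tbar (n N) (t N)\<bar> \<le> K * real (n N) powr (1/2 + \<epsilon>)
                   \<and> real (deg_v (H N) k) \<le> K * real (n N) powr (1/2 + \<epsilon>)) \<and>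
          XX (H N) \<le> K * real (n N) powr (1 + 2 * \<epsilon>)"
      and nm: "(\<lambda>N. real (n N)) \<in> o(\<lambda>N. real (m N) powr (1 + \<epsilon>))"
      and mn: "(\<lambda>N. real (m N)) \<in> o(\<lambda>N. real (n N) powr (1 + \<epsilon>))"
      and dens: "\<forall>\<^sub>F N in sequentially.
          AA (m N) (n N) (s N) > 0 \<and>
          (1 - 2 * lam (m N) (n N) (s N))\<^sup>2 / (8 * AA (m N) (n N) (s N))
            * (1 + 5 * real (m N) / (6 * real (n N)) + 5 * real (n N) / (6 * real (m N)))
          \<le> a * ln (real (n N))"
    obtain K where K: "\<forall>\<^sub>F N in sequentially.
          (\<forall>j<m N. \<bar>real (s N j) - sbar (m N) (s N)\<bar> \<le> K * real (n N) powr (1/2 + \<epsilon>)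
                   \<and> real (deg_u (H N) j) \<le> K * real (n N) powr (1/2 + \<epsilon>)) \<and>
          (\<forall>k<n N. \<bar>real (t N k) - tbar (n N) (t N)\<bar> \<le> K * real (n N) powr (1/2 + \<epsilon>)
                   \<and> real (deg_v (H N) k) \<le> K * real (n N) powr (1/2 + \<epsilon>)) \<and>
          XX (H N) \<le> K * real (n N) powr (1 + 2 * \<epsilon>)" using bounds by blast
    have eps2: "\<epsilon> < 1 / 300" "111 * \<epsilon> - 1 / 2 \<le> - b" using eps assms by (auto simp: \<epsilon>0_def)
    have fb: "\<forall>\<^sub>F N in sequentially. forb_bip (m N) (n N) (s N) (t N) (lam (m N) (n N) (s N))
            (real (n N) powr (3 * \<epsilon>)) (sqrt (real (n N))) (H N)"
      by (rule eventually_forb_bip[OF assms(1) _ eps2(1) m n _ _ K nm mn dens]) (use eps sums box in auto)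
    have n1: "\<forall>\<^sub>F N in sequentially. n N \<ge> 1" using n by (simp add: filterlim_at_top)
    have small: "(real k powr (3 * \<epsilon>)) ^ 37 / sqrt (real k) \<le> real k powr (- b)" if "k \<ge> 1" for k :: nat
    proof -
      have "(real k powr (3 * \<epsilon>)) ^ 37 / sqrt (real k) = real k powr (111 * \<epsilon> - 1 / 2)"
        using that by (simp add: powr_realpow[symmetric] powr_powr powr_diff powr_half_sqrt)
      also have "\<dots> \<le> real k powr (- b)" using that eps2 by (intro powr_mono) auto
      finally show ?thesis .
    qed
    have miss: "\<forall>\<^sub>F N in sequentially. \<exists>E. \<bar>E\<bar> \<le> real (n N) powr (- b) \<and>
        prob_B (m N) (n N) (s N) (t N) (\<lambda>G. G \<inter> H N = {}) = (1 - lam (m N) (n N) (s N)) ^ card (H N) * exp (miss_main (m N) (n N) (s N) (t N) (H N) + E)"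
      using fb ne n1
    proof eventually_elim
      case (elim N)
      from dense_bip.prob_miss[OF forb_bip.axioms(1)[OF elim(1)] elim(1,2)] small[OF elim(3)]
      show ?case by (meson order_trans)
    qed
    have hit: "\<forall>\<^sub>F N in sequentially. \<exists>E. \<bar>E\<bar> \<le> real (n N) powr (- b) \<and>
        prob_B (m N) (n N) (s N) (t N) (\<lambda>G. H N \<subseteq> G) = lam (m N) (n N) (s N) ^ card (H N) * exp (hit_main (m N) (n N) (s N) (t N) (H N) + E)"
      using fb ne n1
    proof eventually_elim
      case (elim N)
      from prob_hit[OF elim(1,2)] small[OF elim(3)] show ?case by (meson order_trans)
    qed
    obtain E1 where E1: "E1 \<in> O(\<lambda>N. real (n N) powr (- b))" "\<forall>\<^sub>F N in sequentially.
        prob_B (m N) (n N) (s N) (t N) (\<lambda>G. G \<inter> H N = {}) = (1 - lam (m N) (n N) (s N)) ^ card (H N) * exp (miss_main (m N) (n N) (s N) (t N) (H N) + E1 N)"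
      using error_sequence[OF miss] by blast
    obtain E2 where E2: "E2 \<in> O(\<lambda>N. real (n N) powr (- b))" "\<forall>\<^sub>F N in sequentially.
        prob_B (m N) (n N) (s N) (t N) (\<lambda>G. H N \<subseteq> G) = lam (m N) (n N) (s N) ^ card (H N) * exp (hit_main (m N) (n N) (s N) (t N) (H N) + E2 N)"
      using error_sequence[OF hit] by blast
    show "\<exists>E1 E2 :: nat \<Rightarrow> real.
          E1 \<in> O(\<lambda>N. real (n N) powr (- b)) \<and>
          E2 \<in> O(\<lambda>N. real (n N) powr (- b)) \<and>
          (\<forall>\<^sub>F N in sequentially.
             prob_B (m N) (n N) (s N) (t N) (\<lambda>G. G \<inter> H N = {})
               = (1 - lam (m N) (n N) (s N)) ^ card (H N)
                 * exp (miss_main (m N) (n N) (s N) (t N) (H N) + E1 N) \<and>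
             prob_B (m N) (n N) (s N) (t N) (\<lambda>G. H N \<subseteq> G)
               = lam (m N) (n N) (s N) ^ card (H N)
                 * exp (hit_main (m N) (n N) (s N) (t N) (H N) + E2 N))"
      using E1 E2 by (intro exI[of _ E1] exI[of _ E2] conjI) (auto intro: eventually_conj)
  qed
qed

end
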